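(* Let $1\leq p, q_1,q_2\leq \infty$ and $\frac{1}{r}=\frac{1}{p}+\frac{1}{q_1}+\frac{1}{q_2}$. Let $q_{\max}=\max(q_1,q_2)$ and $q_{\min}=\min(q_1,q_2)$, and assume $q_{\max} \geq p'$. Let $a\in L^p S^m_\varrho(n,2)$ with $0\leq \varrho\leq 1$ and \[ m< n(\varrho-1)\left(\frac{1}{\min(2,q_{\max},p)}+\frac{1}{\min\big(2,q_{\min},\frac{p q_{\max} }{q_{\max}+p}\big)}\right), \] with the convention that if $p=\infty$ then $\frac{p q_{\max}}{q_{\max}+p}=q_{\max}$. Then the bilinear pseudodifferential operator \[ T_{a} (f,g)(x)= \iint a(x,\xi,\eta)\, e^{ i \langle x,\xi+\eta\rangle} \widehat{ f}(\xi) \widehat{g}(\eta)\,d \xi\, d\eta \] satisfies $\|T_a(f,g)\|_{L^r}\leq C_{a,n} \|f\|_{L^{q_1}}\|g\|_{L^{q_2}}$ for every $f,g\in \mathcal{S}$.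
   Context: $p'$ is the conjugate exponent of $p$. $L^pS^m_\varrho(n,2)$: functions $a(x,\xi,\eta)$, $x,\xi,\eta\in\mathbb{R}^n$, such that for all multi-indices $\alpha_1,\alpha_2$, $\|\partial_{\xi}^{\alpha_1}\partial_{\eta}^{\alpha_2}a(\cdot,\xi,\eta)\|_{L^p}\le C_{\alpha_1,\alpha_2}(1+|\xi|+|\eta|)^{m-\varrho(|\alpha_1|+|\alpha_2|)}$. *)

theory Defs
  imports "HOL-Analysis.Analysis" "HOL-Probability.Essential_Supremum"
begin

text \<open>Directional (partial) derivative along a vector b, and iterated partial derivatives
  along a list of basis vectors (a multi-index written as a list of directions).\<close>

definition partial :: "'a::euclidean_space \<Rightarrow> ('a \<Rightarrow> 'b::real_normed_vector) \<Rightarrow> 'a \<Rightarrow> 'b" where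
  "partial b f x = vector_derivative (\<lambda>t::real. f (x + t *\<^sub>R b)) (at 0)"

fun iter_partial :: "'a::euclidean_space list \<Rightarrow> ('a \<Rightarrow> 'b::real_normed_vector) \<Rightarrow> 'a \<Rightarrow> 'b" where
  "iter_partial [] f = f"
| "iter_partial (b # bs) f = partial b (iter_partial bs f)"

definition schwartz :: "('a::euclidean_space \<Rightarrow> complex) \<Rightarrow> bool" where
  "schwartz f \<longleftrightarrow>
     (\<forall>bs. set bs \<subseteq> Basis \<longrightarrow> (\<forall>x. iter_partial bs f differentiable (at x))) \<and>
     (\<forall>bs (k::nat). set bs \<subseteq> Basis \<longrightarrow>
        bounded (range (\<lambda>x. norm x ^ k * norm (iter_partial bs f x))))"

definition Lp_norm :: "ennreal \<Rightarrow> ('a::euclidean_space \<Rightarrow> 'b::real_normed_vector) \<Rightarrow> ennreal" where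
  "Lp_norm p f =
     (if p = \<infinity> then esssup lborel (\<lambda>x. ennreal (norm (f x)))
      else (let I = (\<integral>\<^sup>+ x. ennreal (norm (f x) powr enn2real p) \<partial>lborel)
            in if I = \<infinity> then \<infinity> else ennreal (enn2real I powr (1 / enn2real p))))"

definition conj_exp :: "ennreal \<Rightarrow> ennreal" where
  "conj_exp p = inverse (1 - inverse p)"

definition fourier :: "('a::euclidean_space \<Rightarrow> complex) \<Rightarrow> 'a \<Rightarrow> complex" where
  "fourier f \<xi> = (\<integral> x. f x * cis (- (x \<bullet> \<xi>)) \<partial>lborel)"

text \<open>The symbol class L^p S^m_\<rho>(n,2): the symbol is viewed, for fixed x, as a function of
  (\<xi>,\<eta>) \<in> 'a \<times> 'a; a list of basis vectors of 'a \<times> 'a is a pair of multi-indices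
  (\<alpha>1,\<alpha>2) with |\<alpha>1|+|\<alpha>2| = its length.\<close>

definition LpS :: "ennreal \<Rightarrow> real \<Rightarrow> real \<Rightarrow> ('a::euclidean_space \<Rightarrow> 'a \<Rightarrow> 'a \<Rightarrow> complex) \<Rightarrow> bool" where
  "LpS p m \<rho> a \<longleftrightarrow>
     (\<forall>x bs. set bs \<subseteq> Basis \<longrightarrow>
        (\<forall>z. iter_partial bs (\<lambda>z. a x (fst z) (snd z)) differentiable (at z))) \<and>
     (\<forall>bs. set bs \<subseteq> (Basis :: ('a \<times> 'a) set) \<longrightarrow>
        (\<forall>\<xi> \<eta>. (\<lambda>x. iter_partial bs (\<lambda>z. a x (fst z) (snd z)) (\<xi>, \<eta>)) \<in> borel_measurable lborel) \<and>
        (\<exists>C. \<forall>\<xi> \<eta>. Lp_norm p (\<lambda>x. iter_partial bs (\<lambda>z. a x (fst z) (snd z)) (\<xi>, \<eta>))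
                 \<le> ennreal (C * (1 + norm \<xi> + norm \<eta>) powr (m - \<rho> * real (length bs)))))"

definition bilinear_pdo :: "('a::euclidean_space \<Rightarrow> 'a \<Rightarrow> 'a \<Rightarrow> complex) \<Rightarrow>
    ('a \<Rightarrow> complex) \<Rightarrow> ('a \<Rightarrow> complex) \<Rightarrow> 'a \<Rightarrow> complex" where
  "bilinear_pdo a f g x =
     (\<integral> z. a x (fst z) (snd z) * cis (x \<bullet> (fst z + snd z)) * fourier f (fst z) * fourier g (snd z)
        \<partial>(lborel :: ('a \<times> 'a) measure))"

end

theory Submission
  imports Defs "HOL-Probability.Probability"
begin

text \<open>
  Fix x and split the symbol dyadically, R = 2^k, into pieces living on |(\<xi>,\<eta>)| of size R.
  A piece oscillates at scale R^\<rho>, so integrating by parts twice in every coordinate of (\<xi>,\<eta>)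
  replaces f and g by f w(x - .) and g w(x - .), where w is the integrable weight
  \<Prod> 1/(1 + (R^\<rho> y_b)^2), at the price of a symbol Q with the same size R^m.
  Hoelder's inequality in (\<xi>,\<eta>) against the L^p norm of Q, together with the Hausdorff-Young
  inequality for the two localised functions, bounds the piece pointwise by a product of an L^p
  function and two local averages of f and g. The k-th piece contributes
  R^(m + n(1 - \<rho>)(1/s1 + 1/s2)), where s1 and s2 are the two minima in the hypothesis on m,
  and this is a convergent geometric series.
\<close>

section \<open>Lebesgue norms of functions with values in the extended reals\<close>

text \<open>The index 1/r may exceed 1; then L^r has no triangle inequality and the pieces cannot be
  summed there. So the three factors of the pointwise bound are summed separately, in L^p, L^q1 and
  L^q2, each series receiving a third of the exponential gain, and Hoelder's inequality in x is
  applied only afterwards, to the product of the three sums. Exponents, with \<sigma>i = 1/si: the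
  L^p majorant of the symbol costs R^(2n/p), a power of the volume of the frequency cube.
  Hausdorff-Young lands at index 1 - \<sigma>i, while duality with L^p asks for 1 - 1/p; closing
  that gap on a cube costs R^(n(\<sigma>i - 1/p)) for each function. The averages gain R^(-\<rho> n
  \<sigma>i). The terms in 1/p cancel, leaving R^(m + n(1 - \<rho>)(\<sigma>1 + \<sigma>2)). One
  integration by parts per coordinate would only give (1 + (R^\<rho> y_b)^2)^(-1/2), which is not
  integrable; two give an integrable weight. Hence the cutoff must have two derivatives in each
  coordinate, which a piecewise quintic provides.\<close>

definition epow :: "ennreal \<Rightarrow> real \<Rightarrow> ennreal" where
  "epow x c = (if x = \<infinity> then \<infinity> else ennreal (enn2real x powr c))"

lemma epow_ennreal: "0 \<le> x \<Longrightarrow> epow (ennreal x) c = ennreal (x powr c)"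
  by (simp add: epow_def)

lemma epow_top [simp]: "epow \<infinity> c = \<infinity>" "epow \<top> c = \<top>"
  by (simp_all add: epow_def)

lemma epow_0 [simp]: "epow 0 c = 0"
  by (simp add: epow_def)

lemma epow_1 [simp]: "epow x 1 = x"
  by (cases x) (simp_all add: epow_def)

lemma epow_one [simp]: "epow 1 c = 1"
  by (simp add: epow_def)

lemma epow_eq_top_iff [simp]: "epow x c = \<top> \<longleftrightarrow> x = \<top>"
  by (auto simp: epow_def)

lemma epow_eq_0_iff [simp]: "epow x c = 0 \<longleftrightarrow> x = 0"
  by (cases x) (auto simp: epow_def ennreal_eq_0_iff)

lemma epow_mono: "0 \<le> c \<Longrightarrow> x \<le> y \<Longrightarrow> epow x c \<le> epow y c"
  by (cases x; cases y) (auto simp: epow_def top_unique powr_mono2 intro!: ennreal_leI)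

text \<open>No side condition: every power, of whatever sign, fixes both 0 and infinity, and this is
  compatible with 0 * infinity = 0. The rules for iterated powers and sums of exponents are
  unconditional for the same reason.\<close>

lemma epow_mult: "epow (x * y) c = epow x c * epow y c"
proof (cases "x = 0 \<or> y = 0")
  case False
  then show ?thesis
    by (cases x; cases y)
       (auto simp: epow_def ennreal_mult[symmetric] powr_mult ennreal_top_mult ennreal_mult_top)
qed auto

lemma epow_epow: "epow (epow x c) d = epow x (c * d)"
  by (cases x) (auto simp: epow_def powr_powr)

lemma epow_add: "epow x (c + d) = epow x c * epow x d"
  by (cases x) (auto simp: epow_def powr_add ennreal_mult[symmetric] ennreal_top_mult)

lemma borel_measurable_epow [measurable]:
  assumes [measurable]: "f \<in> borel_measurable M"
  shows "(\<lambda>x. epow (f x) c) \<in> borel_measurable M"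
proof -
  have [measurable]: "{x \<in> space M. f x = \<infinity>} \<in> sets M"
    using measurable_sets[OF assms, of "{\<infinity>}"] by (simp add: vimage_def Int_def conj_commute)
  show ?thesis unfolding epow_def by (rule measurable_If) measurable
qed

abbreviation ennorm :: "'a::real_normed_vector \<Rightarrow> ennreal" where
  "ennorm z \<equiv> ennreal (norm z)"

text \<open>
  The norm is indexed by the reciprocal exponent \<theta> = 1/p, so that p = \<infinity> is \<theta> = 0 and
  Hoelder's inequality adds the indices.
\<close>

definition Lq :: "real \<Rightarrow> 'a measure \<Rightarrow> ('a \<Rightarrow> ennreal) \<Rightarrow> ennreal" where
  "Lq \<theta> M h = (if \<theta> = 0 then esssup M h else epow (\<integral>\<^sup>+ x. epow (h x) (1 / \<theta>) \<partial>M) \<theta>)"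

abbreviation nLq :: "real \<Rightarrow> ('a::euclidean_space \<Rightarrow> 'b::real_normed_vector) \<Rightarrow> ennreal" where
  "nLq \<theta> f \<equiv> Lq \<theta> lborel (\<lambda>x. ennorm (f x))"

lemma Lq_0: "Lq 0 M h = esssup M h"
  by (simp add: Lq_def)

lemma Lq_pos: "\<theta> \<noteq> 0 \<Longrightarrow> Lq \<theta> M h = epow (\<integral>\<^sup>+ x. epow (h x) (1 / \<theta>) \<partial>M) \<theta>"
  by (simp add: Lq_def)

lemma Lq_1: "Lq 1 M h = (\<integral>\<^sup>+ x. h x \<partial>M)"
  by (simp add: Lq_def)

lemma epow_Lq: "0 < \<theta> \<Longrightarrow> epow (Lq \<theta> M h) (1 / \<theta>) = (\<integral>\<^sup>+ x. epow (h x) (1 / \<theta>) \<partial>M)"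
  by (simp add: Lq_def epow_epow)

lemma Lp_norm_eq_Lq:
  assumes "p \<noteq> 0"
  shows "Lp_norm p f = Lq (enn2real (inverse p)) lborel (\<lambda>x. ennorm (f x))"
proof (cases "p = \<infinity>")
  case False
  then obtain s where s: "p = ennreal s" "0 < s"
    using assms by (cases p) (auto simp: less_le)
  then have e: "enn2real (inverse p) = 1 / s"
    by (simp add: inverse_ennreal divide_simps)
  show ?thesis
    unfolding e using s
    by (auto simp: Lp_norm_def Lq_def Let_def epow_def)
qed (simp add: Lp_norm_def Lq_def)

text \<open>Measurability of the smaller function matters at \<theta> = 0, because
  \<open>esssup\<close> is \<open>\<top>\<close> on nonmeasurable functions.\<close>

lemma Lq_mono_AE:
  assumes "0 \<le> \<theta>" "f \<in> borel_measurable M" "AE x in M. f x \<le> g x"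
  shows "Lq \<theta> M f \<le> Lq \<theta> M g"
proof (cases "\<theta> = 0")
  case True
  then show ?thesis using assms by (simp add: Lq_0 esssup_AE_mono)
next
  case False
  have "(\<integral>\<^sup>+ x. epow (f x) (1 / \<theta>) \<partial>M) \<le> (\<integral>\<^sup>+ x. epow (g x) (1 / \<theta>) \<partial>M)"
    using assms by (intro nn_integral_mono_AE) (auto elim!: eventually_mono intro!: epow_mono)
  then show ?thesis using False assms by (simp add: Lq_pos epow_mono)
qed

lemma Lq_mono:
  assumes "0 \<le> \<theta>" "f \<in> borel_measurable M" "\<And>x. f x \<le> g x"
  shows "Lq \<theta> M f \<le> Lq \<theta> M g"
  using assms by (intro Lq_mono_AE) auto

lemma Lq_cmult_le:
  assumes "0 \<le> \<theta>" and [measurable]: "f \<in> borel_measurable M"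
  shows "Lq \<theta> M (\<lambda>x. c * f x) \<le> c * Lq \<theta> M f"
proof (cases "\<theta> = 0")
  case True
  have "AE x in M. c * f x \<le> c * esssup M f"
    using esssup_AE[of f M] by (rule eventually_mono) (auto intro: mult_left_mono)
  then show ?thesis using True by (auto simp: Lq_0)
next
  case False
  have "(\<integral>\<^sup>+ x. epow (c * f x) (1 / \<theta>) \<partial>M) = epow c (1/\<theta>) * (\<integral>\<^sup>+ x. epow (f x) (1 / \<theta>) \<partial>M)"
    by (simp add: epow_mult nn_integral_cmult)
  then show ?thesis using False by (simp add: Lq_pos epow_mult epow_epow)
qed

lemma Lq_zero [simp]: "0 \<le> \<theta> \<Longrightarrow> Lq \<theta> M (\<lambda>x. 0) = 0"
  using Lq_cmult_le[of \<theta> "\<lambda>x. 0" M 0] by simp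

lemma ennreal_Young:
  assumes "0 < a" "0 < b" "a + b = 1"
  shows "x * y \<le> ennreal a * epow x (1/a) + ennreal b * epow y (1/b)"
proof (cases "x = \<top> \<or> y = \<top>")
  case True
  then show ?thesis using assms by (auto simp: ennreal_mult_top)
next
  case False
  then obtain u v where uv: "x = ennreal u" "y = ennreal v" "0 \<le> u" "0 \<le> v"
    by (cases x; cases y) auto
  have "u * v \<le> a * u powr (1/a) + b * v powr (1/b)"
  proof (cases "u = 0 \<or> v = 0")
    case True
    then show ?thesis using assms by auto
  next
    case False
    have "u * v \<le> u powr (1/a) / (1/a) + v powr (1/b) / (1/b)"
      using uv False assms by (intro Youngs_inequality) (auto simp: field_simps)
    then show ?thesis by (simp add: mult.commute)
  qed
  then show ?thesis using uv assms
    by (simp add: epow_ennreal ennreal_mult[symmetric] ennreal_plus[symmetric] ennreal_leI del: ennreal_plus)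
qed

text \<open>Both factors are normalised to norm one and Young's inequality is integrated. The norms
  0 and infinity are treated first, as the normalisation divides by them.\<close>

lemma nn_integral_Holder:
  assumes "0 < a" "0 < b" "a + b = 1"
    and [measurable]: "f \<in> borel_measurable M" "g \<in> borel_measurable M"
  shows "(\<integral>\<^sup>+ x. f x * g x \<partial>M) \<le>
     epow (\<integral>\<^sup>+ x. epow (f x) (1/a) \<partial>M) a * epow (\<integral>\<^sup>+ x. epow (g x) (1/b) \<partial>M) b"
    (is "_ \<le> epow ?F a * epow ?G b")
proof (cases "?F = 0 \<or> ?G = 0")
  case True
  then have "AE x in M. f x * g x = 0"
    by (auto simp: nn_integral_0_iff_AE elim: eventually_mono)
  then have "(\<integral>\<^sup>+ x. f x * g x \<partial>M) = 0" by (subst nn_integral_0_iff_AE) auto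
  then show ?thesis by simp
next
  case nz: False
  show ?thesis
  proof (cases "?F = \<top> \<or> ?G = \<top>")
    case True
    then show ?thesis using nz by (auto simp: ennreal_mult_top ennreal_top_mult)
  next
    case False
    define A where "A = epow ?F a"
    define B where "B = epow ?G b"
    have AB: "A \<noteq> 0" "A \<noteq> \<top>" "B \<noteq> 0" "B \<noteq> \<top>" using nz False by (auto simp: A_def B_def)
    have pA: "epow A (1/a) = ?F" "epow B (1/b) = ?G"
      using assms by (simp_all add: A_def B_def epow_epow)
    have iA: "epow (f x / A) (1/a) = epow (f x) (1/a) / ?F" for x
    proof -
      have "epow (f x) (1/a) = epow (f x / A * A) (1/a)" using AB
        by (metis ennreal_divide_times ennreal_times_divide mult.commute mult_divide_eq_ennreal)
      then have "epow (f x) (1/a) = epow (f x / A) (1/a) * ?F" by (simp only: epow_mult pA)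
      then show ?thesis using nz False by (simp add: mult_divide_eq_ennreal)
    qed
    have iB: "epow (g x / B) (1/b) = epow (g x) (1/b) / ?G" for x
    proof -
      have "epow (g x) (1/b) = epow (g x / B * B) (1/b)" using AB
        by (metis ennreal_divide_times ennreal_times_divide mult.commute mult_divide_eq_ennreal)
      then have "epow (g x) (1/b) = epow (g x / B) (1/b) * ?G" by (simp only: epow_mult pA)
      then show ?thesis using nz False by (simp add: mult_divide_eq_ennreal)
    qed
    have "(\<integral>\<^sup>+ x. (f x / A) * (g x / B) \<partial>M) \<le>
       (\<integral>\<^sup>+ x. ennreal a * epow (f x / A) (1/a) + ennreal b * epow (g x / B) (1/b) \<partial>M)"
      using assms by (intro nn_integral_mono ennreal_Young)
    also have "\<dots> = ennreal a * (?F / ?F) + ennreal b * (?G / ?G)"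
      unfolding iA iB by (simp add: nn_integral_add nn_integral_cmult nn_integral_divide)
    also have "\<dots> = 1" using nz False assms
      by (simp add: ennreal_divide_self less_top ennreal_plus[symmetric] del: ennreal_plus)
    finally have le: "(\<integral>\<^sup>+ x. (f x / A) * (g x / B) \<partial>M) \<le> 1" .
    have "f x * g x = (A * B) * ((f x / A) * (g x / B))" for x
      using AB by (metis (no_types, lifting) ennreal_divide_times ennreal_times_divide mult.assoc mult.commute mult_divide_eq_ennreal)
    then have "(\<integral>\<^sup>+ x. f x * g x \<partial>M) = (A * B) * (\<integral>\<^sup>+ x. (f x / A) * (g x / B) \<partial>M)"
      by (simp add: nn_integral_cmult)
    also have "\<dots> \<le> (A * B) * 1" by (intro mult_left_mono le) auto
    finally show ?thesis by (simp add: A_def B_def)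
  qed
qed

text \<open>The indices may add up to more than 1, which covers target exponents below 1.\<close>

lemma Lq_Holder:
  assumes "0 \<le> a" "0 \<le> b"
    and [measurable]: "f \<in> borel_measurable M" "g \<in> borel_measurable M"
  shows "Lq (a + b) M (\<lambda>x. f x * g x) \<le> Lq a M f * Lq b M g"
proof -
  consider "a = 0" | "b = 0" | "0 < a" "0 < b" using assms by linarith
  then show ?thesis
  proof cases
    case 1
    have "AE x in M. f x * g x \<le> Lq a M f * g x"
      unfolding 1 Lq_0 using esssup_AE[of f M] by (rule eventually_mono) (auto intro: mult_right_mono)
    then have "Lq (a + b) M (\<lambda>x. f x * g x) \<le> Lq b M (\<lambda>x. Lq a M f * g x)"
      using assms 1 by (auto intro: Lq_mono_AE)
    also have "\<dots> \<le> Lq a M f * Lq b M g" using assms by (intro Lq_cmult_le)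
    finally show ?thesis .
  next
    case 2
    have "AE x in M. f x * g x \<le> Lq b M g * f x"
      unfolding 2 Lq_0 using esssup_AE[of g M]
      by (rule eventually_mono) (auto simp: mult.commute intro: mult_left_mono)
    then have "Lq (a + b) M (\<lambda>x. f x * g x) \<le> Lq a M (\<lambda>x. Lq b M g * f x)"
      using assms 2 by (auto intro: Lq_mono_AE)
    also have "\<dots> \<le> Lq b M g * Lq a M f" using assms by (intro Lq_cmult_le)
    finally show ?thesis by (simp add: mult.commute)
  next
    case 3
    \<comment> \<open>Raising everything to the power 1/r reduces to the conjugate pair a/r,
      b/r.\<close>
    define r where "r = a + b"
    have r: "0 < r" using 3 by (simp add: r_def)
    have "(\<integral>\<^sup>+ x. epow (f x) (1/r) * epow (g x) (1/r) \<partial>M) \<le>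
      epow (\<integral>\<^sup>+ x. epow (epow (f x) (1/r)) (1/(a/r)) \<partial>M) (a/r) *
      epow (\<integral>\<^sup>+ x. epow (epow (g x) (1/r)) (1/(b/r)) \<partial>M) (b/r)"
      using 3 r by (intro nn_integral_Holder) (auto simp: r_def add_divide_distrib[symmetric])
    also have "\<dots> = epow (\<integral>\<^sup>+ x. epow (f x) (1/a) \<partial>M) (a/r) * epow (\<integral>\<^sup>+ x. epow (g x) (1/b) \<partial>M) (b/r)"
      using r 3 by (simp add: epow_epow)
    finally have "epow (\<integral>\<^sup>+ x. epow (f x * g x) (1/r) \<partial>M) r \<le>
       epow (epow (\<integral>\<^sup>+ x. epow (f x) (1/a) \<partial>M) (a/r) * epow (\<integral>\<^sup>+ x. epow (g x) (1/b) \<partial>M) (b/r)) r"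
      using r by (intro epow_mono) (auto simp: epow_mult)
    then show ?thesis using r 3 by (simp add: Lq_pos r_def[symmetric] epow_mult epow_epow)
  qed
qed

text \<open>Jensen's inequality for an unnormalised weight \<open>k\<close>, from Hoelder applied to
  k h = k^(1-a) (k^a h). It serves both for series (counting measure) and for averages against
  \<open>wt\<close>.\<close>

lemma nn_integral_Jensen:
  assumes "0 < a" "a \<le> 1"
    and [measurable]: "k \<in> borel_measurable M" "h \<in> borel_measurable M"
  shows "epow (\<integral>\<^sup>+ x. k x * h x \<partial>M) (1/a) \<le>
      epow (\<integral>\<^sup>+ x. k x \<partial>M) (1/a - 1) * (\<integral>\<^sup>+ x. k x * epow (h x) (1/a) \<partial>M)"
proof (cases "a = 1")
  case True
  \<comment> \<open>The factor \<open>epow _ 0\<close> is at least 1 unless its base is 0, where it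
    is 0; then the weight vanishes almost everywhere.\<close>
  show ?thesis
  proof (cases "(\<integral>\<^sup>+ x. k x \<partial>M) = 0")
    case k0: True
    then have "AE x in M. k x = 0" by (simp add: nn_integral_0_iff_AE)
    then have "AE x in M. k x * h x = 0" by (rule eventually_mono) auto
    then have "(\<integral>\<^sup>+ x. k x * h x \<partial>M) = 0" by (subst nn_integral_0_iff_AE) auto
    then show ?thesis by simp
  next
    case False
    then have "1 \<le> epow (\<integral>\<^sup>+ x. k x \<partial>M) 0"
      by (auto simp: epow_def enn2real_eq_0_iff)
    then show ?thesis using True
      mult_right_mono[of 1 "epow (\<integral>\<^sup>+ x. k x \<partial>M) 0" "\<integral>\<^sup>+ x. k x * h x \<partial>M"] by simp
  qed
next
  case False
  then have a: "0 < a" "a < 1" using assms by auto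
  have "k x * h x = epow (k x) (1 - a) * (epow (k x) a * h x)" for x
    using epow_add[of "k x" "1 - a" a] by (metis mult.assoc diff_add_cancel epow_1)
  then have "(\<integral>\<^sup>+ x. k x * h x \<partial>M) = (\<integral>\<^sup>+ x. epow (k x) (1 - a) * (epow (k x) a * h x) \<partial>M)"
    by simp
  also have "\<dots> \<le> epow (\<integral>\<^sup>+ x. epow (epow (k x) (1 - a)) (1/(1-a)) \<partial>M) (1-a) *
      epow (\<integral>\<^sup>+ x. epow (epow (k x) a * h x) (1/a) \<partial>M) a"
    using a by (intro nn_integral_Holder) auto
  also have "\<dots> = epow (\<integral>\<^sup>+ x. k x \<partial>M) (1-a) * epow (\<integral>\<^sup>+ x. k x * epow (h x) (1/a) \<partial>M) a"
    using a by (simp add: epow_epow epow_mult)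
  finally have "epow (\<integral>\<^sup>+ x. k x * h x \<partial>M) (1/a) \<le>
     epow (epow (\<integral>\<^sup>+ x. k x \<partial>M) (1-a) * epow (\<integral>\<^sup>+ x. k x * epow (h x) (1/a) \<partial>M) a) (1/a)"
    using a by (intro epow_mono) auto
  then show ?thesis using a by (simp add: epow_mult epow_epow diff_divide_distrib)
qed

lemma suminf_Jensen:
  fixes c h :: "nat \<Rightarrow> ennreal"
  assumes "0 < a" "a \<le> 1"
  shows "epow (\<Sum>k. c k * h k) (1/a) \<le> epow (\<Sum>k. c k) (1/a - 1) * (\<Sum>k. c k * epow (h k) (1/a))"
  using nn_integral_Jensen[of a c "count_space UNIV" h] assms
  by (simp add: nn_integral_count_space_nat)

text \<open>A substitute for countable Minkowski when the terms share a bound \<open>S\<close>: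
  Jensen with weights \<open>c k\<close> moves the power inside the series, and integration is then
  termwise. The exponent 1/a is at least 1 here.\<close>

lemma Lq_suminf_le:
  fixes c :: "nat \<Rightarrow> ennreal"
  assumes a: "0 \<le> a" "a \<le> 1" and [measurable]: "\<And>k. h k \<in> borel_measurable M"
    and S: "\<And>k. Lq a M (h k) \<le> S"
  shows "Lq a M (\<lambda>x. \<Sum>k. c k * h k x) \<le> (\<Sum>k. c k) * S"
proof (cases "a = 0")
  case True
  have "AE x in M. h k x \<le> S" for k
    using esssup_AE[of "h k" M] S[of k] True by (auto simp: Lq_0 elim: eventually_mono)
  then have "AE x in M. \<forall>k. h k x \<le> S" by (simp add: AE_all_countable)
  then have "AE x in M. (\<Sum>k. c k * h k x) \<le> (\<Sum>k. c k) * S"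
  proof (rule eventually_mono)
    fix x assume "\<forall>k. h k x \<le> S"
    then have "(\<Sum>k. c k * h k x) \<le> (\<Sum>k. c k * S)"
      by (intro suminf_le mult_left_mono) auto
    then show "(\<Sum>k. c k * h k x) \<le> (\<Sum>k. c k) * S" by simp
  qed
  then show ?thesis using True by (auto simp: Lq_0)
next
  case False
  then have a: "0 < a" "a \<le> 1" using a by auto
  define A where "A = (\<Sum>k. c k)"
  have "(\<integral>\<^sup>+ x. epow (\<Sum>k. c k * h k x) (1/a) \<partial>M) \<le>
     (\<integral>\<^sup>+ x. epow A (1/a - 1) * (\<Sum>k. c k * epow (h k x) (1/a)) \<partial>M)"
    unfolding A_def by (intro nn_integral_mono suminf_Jensen a)
  also have "\<dots> = epow A (1/a - 1) * (\<Sum>k. c k * (\<integral>\<^sup>+ x. epow (h k x) (1/a) \<partial>M))"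
    by (simp add: nn_integral_cmult nn_integral_suminf)
  also have "\<dots> \<le> epow A (1/a - 1) * (\<Sum>k. c k * epow S (1/a))"
  proof (intro mult_left_mono suminf_le)
    fix k show "(\<integral>\<^sup>+ x. epow (h k x) (1/a) \<partial>M) \<le> epow S (1/a)"
      using S[of k] a by (subst epow_Lq[symmetric]) (auto intro: epow_mono)
  qed auto
  also have "\<dots> = epow (A * S) (1/a)"
    using epow_add[of A "1/a - 1" 1] by (simp add: A_def epow_mult mult.assoc)
  finally have "Lq a M (\<lambda>x. \<Sum>k. c k * h k x) \<le> epow (epow (A * S) (1/a)) a"
    using a by (auto simp: Lq_pos intro: epow_mono)
  then show ?thesis using a by (simp add: epow_epow A_def)
qed

text \<open>The series bound with coefficients 1, 1, 1, 0, 0, ...; three terms are what one Leibniz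
  step produces.\<close>

lemma Lq_add3_le:
  assumes a: "0 \<le> a" "a \<le> 1"
    and [measurable]: "f \<in> borel_measurable M" "g \<in> borel_measurable M" "h \<in> borel_measurable M"
    and S: "Lq a M f \<le> S" "Lq a M g \<le> S" "Lq a M h \<le> S"
  shows "Lq a M (\<lambda>x. f x + g x + h x) \<le> 3 * S"
proof -
  define c :: "nat \<Rightarrow> ennreal" where "c k = (if k < 3 then 1 else 0)" for k
  define H where "H k = (if k = 0 then f else if k = 1 then g else h)" for k :: nat
  have *: "(\<Sum>k. c k * u k) = u 0 + u 1 + u 2" for u :: "nat \<Rightarrow> ennreal"
  proof -
    have "(\<Sum>k. c k * u k) = (\<Sum>k<3. c k * u k)"
      by (rule suminf_finite) (auto simp: c_def)
    then show ?thesis by (simp add: c_def eval_nat_numeral)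
  qed
  have "Lq a M (\<lambda>x. \<Sum>k. c k * H k x) \<le> (\<Sum>k. c k) * S"
    using assms by (intro Lq_suminf_le) (auto simp: H_def)
  moreover have "(\<Sum>k. c k) = 3" using *[of "\<lambda>_. 1"] by simp
  ultimately show ?thesis by (simp add: * H_def)
qed

text \<open>Separates the frequency variables \<xi> and \<eta>, so that Hausdorff-Young can be used
  for each function alone.\<close>

lemma Lq_tensor_le:
  fixes M :: "'a measure" and N :: "'b measure"
  assumes "sigma_finite_measure M" "sigma_finite_measure N" "0 \<le> a"
    and [measurable]: "f \<in> borel_measurable M" "g \<in> borel_measurable N"
  shows "Lq a (M \<Otimes>\<^sub>M N) (\<lambda>z. f (fst z) * g (snd z)) \<le> Lq a M f * Lq a N g"
proof -
  interpret M: sigma_finite_measure M by fact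
  interpret N: sigma_finite_measure N by fact
  interpret P: pair_sigma_finite M N by standard
  show ?thesis
  proof (cases "a = 0")
    case True
    have 1: "AE z in M \<Otimes>\<^sub>M N. f (fst z) \<le> esssup M f"
    proof (rule P.AE_pair_measure)
      show "AE x in M. AE y in N. f (fst (x, y)) \<le> esssup M f"
        using esssup_AE[of f M] by (rule eventually_mono) simp
    qed measurable
    have 2: "AE z in M \<Otimes>\<^sub>M N. g (snd z) \<le> esssup N g"
    proof (rule P.AE_pair_measure)
      show "AE x in M. AE y in N. g (snd (x, y)) \<le> esssup N g"
        using esssup_AE[of g N] by simp
    qed measurable
    have "AE z in M \<Otimes>\<^sub>M N. f (fst z) * g (snd z) \<le> esssup M f * esssup N g"
      using 1 2 by eventually_elim (auto intro: mult_mono)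
    then show ?thesis using True by (auto simp: Lq_0)
  next
    case False
    have "(\<integral>\<^sup>+ z. epow (f (fst z) * g (snd z)) (1/a) \<partial>(M \<Otimes>\<^sub>M N)) =
      (\<integral>\<^sup>+ x. \<integral>\<^sup>+ y. epow (f x) (1/a) * epow (g y) (1/a) \<partial>N \<partial>M)"
      by (subst N.nn_integral_fst[symmetric]) (auto simp: epow_mult)
    also have "\<dots> = (\<integral>\<^sup>+ x. epow (f x) (1/a) \<partial>M) * (\<integral>\<^sup>+ y. epow (g y) (1/a) \<partial>N)"
      by (simp add: nn_integral_cmult nn_integral_multc)
    finally show ?thesis using False by (simp add: Lq_pos epow_mult)
  qed
qed

section \<open>Fourier transforms and the Plancherel inequality\<close>

lemma nn_integral_lborel_reflect:
  fixes x :: "'a::euclidean_space"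
  assumes [measurable]: "f \<in> borel_measurable borel"
  shows "(\<integral>\<^sup>+ y. f (x - y) \<partial>lborel) = (\<integral>\<^sup>+ y. f y \<partial>lborel)"
  by (subst (2) lborel_affine[of "-1" x]) (simp_all add: nn_integral_density nn_integral_distr)

lemma nn_integral_lborel_shift:
  fixes x :: "'a::euclidean_space"
  assumes [measurable]: "f \<in> borel_measurable borel"
  shows "(\<integral>\<^sup>+ y. f (y - x) \<partial>lborel) = (\<integral>\<^sup>+ y. f y \<partial>lborel)"
  by (subst (2) lborel_affine[of "1" "-x"]) (simp_all add: nn_integral_density nn_integral_distr)

lemma integrable_lborel_measurable:
  fixes f :: "'a::euclidean_space \<Rightarrow> 'b::{banach,second_countable_topology}"
  shows "integrable lborel f \<Longrightarrow> f \<in> borel_measurable borel"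
  using borel_measurable_integrable[of lborel f] by simp

lemma lborel_integral_prod:
  fixes f :: "'a::euclidean_space \<Rightarrow> real \<Rightarrow> 'b::{real_normed_field,banach,second_countable_topology}"
  assumes "\<And>b. b \<in> Basis \<Longrightarrow> integrable lborel (f b)"
  shows "(\<integral>x. (\<Prod>b\<in>Basis. f b (x \<bullet> b)) \<partial>lborel) = (\<Prod>b\<in>Basis. \<integral>t. f b t \<partial>lborel)"
proof -
  interpret product_sigma_finite "\<lambda>_::'a. lborel :: real measure" ..
  have [measurable]: "b \<in> Basis \<Longrightarrow> f b \<in> borel_measurable borel" for b
    using borel_measurable_integrable[OF assms] by simp
  have "(\<integral>x. (\<Prod>b\<in>Basis. f b (x \<bullet> b)) \<partial>lborel) =
     (\<integral>x. (\<Prod>b\<in>Basis. f b ((\<Sum>b\<in>Basis. x b *\<^sub>R b) \<bullet> b)) \<partial>(\<Pi>\<^sub>M b\<in>Basis. lborel))"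
    by (subst lborel_eq, subst integral_distr) (auto intro!: borel_measurable_prod)
  also have "\<dots> = (\<integral>x. (\<Prod>b\<in>Basis. f b (x b)) \<partial>(\<Pi>\<^sub>M b\<in>Basis. lborel))"
    by (simp add: inner_sum_left inner_Basis if_distrib cong: if_cong)
  also have "\<dots> = (\<Prod>b\<in>Basis. \<integral>t. f b t \<partial>lborel)"
    using assms by (intro product_integral_prod) auto
  finally show ?thesis .
qed

text \<open>A product of rescaled Cauchy densities up to normalisation. It is the squared modulus of
  \<Prod> 1/(1 + i \<delta> v_b), the factor left by two integrations by parts in each
  coordinate.\<close>

definition wt :: "real \<Rightarrow> 'a::euclidean_space \<Rightarrow> real" where
  "wt \<delta> v = (\<Prod>b\<in>Basis. inverse (1 + (\<delta> * (v \<bullet> b))\<^sup>2))"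

lemma wt_pos: "0 < wt \<delta> v"
  unfolding wt_def by (intro prod_pos) (auto intro: add_pos_nonneg)

lemma wt_le_1: "wt \<delta> v \<le> 1"
  unfolding wt_def by (intro prod_le_1) (auto intro: inverse_le_1_iff[THEN iffD2])

lemma borel_measurable_wt [measurable]: "wt \<delta> \<in> borel_measurable borel"
  unfolding wt_def by measurable

lemma nn_integral_inverse_1_plus_square:
  "(\<integral>\<^sup>+ t. ennreal (inverse (1 + t\<^sup>2)) \<partial>lborel) = ennreal pi"
proof -
  have i: "integrable lborel (\<lambda>t::real. inverse (1 + t\<^sup>2))"
    using integrable_inverse_1_plus_square by (simp add: set_integrable_def)
  moreover have "(\<integral> t. inverse (1 + t\<^sup>2) \<partial>lborel) = pi"
    using LBINT_inverse_1_plus_square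
    by (simp add: interval_lebesgue_integral_def set_lebesgue_integral_def)
  ultimately show ?thesis by (simp add: nn_integral_eq_integral)
qed

lemma nn_integral_wt:
  assumes "0 < \<delta>"
  shows "(\<integral>\<^sup>+ v. ennreal (wt \<delta> (v::'a::euclidean_space)) \<partial>lborel) = ennreal ((pi / \<delta>) ^ DIM('a))"
proof -
  have 1: "(\<integral>\<^sup>+ t. ennreal (inverse (1 + (\<delta> * t)\<^sup>2)) \<partial>lborel) = ennreal (pi / \<delta>)"
  proof -
    have "ennreal pi = ennreal \<delta> * (\<integral>\<^sup>+ t. ennreal (inverse (1 + (\<delta> * t)\<^sup>2)) \<partial>lborel)"
      using nn_integral_real_affine[of "\<lambda>t. ennreal (inverse (1 + t\<^sup>2))" \<delta> 0] assms
      by (simp add: nn_integral_inverse_1_plus_square)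
    then have "ennreal (1/\<delta>) * ennreal pi = ennreal (1/\<delta>) * ennreal \<delta> * (\<integral>\<^sup>+ t. ennreal (inverse (1 + (\<delta> * t)\<^sup>2)) \<partial>lborel)"
      by (simp add: mult.assoc)
    then show ?thesis using assms by (simp add: ennreal_mult[symmetric])
  qed
  have "(\<integral>\<^sup>+ v. ennreal (wt \<delta> (v::'a)) \<partial>lborel) =
     (\<integral>\<^sup>+ v. (\<Prod>b\<in>Basis. ennreal (inverse (1 + (\<delta> * ((v::'a) \<bullet> b))\<^sup>2))) \<partial>lborel)"
    unfolding wt_def by (simp add: prod_ennreal)
  also have "\<dots> = (\<Prod>b\<in>(Basis::'a set). \<integral>\<^sup>+ t. ennreal (inverse (1 + (\<delta> * t)\<^sup>2)) \<partial>lborel)"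
    by (rule nn_integral_lborel_prod) auto
  also have "\<dots> = ennreal ((pi / \<delta>) ^ DIM('a))"
    using assms by (simp add: 1 ennreal_power)
  finally show ?thesis .
qed

lemma borel_measurable_cis [measurable]: "cis \<in> borel_measurable borel"
  by (intro borel_measurable_continuous_onI) (simp add: continuous_on_cis)

lemma borel_measurable_fourier [measurable]:
  fixes f :: "'a::euclidean_space \<Rightarrow> complex"
  assumes [measurable]: "f \<in> borel_measurable borel"
  shows "fourier f \<in> borel_measurable borel"
  unfolding fourier_def by measurable

lemma norm_fourier_le:
  assumes "integrable lborel f"
  shows "norm (fourier f \<xi>) \<le> (\<integral> x. norm (f x) \<partial>lborel)"
  unfolding fourier_def by (rule integral_norm_bound[THEN order_trans]) (simp add: norm_mult)

lemma integrable_cis_mult: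
  fixes f :: "'a::euclidean_space \<Rightarrow> complex"
  assumes "integrable lborel f" and [measurable]: "\<phi> \<in> borel_measurable borel"
  shows "integrable lborel (\<lambda>x. f x * cis (\<phi> x))"
  by (rule Bochner_Integration.integrable_bound[OF assms(1)]) (use assms in \<open>auto simp: norm_mult\<close>)

lemma fourier_add:
  assumes "integrable lborel f" "integrable lborel g"
  shows "fourier (\<lambda>x. f x + g x) \<xi> = fourier f \<xi> + fourier g \<xi>"
  unfolding fourier_def distrib_right
  by (intro Bochner_Integration.integral_add integrable_cis_mult assms) measurable

lemma integrable_pair_mult:
  fixes u :: "'a::euclidean_space \<Rightarrow> complex" and h :: "'b::euclidean_space \<Rightarrow> complex"
  assumes u: "integrable lborel u" and h: "integrable lborel h"
  shows "integrable (lborel \<Otimes>\<^sub>M lborel) (\<lambda>z. u (fst z) * h (snd z))"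
proof (rule integrableI_bounded)
  note [measurable] = integrable_lborel_measurable[OF u] integrable_lborel_measurable[OF h]
  show "(\<lambda>z. u (fst z) * h (snd z)) \<in> borel_measurable (lborel \<Otimes>\<^sub>M lborel)" by measurable
  have "(\<integral>\<^sup>+ z. ennorm (u (fst z) * h (snd z)) \<partial>(lborel \<Otimes>\<^sub>M lborel)) =
     (\<integral>\<^sup>+ x. \<integral>\<^sup>+ y. ennorm (u x) * ennorm (h y) \<partial>lborel \<partial>lborel)"
    by (subst lborel.nn_integral_fst[symmetric]) (auto simp: norm_mult ennreal_mult)
  also have "\<dots> = (\<integral>\<^sup>+ x. ennorm (u x) \<partial>lborel) * (\<integral>\<^sup>+ x. ennorm (h x) \<partial>lborel)"
    by (simp add: nn_integral_cmult nn_integral_multc)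
  also have "\<dots> < \<infinity>" using u h by (simp add: integrable_iff_bounded ennreal_mult_less_top)
  finally show "(\<integral>\<^sup>+ z. ennorm (u (fst z) * h (snd z)) \<partial>(lborel \<Otimes>\<^sub>M lborel)) < \<infinity>" .
qed

text \<open>The phase is real, so \<open>cis\<close> has modulus one and the integrand is dominated
  by the tensor product of \<open>u\<close> and \<open>h\<close>; Fubini applies.\<close>

lemma integral_swap_cis:
  fixes u :: "'a::euclidean_space \<Rightarrow> complex" and h :: "'b::euclidean_space \<Rightarrow> complex"
  assumes u: "integrable lborel u" and h: "integrable lborel h"
    and E: "(\<lambda>z. E (fst z) (snd z)) \<in> borel_measurable (borel \<Otimes>\<^sub>M borel)"
  shows "(\<integral>z. u z * (\<integral>v. h v * cis (E z v) \<partial>lborel) \<partial>lborel) =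
    (\<integral>v. h v * (\<integral>z. u z * cis (E z v) \<partial>lborel) \<partial>lborel)"
proof -
  note [measurable] = integrable_lborel_measurable[OF u] integrable_lborel_measurable[OF h]
  have [measurable]: "(\<lambda>z. E (fst z) (snd z)) \<in> borel_measurable (lborel \<Otimes>\<^sub>M lborel)"
    using E by (simp cong: measurable_cong_sets)
  have i: "integrable (lborel \<Otimes>\<^sub>M lborel) (\<lambda>(z, v). u z * h v * cis (E z v))"
    by (rule Bochner_Integration.integrable_bound[OF integrable_pair_mult[OF u h]])
       (auto simp: norm_mult split_beta)
  have "(\<integral>z. u z * (\<integral>v. h v * cis (E z v) \<partial>lborel) \<partial>lborel) =
      (\<integral>z. (\<integral>v. u z * h v * cis (E z v) \<partial>lborel) \<partial>lborel)"
    by (simp add: mult.assoc)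
  also have "\<dots> = (\<integral>v. (\<integral>z. u z * h v * cis (E z v) \<partial>lborel) \<partial>lborel)"
    using lborel_pair.Fubini_integral[OF i] by simp
  also have "\<dots> = (\<integral>v. h v * (\<integral>z. u z * cis (E z v) \<partial>lborel) \<partial>lborel)"
    by (simp add: mult.assoc mult.left_commute)
  finally show ?thesis .
qed

section \<open>Gaussian regularisation and the Plancherel inequality\<close>

definition gau :: "real \<Rightarrow> 'a::euclidean_space \<Rightarrow> real" where
  "gau \<epsilon> \<xi> = (\<Prod>b\<in>Basis. exp (- ((\<epsilon> * (\<xi> \<bullet> b))\<^sup>2 / 2)))"

lemma gau_pos: "0 < gau \<epsilon> \<xi>"
  unfolding gau_def by (intro prod_pos) auto

lemma borel_measurable_gau [measurable]: "gau \<epsilon> \<in> borel_measurable borel"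
  unfolding gau_def by measurable

lemma nn_integral_gauss_1d:
  assumes "0 < \<epsilon>"
  shows "(\<integral>\<^sup>+ t. ennreal (exp (- ((\<epsilon> * t)\<^sup>2 / 2))) \<partial>lborel) = ennreal (sqrt (2 * pi) / \<epsilon>)"
proof -
  have "ennreal (exp (- ((\<epsilon> * t)\<^sup>2 / 2))) = ennreal (sqrt (2 * pi) / \<epsilon>) * ennreal (normal_density 0 (1/\<epsilon>) t)" for t
    using assms by (simp add: normal_density_def ennreal_mult[symmetric] real_sqrt_divide field_simps)
  then show ?thesis using assms
    by (simp add: nn_integral_cmult nn_integral_eq_integral)
qed

lemma nn_integral_gau:
  assumes "0 < \<epsilon>"
  shows "(\<integral>\<^sup>+ v. ennreal (gau \<epsilon> (v::'a::euclidean_space)) \<partial>lborel) = ennreal ((sqrt (2 * pi) / \<epsilon>) ^ DIM('a))"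
proof -
  have "(\<integral>\<^sup>+ v. ennreal (gau \<epsilon> (v::'a)) \<partial>lborel) =
     (\<integral>\<^sup>+ v. (\<Prod>b\<in>Basis. ennreal (exp (- ((\<epsilon> * ((v::'a) \<bullet> b))\<^sup>2 / 2)))) \<partial>lborel)"
    unfolding gau_def by (simp add: prod_ennreal)
  also have "\<dots> = (\<Prod>b\<in>(Basis::'a set). \<integral>\<^sup>+ t. ennreal (exp (- ((\<epsilon> * t)\<^sup>2 / 2))) \<partial>lborel)"
    by (rule nn_integral_lborel_prod) auto
  also have "\<dots> = ennreal ((sqrt (2 * pi) / \<epsilon>) ^ DIM('a))"
    using assms by (simp add: nn_integral_gauss_1d ennreal_power)
  finally show ?thesis .
qed

lemma integrable_gau: "0 < \<epsilon> \<Longrightarrow> integrable lborel (gau \<epsilon>)"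
  by (rule integrableI_bounded) (auto simp: nn_integral_gau less_imp_le[OF gau_pos])

lemma integrable_gauss_1d: "0 < \<epsilon> \<Longrightarrow> integrable lborel (\<lambda>t::real. exp (- ((\<epsilon> * t)\<^sup>2 / 2)))"
  by (rule integrableI_bounded) (auto simp: nn_integral_gauss_1d)

text \<open>After rescaling by \<epsilon> this is the characteristic function of the standard normal
  distribution.\<close>

lemma integral_gauss_cis_1d:
  assumes e: "0 < \<epsilon>"
  shows "(\<integral> t. cis (v * t) * complex_of_real (exp (- ((\<epsilon> * t)\<^sup>2 / 2))) \<partial>lborel) =
    complex_of_real (sqrt (2 * pi) / \<epsilon> * exp (- ((v / \<epsilon>)\<^sup>2 / 2)))"
proof -
  have "(\<integral> t. cis (v * t) * complex_of_real (exp (- ((\<epsilon> * t)\<^sup>2 / 2))) \<partial>lborel) =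
     (1/\<epsilon>) *\<^sub>R (\<integral> t. cis (v / \<epsilon> * t) * complex_of_real (exp (- (t\<^sup>2 / 2))) \<partial>lborel)"
    using lborel_integral_real_affine[of "1/\<epsilon>" "\<lambda>t. cis (v * t) * complex_of_real (exp (- ((\<epsilon> * t)\<^sup>2 / 2)))" 0] e
    by simp
  also have "(\<integral> t. cis (v / \<epsilon> * t) * complex_of_real (exp (- (t\<^sup>2 / 2))) \<partial>lborel) =
     (\<integral> t. sqrt (2 * pi) *\<^sub>R (std_normal_density t *\<^sub>R cis (v / \<epsilon> * t)) \<partial>lborel)"
    by (intro Bochner_Integration.integral_cong refl)
       (simp add: std_normal_density_def scaleR_conv_of_real)
  also have "\<dots> = sqrt (2 * pi) *\<^sub>R (\<integral> t. std_normal_density t *\<^sub>R cis (v / \<epsilon> * t) \<partial>lborel)"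
    by (rule integral_scaleR_right)
  also have "(\<integral> t. std_normal_density t *\<^sub>R cis (v / \<epsilon> * t) \<partial>lborel) = char std_normal_distribution (v/\<epsilon>)"
    unfolding char_def by (subst integral_density) (auto simp: cis_conv_exp mult_ac)
  finally show ?thesis
    by (simp add: char_std_normal_distribution scaleR_conv_of_real)
qed

lemma integral_gau_cis:
  fixes v :: "'a::euclidean_space"
  assumes e: "0 < \<epsilon>"
  shows "(\<integral> \<xi>. complex_of_real (gau \<epsilon> \<xi>) * cis (\<xi> \<bullet> v) \<partial>lborel) =
    complex_of_real ((sqrt (2 * pi) / \<epsilon>) ^ DIM('a) * gau (1/\<epsilon>) v)"
proof -
  have cp: "cis (\<Sum>b\<in>A. f b) = (\<Prod>b\<in>A. cis (f b))" for A and f :: "'a \<Rightarrow> real"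
    by (induction A rule: infinite_finite_induct) (auto simp: cis_mult[symmetric])
  have "(\<integral> \<xi>. complex_of_real (gau \<epsilon> \<xi>) * cis (\<xi> \<bullet> v) \<partial>lborel) =
     (\<integral> \<xi>. (\<Prod>b\<in>Basis. cis ((v \<bullet> b) * (\<xi> \<bullet> b)) * complex_of_real (exp (- ((\<epsilon> * (\<xi> \<bullet> b))\<^sup>2 / 2)))) \<partial>lborel)"
    by (subst euclidean_inner) (simp add: gau_def cp prod.distrib mult.commute)
  also have "\<dots> = (\<Prod>b\<in>Basis. \<integral> t. cis ((v \<bullet> b) * t) * complex_of_real (exp (- ((\<epsilon> * t)\<^sup>2 / 2))) \<partial>lborel)"
  proof (rule lborel_integral_prod[of "\<lambda>b t. cis ((v \<bullet> b) * t) * complex_of_real (exp (- ((\<epsilon> * t)\<^sup>2 / 2)))"])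
    fix b :: 'a
    show "integrable lborel (\<lambda>t. cis ((v \<bullet> b) * t) * complex_of_real (exp (- ((\<epsilon> * t)\<^sup>2 / 2))))"
      by (rule Bochner_Integration.integrable_bound[OF integrable_gauss_1d[OF e]]) (auto simp: norm_mult)
  qed
  also have "\<dots> = complex_of_real ((sqrt (2 * pi) / \<epsilon>) ^ DIM('a) * gau (1/\<epsilon>) v)"
    unfolding integral_gauss_cis_1d[OF e] by (simp add: gau_def prod.distrib power_divide prod_dividef)
  finally show ?thesis .
qed

lemma borel_measurable_cnj [measurable]: "cnj \<in> borel_measurable borel"
  by (intro borel_measurable_continuous_onI continuous_intros)

text \<open>No integrability is assumed: otherwise the Bochner integral is 0 by convention.\<close>

lemma ennreal_norm_integral_le:
  fixes f :: "'a \<Rightarrow> 'b::{banach, second_countable_topology}"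
  shows "ennorm (\<integral>x. f x \<partial>M) \<le> (\<integral>\<^sup>+x. ennorm (f x) \<partial>M)"
  by (cases "integrable M f") (auto simp: integral_norm_bound_ennreal not_integrable_integral_eq)

text \<open>
  The Gaussian factor makes the double integral absolutely convergent; the resulting positive kernel
  has mass \<open>(2 * pi) ^ DIM('a)\<close>, independent of \<epsilon>, so Schur's test applies.
\<close>

lemma fourier_norm_square_gau_le:
  fixes g :: "'a::euclidean_space \<Rightarrow> complex"
  assumes g: "integrable lborel g" and e: "0 < \<epsilon>"
  shows "(\<integral>\<^sup>+ \<xi>. ennreal ((norm (fourier g \<xi>))\<^sup>2 * gau \<epsilon> \<xi>) \<partial>lborel) \<le>
    ennreal ((2 * pi) ^ DIM('a)) * (\<integral>\<^sup>+ y. ennreal ((norm (g y))\<^sup>2) \<partial>lborel)"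
proof -
  let ?N = "ennreal ((2 * pi) ^ DIM('a)) * (\<integral>\<^sup>+ y. ennreal ((norm (g y))\<^sup>2) \<partial>lborel)"
  note [measurable] = integrable_lborel_measurable[OF g]
  define c where "c = (\<integral> x. norm (g x) \<partial>lborel)"
  define G :: "'a \<Rightarrow> real" where "G v = (sqrt (2 * pi) / \<epsilon>) ^ DIM('a) * gau (1/\<epsilon>) v" for v
  have [measurable]: "G \<in> borel_measurable borel" unfolding G_def by measurable
  let ?J = "\<lambda>y. \<integral>y'. cnj (g y') * complex_of_real (G (y' - y)) \<partial>lborel"
  have G0: "0 \<le> G v" for v using e by (auto simp: G_def intro!: mult_nonneg_nonneg less_imp_le[OF gau_pos])
  have Gm: "G (x - y) = G (y - x)" for x y
    unfolding G_def gau_def by (simp add: inner_diff_left power2_eq_square algebra_simps)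
  \<comment> \<open>The Gaussian and its transform contribute reciprocal powers of \<epsilon>, which
    cancel.\<close>
  have IG: "(\<integral>\<^sup>+ v. ennreal (G v) \<partial>lborel) = ennreal ((2 * pi) ^ DIM('a))"
  proof -
    have "(\<integral>\<^sup>+ v. ennreal (G v) \<partial>lborel) =
        ennreal ((sqrt (2 * pi) / \<epsilon>) ^ DIM('a)) * ennreal ((sqrt (2 * pi) / (1/\<epsilon>)) ^ DIM('a))"
    proof -
      have "ennreal (G v) = ennreal ((sqrt (2 * pi) / \<epsilon>) ^ DIM('a)) * ennreal (gau (1/\<epsilon>) v)" for v
        unfolding G_def using e by (intro ennreal_mult less_imp_le[OF gau_pos]) auto
      then show ?thesis using e by (simp only:) (subst nn_integral_cmult, auto simp: nn_integral_gau)
    qed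
    also have "\<dots> = ennreal ((sqrt (2 * pi) / \<epsilon> * (sqrt (2 * pi) / (1/\<epsilon>))) ^ DIM('a))"
      using e by (simp only: power_mult_distrib) (subst ennreal_mult, auto)
    also have "sqrt (2 * pi) / \<epsilon> * (sqrt (2 * pi) / (1/\<epsilon>)) = 2 * pi"
      using e by simp
    finally show ?thesis .
  qed
  have c: "norm (fourier g \<xi>) \<le> c" for \<xi> unfolding c_def by (rule norm_fourier_le[OF g])
  have c0: "0 \<le> c" unfolding c_def by simp
  have bi: "integrable lborel (\<lambda>\<xi>. complex_of_real (gau \<epsilon> \<xi>) * u \<xi>)"
    if [measurable]: "u \<in> borel_measurable borel" and b: "\<And>\<xi>. norm (u \<xi>) \<le> B" for u :: "'a \<Rightarrow> complex" and B
  proof (rule Bochner_Integration.integrable_bound)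
    show "integrable lborel (\<lambda>\<xi>::'a. B * gau \<epsilon> \<xi>)" using integrable_gau[OF e, where ?'a='a] by simp
    show "AE \<xi> in lborel. norm (complex_of_real (gau \<epsilon> \<xi>) * u \<xi>) \<le> norm (B * gau \<epsilon> \<xi>)"
      using b by (intro AE_I2) (auto simp: norm_mult abs_mult mult.commute intro!: mult_right_mono order_trans[OF b])
  qed measurable
  have cnj: "cnj (fourier g \<xi>) = (\<integral>y. cnj (g y) * cis (y \<bullet> \<xi>) \<partial>lborel)" for \<xi>
    unfolding fourier_def Bochner_Integration.integral_cnj[symmetric] by (simp add: cis_cnj del: Bochner_Integration.integral_cnj)
  define I where "I = (\<integral>\<xi>. (complex_of_real (gau \<epsilon> \<xi>) * cnj (fourier g \<xi>)) * fourier g \<xi> \<partial>lborel)"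
  \<comment> \<open>Both transforms are opened in turn; the remaining frequency integral is the
    Gaussian transform, so \<open>I\<close> becomes a quadratic form in \<open>g\<close> with kernel
    \<open>G\<close>.\<close>
  have "I = (\<integral>y. g y * (\<integral>\<xi>. (complex_of_real (gau \<epsilon> \<xi>) * cnj (fourier g \<xi>)) * cis (- (y \<bullet> \<xi>)) \<partial>lborel) \<partial>lborel)"
    unfolding I_def fourier_def[of g]
    by (subst integral_swap_cis[OF _ g])
       (auto simp: fourier_def[symmetric] c intro!: bi[of _ c])
  also have "\<dots> = (\<integral>y. g y * (?J y) \<partial>lborel)"
  proof (rule Bochner_Integration.integral_cong[OF refl], rule arg_cong2[where f = "(*)", OF refl])
    fix y :: 'a
    have "(\<integral>\<xi>. (complex_of_real (gau \<epsilon> \<xi>) * cnj (fourier g \<xi>)) * cis (- (y \<bullet> \<xi>)) \<partial>lborel) =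
        (\<integral>\<xi>. (complex_of_real (gau \<epsilon> \<xi>) * cis (- (y \<bullet> \<xi>))) * (\<integral>y'. cnj (g y') * cis (y' \<bullet> \<xi>) \<partial>lborel) \<partial>lborel)"
      by (simp add: cnj mult_ac)
    also have "\<dots> = (\<integral>y'. cnj (g y') * (\<integral>\<xi>. (complex_of_real (gau \<epsilon> \<xi>) * cis (- (y \<bullet> \<xi>))) * cis (y' \<bullet> \<xi>) \<partial>lborel) \<partial>lborel)"
      using g by (intro integral_swap_cis bi[of _ 1]) auto
    also have "\<dots> = (?J y)"
    proof -
      have "cis (- (y \<bullet> \<xi>)) * cis (y' \<bullet> \<xi>) = cis (\<xi> \<bullet> (y' - y))" for y' \<xi>
        by (simp add: cis_mult inner_diff_right inner_commute)
      then show ?thesis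
        using integral_gau_cis[OF e, where ?'a='a] by (simp add: mult.assoc G_def)
    qed
    finally show "(\<integral>\<xi>. (complex_of_real (gau \<epsilon> \<xi>) * cnj (fourier g \<xi>)) * cis (- (y \<bullet> \<xi>)) \<partial>lborel) =
       (?J y)" .
  qed
  finally have I: "I = (\<integral>y. g y * (?J y) \<partial>lborel)" .
  have "ennreal (norm I) \<le> (\<integral>\<^sup>+y. ennorm (g y * (?J y)) \<partial>lborel)"
    unfolding I by (rule ennreal_norm_integral_le)
  also have "\<dots> \<le> (\<integral>\<^sup>+y. ennorm (g y) * (\<integral>\<^sup>+y'. ennorm (g y') * ennreal (G (y' - y)) \<partial>lborel) \<partial>lborel)"
  proof (intro nn_integral_mono)
    fix y
    have "ennorm (?J y) \<le>
      (\<integral>\<^sup>+y'. ennorm (cnj (g y') * complex_of_real (G (y' - y))) \<partial>lborel)"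
      by (rule ennreal_norm_integral_le)
    also have "\<dots> = (\<integral>\<^sup>+y'. ennorm (g y') * ennreal (G (y' - y)) \<partial>lborel)"
      by (simp add: norm_mult G0 ennreal_mult)
    finally show "ennorm (g y * (?J y)) \<le>
       ennorm (g y) * (\<integral>\<^sup>+y'. ennorm (g y') * ennreal (G (y' - y)) \<partial>lborel)"
      by (simp add: norm_mult ennreal_mult mult_left_mono)
  qed
  finally have nI: "ennreal (norm I) \<le> (\<integral>\<^sup>+y. \<integral>\<^sup>+y'. ennreal (norm (g y) * norm (g y') * G (y' - y)) \<partial>lborel \<partial>lborel)"
    by (simp add: nn_integral_cmult[symmetric] ennreal_mult G0 mult.assoc)
  \<comment> \<open>Schur's test by 2ab <= a^2 + b^2. The kernel is even, and its argument in the
    second term is reversed so that after exchanging the integrals both terms have the same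
    shape.\<close>
  have AB: "2 * ennreal (norm (g y) * norm (g y') * G (y' - y)) \<le>
       ennreal ((norm (g y))\<^sup>2) * ennreal (G (y' - y)) + ennreal ((norm (g y'))\<^sup>2) * ennreal (G (y - y'))" for y y'
  proof -
    have "2 * (norm (g y) * norm (g y')) \<le> (norm (g y))\<^sup>2 + (norm (g y'))\<^sup>2"
      using sum_squares_bound[of "norm (g y)" "norm (g y')"] by simp
    then have "2 * (norm (g y) * norm (g y')) * G (y' - y) \<le> ((norm (g y))\<^sup>2 + (norm (g y'))\<^sup>2) * G (y' - y)"
      by (rule mult_right_mono) (rule G0)
    then show ?thesis
      by (subst Gm[of y y'])
         (simp add: ennreal_mult[symmetric] ennreal_plus[symmetric] G0 distrib_right numeral_mult_ennreal
           del: ennreal_plus)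
  qed
  have two: "(2::ennreal) \<noteq> 0"
    by (metis add_eq_0_iff_both_eq_0 one_add_one one_neq_zero)
  have "2 * ennreal (norm I) \<le> (\<integral>\<^sup>+y. \<integral>\<^sup>+y'. 2 * ennreal (norm (g y) * norm (g y') * G (y' - y)) \<partial>lborel \<partial>lborel)"
    using nI by (simp add: nn_integral_cmult mult_left_mono)
  also have "\<dots> \<le> (\<integral>\<^sup>+y. \<integral>\<^sup>+y'. ennreal ((norm (g y))\<^sup>2) * ennreal (G (y' - y)) + ennreal ((norm (g y'))\<^sup>2) * ennreal (G (y - y')) \<partial>lborel \<partial>lborel)"
    by (intro nn_integral_mono AB)
  also have "\<dots> = (\<integral>\<^sup>+y. \<integral>\<^sup>+y'. ennreal ((norm (g y))\<^sup>2) * ennreal (G (y' - y)) \<partial>lborel \<partial>lborel) +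
     (\<integral>\<^sup>+y. \<integral>\<^sup>+y'. ennreal ((norm (g y'))\<^sup>2) * ennreal (G (y - y')) \<partial>lborel \<partial>lborel)"
    by (simp add: nn_integral_add)
  also have "(\<integral>\<^sup>+y. \<integral>\<^sup>+y'. ennreal ((norm (g y'))\<^sup>2) * ennreal (G (y - y')) \<partial>lborel \<partial>lborel) =
     (\<integral>\<^sup>+y'. \<integral>\<^sup>+y. ennreal ((norm (g y'))\<^sup>2) * ennreal (G (y - y')) \<partial>lborel \<partial>lborel)"
    by (rule lborel_pair.Fubini') measurable
  also have "(\<integral>\<^sup>+y. \<integral>\<^sup>+y'. ennreal ((norm (g y))\<^sup>2) * ennreal (G (y' - y)) \<partial>lborel \<partial>lborel) =
     (\<integral>\<^sup>+ y. ennreal ((norm (g y))\<^sup>2) \<partial>lborel) * ennreal ((2 * pi) ^ DIM('a))"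
    using nn_integral_lborel_shift[of "\<lambda>v. ennreal (G v)"] by (simp add: nn_integral_cmult nn_integral_multc IG)
  finally have "2 * ennreal (norm I) \<le> 2 * (?N)"
    unfolding mult_2 by (simp only: mult.commute)
  then have le: "ennreal (norm I) \<le> ?N"
    using two by (simp add: ennreal_mult_le_mult_iff)
  \<comment> \<open>The integrand is a conjugate times itself, so \<open>I\<close> is the
    nonnegative quantity to be bounded.\<close>
  have "I = complex_of_real (\<integral>\<xi>. (norm (fourier g \<xi>))\<^sup>2 * gau \<epsilon> \<xi> \<partial>lborel)"
    unfolding I_def integral_complex_of_real[symmetric]
    by (intro Bochner_Integration.integral_cong refl)
       (simp add: complex_norm_square mult_ac del: of_real_power flip: of_real_power)
  moreover have "integrable lborel (\<lambda>\<xi>. (norm (fourier g \<xi>))\<^sup>2 * gau \<epsilon> \<xi>)"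
  proof (rule Bochner_Integration.integrable_bound)
    show "integrable lborel (\<lambda>\<xi>::'a. c\<^sup>2 * gau \<epsilon> \<xi>)" using integrable_gau[OF e, where ?'a='a] by simp
    show "AE \<xi> in lborel. norm ((norm (fourier g \<xi>))\<^sup>2 * gau \<epsilon> \<xi>) \<le> norm (c\<^sup>2 * gau \<epsilon> \<xi>)"
      using c c0 by (intro AE_I2) (auto simp: abs_mult intro!: mult_right_mono power_mono)
  qed measurable
  ultimately have "(\<integral>\<^sup>+ \<xi>. ennreal ((norm (fourier g \<xi>))\<^sup>2 * gau \<epsilon> \<xi>) \<partial>lborel) = ennreal (norm I)"
    by (subst nn_integral_eq_integral) (auto simp: less_imp_le[OF gau_pos] integral_nonneg)
  then show ?thesis using le by simp
qed

text \<open>The regularised bound is uniform in \<epsilon>; Fatou's lemma along \<epsilon> = 1/(k+1)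
  removes the Gaussian.\<close>

lemma nn_integral_fourier_square_le:
  fixes g :: "'a::euclidean_space \<Rightarrow> complex"
  assumes g: "integrable lborel g"
  shows "(\<integral>\<^sup>+ \<xi>. ennreal ((norm (fourier g \<xi>))\<^sup>2) \<partial>lborel) \<le>
    ennreal ((2 * pi) ^ DIM('a)) * (\<integral>\<^sup>+ y. ennreal ((norm (g y))\<^sup>2) \<partial>lborel)"
proof -
  let ?N = "ennreal ((2 * pi) ^ DIM('a)) * (\<integral>\<^sup>+ y. ennreal ((norm (g y))\<^sup>2) \<partial>lborel)"
  note [measurable] = integrable_lborel_measurable[OF g]
  have "(\<lambda>k. ennreal ((norm (fourier g \<xi>))\<^sup>2 * gau (1 / real (Suc k)) \<xi>)) \<longlonglongrightarrow> ennreal ((norm (fourier g \<xi>))\<^sup>2)" for \<xi>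
  proof -
    have "(\<lambda>k. exp (- ((1 / real (Suc k) * (\<xi> \<bullet> b))\<^sup>2 / 2))) \<longlonglongrightarrow> exp (- ((0 * (\<xi> \<bullet> b))\<^sup>2 / 2))" for b
      by (intro tendsto_intros lim_1_over_n[THEN LIMSEQ_Suc]) auto
    then have "(\<lambda>k. gau (1 / real (Suc k)) \<xi>) \<longlonglongrightarrow> (\<Prod>b\<in>(Basis::'a set). 1)"
      unfolding gau_def by - (rule Limits.tendsto_prod, simp)
    then have "(\<lambda>k. (norm (fourier g \<xi>))\<^sup>2 * gau (1 / real (Suc k)) \<xi>) \<longlonglongrightarrow> (norm (fourier g \<xi>))\<^sup>2 * 1"
      by - (intro tendsto_intros, simp)
    then show ?thesis by (simp del: of_nat_Suc)
  qed
  then have "(\<integral>\<^sup>+ \<xi>. ennreal ((norm (fourier g \<xi>))\<^sup>2) \<partial>lborel) =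
     (\<integral>\<^sup>+ \<xi>. liminf (\<lambda>k. ennreal ((norm (fourier g \<xi>))\<^sup>2 * gau (1 / real (Suc k)) \<xi>)) \<partial>lborel)"
    by (intro nn_integral_cong) (metis lim_imp_Liminf sequentially_bot)
  also have "\<dots> \<le> liminf (\<lambda>k. \<integral>\<^sup>+ \<xi>. ennreal ((norm (fourier g \<xi>))\<^sup>2 * gau (1 / real (Suc k)) \<xi>) \<partial>lborel)"
    by (rule nn_integral_liminf) measurable
  also have "\<dots> \<le> liminf (\<lambda>k. ?N)"
    by (intro Liminf_mono always_eventually allI fourier_norm_square_gau_le g) simp
  also have "\<dots> = ?N"
    by (simp add: Liminf_const)
  finally show ?thesis .
qed

text \<open>Local averages in L^(1/\<sigma>) are bounded on L^(1/\<theta>) whenever \<theta> <=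
  \<sigma>. The constant is the mass of the weight to the power \<sigma>; with \<delta> = R^\<rho>
  it supplies the gain R^(-\<rho> n \<sigma>).\<close>

lemma Lq_wt_conv_le:
  fixes h :: "'a::euclidean_space \<Rightarrow> ennreal"
  assumes \<theta>: "0 \<le> \<theta>" "\<theta> \<le> \<sigma>" and \<sigma>: "0 < \<sigma>" "\<sigma> \<le> 1" and \<delta>: "0 < \<delta>"
    and [measurable]: "h \<in> borel_measurable borel"
  shows "Lq \<theta> lborel (\<lambda>x. Lq \<sigma> lborel (\<lambda>y. ennreal (wt \<delta> (x - y)) * h y)) \<le>
    epow (ennreal ((pi / \<delta>) ^ DIM('a))) \<sigma> * Lq \<theta> lborel h"
proof -
  let ?w = "\<lambda>x y::'a. ennreal (wt \<delta> (x - y))"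
  let ?M = "\<lambda>x. Lq \<sigma> lborel (\<lambda>y. ?w x y * h y)"
  let ?c = "\<lambda>x s. \<integral>\<^sup>+ y. ?w x y * epow (h y) (1/s) \<partial>lborel"
  let ?A = "ennreal ((pi / \<delta>) ^ DIM('a))"
  \<comment> \<open>The weight lies below 1 and 1/\<sigma> is at least 1, so raising it to that
    power only decreases it.\<close>
  have w1: "epow (ennreal (wt \<delta> v)) (1/\<sigma>) \<le> ennreal (wt \<delta> v)" for v :: 'a
    using \<sigma> powr_mono'[of 1 "1/\<sigma>" "wt \<delta> v"] wt_pos[of \<delta> v] wt_le_1[of \<delta> v]
    by (simp add: epow_ennreal ennreal_leI)
  have I1: "(\<integral>\<^sup>+ y. ?w x y \<partial>lborel) = ?A" for x :: 'a
    using nn_integral_lborel_reflect[of "\<lambda>y. ennreal (wt \<delta> y)" x] nn_integral_wt[OF \<delta>, where ?'a='a] by simp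
  have I2: "(\<integral>\<^sup>+ x. ?w x y \<partial>lborel) = ?A" for y :: 'a
    using nn_integral_lborel_shift[of "\<lambda>y. ennreal (wt \<delta> y)" y] nn_integral_wt[OF \<delta>, where ?'a='a] by simp
  have inner: "?M x \<le>
     epow (?c x \<sigma>) \<sigma>" for x
  proof -
    have "?M x =
      epow (\<integral>\<^sup>+ y. epow (?w x y) (1/\<sigma>) * epow (h y) (1/\<sigma>) \<partial>lborel) \<sigma>"
      using \<sigma> by (simp add: Lq_pos epow_mult)
    also have "\<dots> \<le> epow (?c x \<sigma>) \<sigma>"
      using \<sigma> by (intro epow_mono nn_integral_mono mult_right_mono w1) auto
    finally show ?thesis .
  qed
  have [measurable]: "(\<lambda>x. ?M x) \<in> borel_measurable borel"
    using \<sigma> by (simp add: Lq_pos)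
  show ?thesis
  proof (cases "\<theta> = 0")
    case True
    have "?M x \<le> epow ?A \<sigma> * esssup lborel h" for x
    proof -
      have "(?c x \<sigma>) \<le>
         (\<integral>\<^sup>+ y. ?w x y * epow (esssup lborel h) (1/\<sigma>) \<partial>lborel)"
        by (rule nn_integral_mono_AE, rule eventually_mono[OF esssup_AE[of h lborel]])
           (use \<sigma> in \<open>auto intro!: mult_left_mono epow_mono\<close>)
      also have "\<dots> = ?A * epow (esssup lborel h) (1/\<sigma>)"
        by (simp add: nn_integral_multc I1)
      finally have "epow (?c x \<sigma>) \<sigma> \<le>
         epow (?A * epow (esssup lborel h) (1/\<sigma>)) \<sigma>"
        using \<sigma> by (intro epow_mono) auto
      then show ?thesis using inner[of x] \<sigma> by (simp add: epow_mult epow_epow)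
    qed
    then show ?thesis unfolding True Lq_0 by (intro esssup_I AE_I2) auto
  next
    case False
    then have t: "0 < \<theta>" using \<theta> by simp
    have "(\<integral>\<^sup>+ x. epow (?M x) (1/\<theta>) \<partial>lborel) \<le>
      (\<integral>\<^sup>+ x. epow ?A (\<sigma>/\<theta> - 1) * (?c x \<theta>) \<partial>lborel)"
    proof (intro nn_integral_mono)
      fix x :: 'a
      have "epow (?M x) (1/\<theta>) \<le>
        epow (epow (?c x \<sigma>) \<sigma>) (1/\<theta>)"
        using t by (intro epow_mono inner) auto
      also have "\<dots> = epow (?c x \<sigma>) (1/(\<theta>/\<sigma>))"
        by (simp add: epow_epow)
      \<comment> \<open>Jensen with index \<theta>/\<sigma>, which is at most 1; the remaining
        integral is a convolution to which Tonelli applies.\<close>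
      also have "\<dots> \<le> epow (\<integral>\<^sup>+ y. ?w x y \<partial>lborel) (1/(\<theta>/\<sigma>) - 1) *
         (\<integral>\<^sup>+ y. ?w x y * epow (epow (h y) (1/\<sigma>)) (1/(\<theta>/\<sigma>)) \<partial>lborel)"
        using t \<theta> \<sigma> by (intro nn_integral_Jensen) auto
      also have "\<dots> = epow ?A (\<sigma>/\<theta> - 1) * (?c x \<theta>)"
        using \<sigma> by (simp add: epow_epow I1)
      finally show "epow (?M x) (1/\<theta>) \<le> \<dots>" .
    qed
    also have "\<dots> = epow ?A (\<sigma>/\<theta> - 1) * (\<integral>\<^sup>+ x. \<integral>\<^sup>+ y. ?w x y * epow (h y) (1/\<theta>) \<partial>lborel \<partial>lborel)"
      by (simp add: nn_integral_cmult)
    also have "(\<integral>\<^sup>+ x. \<integral>\<^sup>+ y. ?w x y * epow (h y) (1/\<theta>) \<partial>lborel \<partial>lborel) =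
       (\<integral>\<^sup>+ y. \<integral>\<^sup>+ x. ?w x y * epow (h y) (1/\<theta>) \<partial>lborel \<partial>lborel)"
      by (rule lborel_pair.Fubini') measurable
    also have "\<dots> = ?A * (\<integral>\<^sup>+ y. epow (h y) (1/\<theta>) \<partial>lborel)"
      by (simp add: nn_integral_cmult nn_integral_multc I2)
    also have "epow ?A (\<sigma>/\<theta> - 1) * (?A * (\<integral>\<^sup>+ y. epow (h y) (1/\<theta>) \<partial>lborel)) =
        epow ?A (\<sigma>/\<theta>) * (\<integral>\<^sup>+ y. epow (h y) (1/\<theta>) \<partial>lborel)"
      using epow_add[of ?A "\<sigma>/\<theta> - 1" 1] by (simp add: mult.assoc)
    finally have "epow (\<integral>\<^sup>+ x. epow (?M x) (1/\<theta>) \<partial>lborel) \<theta> \<le>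
       epow (epow ?A (\<sigma>/\<theta>) * (\<integral>\<^sup>+ y. epow (h y) (1/\<theta>) \<partial>lborel)) \<theta>"
      using t by (intro epow_mono) auto
    then show ?thesis using t by (simp add: Lq_pos[of \<theta>] epow_mult epow_epow)
  qed
qed

section \<open>The Hausdorff-Young inequality\<close>

lemma nn_integral_powr_interval:
  assumes e: "-1 < e" and B: "0 \<le> B"
  shows "(\<integral>\<^sup>+ l. ennreal (l powr e) * indicator {0<..<B} l \<partial>lborel) = ennreal (B powr (e + 1) / (e + 1))"
proof -
  have "((\<lambda>l. l powr e) has_integral (B powr (e + 1) / (e + 1))) {0..B}"
    by (rule has_integral_powr_from_0[OF e B])
  then have "(\<integral>\<^sup>+ l. ennreal (l powr e) * indicator {0..B} l \<partial>lborel) = ennreal (B powr (e + 1) / (e + 1))"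
    by (rule nn_integral_has_integral_lebesgue'[rotated]) auto
  moreover have "(\<integral>\<^sup>+ l. ennreal (l powr e) * indicator {0<..<B} l \<partial>lborel) =
      (\<integral>\<^sup>+ l. ennreal (l powr e) * indicator {0..B} l \<partial>lborel)"
    using AE_lborel_singleton[of 0] AE_lborel_singleton[of B]
    by (intro nn_integral_cong_AE, eventually_elim) (auto split: split_indicator)
  ultimately show ?thesis by simp
qed

lemma fourier_eq_0_AE:
  assumes "AE y in lborel. g y = 0"
  shows "fourier g \<xi> = 0"
  unfolding fourier_def
  by (rule integral_eq_zero_AE) (use assms in \<open>auto elim: eventually_mono\<close>)

text \<open>
  At level \<open>l\<close> the function is cut at height \<open>t l\<close>, chosen such that the transform of the
  high part is at most \<open>l\<close>; only the low part, controlled by Plancherel, can exceed it.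
\<close>

lemma fourier_Marcinkiewicz:
  fixes g :: "'a::euclidean_space \<Rightarrow> complex"
  assumes g: "integrable lborel g" and s: "1 < s" "s < 2"
    and A: "0 < A" "(\<integral>\<^sup>+ y. ennreal (norm (g y) powr s) \<partial>lborel) = ennreal A"
  defines "\<tau> \<equiv> s / (s - 1)"
  shows "(\<integral>\<^sup>+ \<xi>. ennreal (norm (fourier g \<xi>) powr \<tau>) \<partial>lborel) \<le>
     ennreal (2 powr \<tau> * \<tau> * (2 * pi) ^ DIM('a) / (\<tau> - 2) * A powr (\<tau> - 1))"
proof -
  note [measurable] = integrable_lborel_measurable[OF g]
  \<comment> \<open>\<tau> is the exponent conjugate to s. The second identity makes the integral
    over levels below return exactly |g|^s.\<close>
  have \<tau>: "2 < \<tau>" "(1 - s) * (\<tau> - 2) = s - 2" 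
    using s by (auto simp: \<tau>_def field_simps)
  define P where "P = (2 * pi) ^ DIM('a)"
  have P: "0 < P" by (simp add: P_def)
  \<comment> \<open>The height solves t^(s-1) = A/l. Where |g| >= t one has |g| <= (l/A) |g|^s, so
    the part of \<open>g\<close> above the cut has L^1 norm at most l.\<close>
  define t where "t l = (A / l) powr (1 / (s - 1))" for l
  have [measurable]: "t \<in> borel_measurable borel" unfolding t_def by measurable
  have t_powr: "t l powr (s - 1) = A / l" if "0 < l" for l
    using that s A by (simp add: t_def powr_powr)
  have t_pos: "0 < t l" if "0 < l" for l using that A by (simp add: t_def)
  let ?E = "\<lambda>l. {\<xi>. 2 * l < norm (fourier g \<xi>)}"
  let ?I = "\<lambda>l y. ennreal ((norm (g y))\<^sup>2) * (indicator {y. norm (g y) < t l} y * indicator {0<..} l)"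
  \<comment> \<open>If the transform of \<open>g\<close> exceeds 2l while that of the high part
    stays below l, the low part exceeds l; Chebyshev and Plancherel finish.\<close>
  have level: "ennreal (l\<^sup>2) * emeasure lborel (?E l) \<le>
       ennreal P * (\<integral>\<^sup>+ y. ennreal ((norm (g y))\<^sup>2) * indicator {y. norm (g y) < t l} y \<partial>lborel)" if l: "0 < l" for l
  proof -
    define g1 where "g1 y = (if norm (g y) < t l then 0 else g y)" for y
    define g2 where "g2 y = (if norm (g y) < t l then g y else 0)" for y
    have [measurable]: "g1 \<in> borel_measurable borel" "g2 \<in> borel_measurable borel"
      unfolding g1_def g2_def by measurable
    have i: "integrable lborel g1" "integrable lborel g2"
      by (rule Bochner_Integration.integrable_bound[OF g]; auto simp: g1_def g2_def)+
    have "norm (g1 y) \<le> l / A * norm (g y) powr s" for y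
    proof (cases "norm (g y) < t l")
      case False
      then have ge: "t l \<le> norm (g y)" by simp
      then have gp: "0 < norm (g y)" using t_pos[OF l] by linarith
      have "A / l \<le> norm (g y) powr (s - 1)"
        using ge s t_pos[OF l] by (subst t_powr[OF l, symmetric]) (auto intro!: powr_mono2)
      then have "1 \<le> l / A * norm (g y) powr (s - 1)"
        using l A by (simp add: field_simps)
      then have "norm (g y) * 1 \<le> norm (g y) * (l / A * norm (g y) powr (s - 1))"
        by (intro mult_left_mono) auto
      also have "\<dots> = l / A * norm (g y) powr s"
        using gp powr_add[of "norm (g y)" 1 "s - 1"] by simp
      finally show ?thesis using False by (simp add: g1_def)
    qed (use l A in \<open>auto simp: g1_def\<close>)
    then have "(\<integral>\<^sup>+ y. ennorm (g1 y) \<partial>lborel) \<le>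
        (\<integral>\<^sup>+ y. ennreal (l / A) * ennreal (norm (g y) powr s) \<partial>lborel)"
      using l A by (intro nn_integral_mono) (simp add: ennreal_mult[symmetric] ennreal_leI del: ennreal_plus)
    also have "\<dots> = ennreal l"
      using l A by (subst nn_integral_cmult) (simp_all add: A(2), simp add: ennreal_mult[symmetric])
    finally have "ennreal (\<integral> y. norm (g1 y) \<partial>lborel) \<le> ennreal l"
      using i by (simp add: nn_integral_eq_integral)
    then have b1: "norm (fourier g1 \<xi>) \<le> l" for \<xi>
      using norm_fourier_le[OF i(1), of \<xi>] l by (simp add: ennreal_le_iff)
    have sp: "fourier g \<xi> = fourier g1 \<xi> + fourier g2 \<xi>" for \<xi>
    proof -
      have "(\<lambda>y. g1 y + g2 y) = g" by (auto simp: g1_def g2_def)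
      then show ?thesis using fourier_add[OF i, of \<xi>] by simp
    qed
    have "ennreal (l\<^sup>2) * emeasure lborel (?E l) =
       (\<integral>\<^sup>+ \<xi>. ennreal (l\<^sup>2) * indicator (?E l) \<xi> \<partial>lborel)"
      by (subst nn_integral_cmult) auto
    also have "\<dots> \<le> (\<integral>\<^sup>+ \<xi>. ennreal ((norm (fourier g2 \<xi>))\<^sup>2) \<partial>lborel)"
    proof (intro nn_integral_mono)
      fix \<xi>
      have "l\<^sup>2 \<le> (norm (fourier g2 \<xi>))\<^sup>2" if "2 * l < norm (fourier g \<xi>)"
      proof (rule power_mono)
        show "l \<le> norm (fourier g2 \<xi>)"
          using that b1[of \<xi>] norm_triangle_ineq[of "fourier g1 \<xi>" "fourier g2 \<xi>"] by (simp add: sp)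
      qed (use l in auto)
      then show "ennreal (l\<^sup>2) * indicator (?E l) \<xi> \<le> ennreal ((norm (fourier g2 \<xi>))\<^sup>2)"
        by (auto split: split_indicator simp: ennreal_leI)
    qed
    also have "\<dots> \<le> ennreal P * (\<integral>\<^sup>+ y. ennreal ((norm (g2 y))\<^sup>2) \<partial>lborel)"
      unfolding P_def by (rule nn_integral_fourier_square_le[OF i(2)])
    also have "(\<integral>\<^sup>+ y. ennreal ((norm (g2 y))\<^sup>2) \<partial>lborel) =
       (\<integral>\<^sup>+ y. ennreal ((norm (g y))\<^sup>2) * indicator {y. norm (g y) < t l} y \<partial>lborel)"
      by (intro nn_integral_cong) (auto simp: g2_def)
    finally show ?thesis .
  qed
  \<comment> \<open>Splitting l^(\<tau>-1) as l^(\<tau>-3) l^2 gives the measure bound the weight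
    l^2 that it needs.\<close>
  have level': "ennreal (l powr (\<tau> - 1)) * indicator {0<..} l * emeasure lborel (?E l) \<le>
      (\<integral>\<^sup>+ y. ennreal P * (ennreal (l powr (\<tau> - 3)) * ?I l y) \<partial>lborel)" for l
  proof (cases "0 < l")
    case True
    have "l powr (\<tau> - 1) = l powr (\<tau> - 3) * l\<^sup>2"
      using True powr_add[of l "\<tau> - 3" 2] by (simp add: powr_numeral)
    then have "ennreal (l powr (\<tau> - 1)) = ennreal (l powr (\<tau> - 3)) * ennreal (l\<^sup>2)"
      by (simp add: ennreal_mult)
    then have "ennreal (l powr (\<tau> - 1)) * emeasure lborel (?E l) =
        ennreal (l powr (\<tau> - 3)) * (ennreal (l\<^sup>2) * emeasure lborel (?E l))"
      by (simp only: mult.assoc)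
    also have "\<dots> \<le> ennreal (l powr (\<tau> - 3)) *
       (ennreal P * (\<integral>\<^sup>+ y. ennreal ((norm (g y))\<^sup>2) * indicator {y. norm (g y) < t l} y \<partial>lborel))"
      by (intro mult_left_mono level True) simp
    also have "\<dots> = ennreal P * (ennreal (l powr (\<tau> - 3)) *
       (\<integral>\<^sup>+ y. ennreal ((norm (g y))\<^sup>2) * indicator {y. norm (g y) < t l} y \<partial>lborel))"
      by (simp only: mult.left_commute)
    finally show ?thesis using True by (simp add: nn_integral_cmult)
  qed simp
  \<comment> \<open>The cut read as a condition on l for fixed y: since t decreases in l, the
    admissible levels form an interval starting at 0.\<close>
  have small: "norm (g y) < t l \<longleftrightarrow> l < A * norm (g y) powr (1 - s)" if "0 < l" "g y \<noteq> 0" for l y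
  proof -
    have gp: "0 < norm (g y)" using that by simp
    have "norm (g y) < t l \<longleftrightarrow> norm (g y) powr (s - 1) < t l powr (s - 1)"
      using s gp t_pos[OF that(1)] powr_less_mono2[of "s - 1" "norm (g y)" "t l"]
        powr_mono2[of "s - 1" "t l" "norm (g y)"] by (auto simp: not_less[symmetric])
    also have "\<dots> \<longleftrightarrow> norm (g y) powr (s - 1) < A / l" by (simp add: t_powr[OF that(1)])
    also have "\<dots> \<longleftrightarrow> l < A * norm (g y) powr (1 - s)"
    proof -
      have "norm (g y) powr (1 - s) = 1 / norm (g y) powr (s - 1)"
        using powr_minus_divide[of "norm (g y)" "s - 1"] by simp
      moreover have "c < A / l \<longleftrightarrow> l < A * (1 / c)" if "0 < c" for c
        using that \<open>0 < l\<close> by (simp add: field_simps)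
      ultimately show ?thesis using gp by simp
    qed
    finally show ?thesis .
  qed
  \<comment> \<open>Integrability of l^(\<tau>-3) at 0 is the condition \<tau> > 2, that is s < 2;
    it is the source of the denominator \<tau> - 2.\<close>
  have inner: "(\<integral>\<^sup>+ l. ennreal (l powr (\<tau> - 3)) * ?I l y \<partial>lborel)
      = ennreal (A powr (\<tau> - 2) / (\<tau> - 2)) * ennreal (norm (g y) powr s)" for y
  proof (cases "g y = 0")
    case True
    then show ?thesis using s by simp
  next
    case False
    let ?B = "A * norm (g y) powr (1 - s)"
    have "(\<integral>\<^sup>+ l. ennreal (l powr (\<tau> - 3)) * ?I l y \<partial>lborel)
       = (\<integral>\<^sup>+ l. ennreal ((norm (g y))\<^sup>2) * (ennreal (l powr (\<tau> - 3)) * indicator {0<..<?B} l) \<partial>lborel)"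
      using small[of _ y] False by (intro nn_integral_cong) (auto simp: mult_ac split: split_indicator)
    also have "\<dots> = ennreal ((norm (g y))\<^sup>2) * ennreal (?B powr (\<tau> - 3 + 1) / (\<tau> - 3 + 1))"
      using \<tau> A by (subst nn_integral_cmult) (auto simp: nn_integral_powr_interval)
    also have "\<dots> = ennreal (A powr (\<tau> - 2) / (\<tau> - 2)) * ennreal (norm (g y) powr s)"
    proof -
      have "?B powr (\<tau> - 2) = A powr (\<tau> - 2) * norm (g y) powr (s - 2)"
        using A \<tau>(2) by (simp add: powr_mult powr_powr)
      moreover have "(norm (g y))\<^sup>2 * norm (g y) powr (s - 2) = norm (g y) powr s"
        using False powr_add[of "norm (g y)" 2 "s - 2"] by (simp add: powr_numeral)
      ultimately have "(norm (g y))\<^sup>2 * (?B powr (\<tau> - 2) / (\<tau> - 2)) = A powr (\<tau> - 2) / (\<tau> - 2) * norm (g y) powr s"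
        by (metis (no_types, lifting) mult.left_commute times_divide_eq_left times_divide_eq_right)
      then show ?thesis using \<tau> by (simp add: ennreal_mult[symmetric])
    qed
    finally show ?thesis .
  qed
  \<comment> \<open>Layer cake formula. The levels run up to half the modulus because the superlevel
    sets are taken at 2l; this accounts for the factor 2^\<tau>.\<close>
  have cake: "ennreal (norm (fourier g \<xi>) powr \<tau>) =
     ennreal (2 powr \<tau> * \<tau>) * (\<integral>\<^sup>+ l. ennreal (l powr (\<tau> - 1)) * indicator {0<..} l * indicator (?E l) \<xi> \<partial>lborel)" for \<xi>
  proof -
    have "(\<integral>\<^sup>+ l. ennreal (l powr (\<tau> - 1)) * indicator {0<..} l * indicator (?E l) \<xi> \<partial>lborel)
      = (\<integral>\<^sup>+ l. ennreal (l powr (\<tau> - 1)) * indicator {0<..<norm (fourier g \<xi>) / 2} l \<partial>lborel)"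
      by (intro nn_integral_cong) (auto split: split_indicator)
    also have "\<dots> = ennreal ((norm (fourier g \<xi>) / 2) powr \<tau> / \<tau>)"
      using \<tau> by (subst nn_integral_powr_interval) auto
    finally show ?thesis using \<tau> by (simp add: ennreal_mult[symmetric] powr_divide)
  qed
  have eq: "(\<integral>\<^sup>+ \<xi>. ennreal (norm (fourier g \<xi>) powr \<tau>) \<partial>lborel) =
     ennreal (2 powr \<tau> * \<tau>) * (\<integral>\<^sup>+ \<xi>. \<integral>\<^sup>+ l. ennreal (l powr (\<tau> - 1)) * indicator {0<..} l * indicator (?E l) \<xi> \<partial>lborel \<partial>lborel)"
    unfolding cake by (rule nn_integral_cmult) (simp add: indicator_def)
  have "(\<integral>\<^sup>+ \<xi>. \<integral>\<^sup>+ l. ennreal (l powr (\<tau> - 1)) * indicator {0<..} l * indicator (?E l) \<xi> \<partial>lborel \<partial>lborel)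
     = (\<integral>\<^sup>+ l. \<integral>\<^sup>+ \<xi>. ennreal (l powr (\<tau> - 1)) * indicator {0<..} l * indicator (?E l) \<xi> \<partial>lborel \<partial>lborel)"
    by (rule lborel_pair.Fubini') (simp add: indicator_def)
  also have "\<dots> = (\<integral>\<^sup>+ l. ennreal (l powr (\<tau> - 1)) * indicator {0<..} l * emeasure lborel (?E l) \<partial>lborel)"
    by (intro nn_integral_cong, subst nn_integral_cmult) auto
  also have "\<dots> \<le> (\<integral>\<^sup>+ l. \<integral>\<^sup>+ y. ennreal P * (ennreal (l powr (\<tau> - 3)) * ?I l y) \<partial>lborel \<partial>lborel)"
    by (intro nn_integral_mono level')
  also have "\<dots> = (\<integral>\<^sup>+ y. \<integral>\<^sup>+ l. ennreal P * (ennreal (l powr (\<tau> - 3)) * ?I l y) \<partial>lborel \<partial>lborel)"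
    by (rule lborel_pair.Fubini') (simp add: indicator_def)
  also have "\<dots> = (\<integral>\<^sup>+ y. ennreal P * (ennreal (A powr (\<tau> - 2) / (\<tau> - 2)) * ennreal (norm (g y) powr s)) \<partial>lborel)"
    by (intro nn_integral_cong, subst nn_integral_cmult, simp add: indicator_def) (simp only: inner)
  also have "\<dots> = ennreal P * (ennreal (A powr (\<tau> - 2) / (\<tau> - 2)) * ennreal A)"
    by (simp add: nn_integral_cmult A)
  also have "\<dots> = ennreal (P / (\<tau> - 2) * A powr (\<tau> - 1))"
    using P A \<tau> powr_add[of A "\<tau> - 2" 1] by (simp add: ennreal_mult[symmetric])
  finally have "(\<integral>\<^sup>+ \<xi>. ennreal (norm (fourier g \<xi>) powr \<tau>) \<partial>lborel) \<le>
     ennreal (2 powr \<tau> * \<tau>) * ennreal (P / (\<tau> - 2) * A powr (\<tau> - 1))"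
    unfolding eq by (rule mult_left_mono) simp
  also have "\<dots> = ennreal (2 powr \<tau> * \<tau> * P / (\<tau> - 2) * A powr (\<tau> - 1))"
    using P \<tau> by (simp add: ennreal_mult[symmetric] mult_ac)
  finally show ?thesis unfolding P_def .
qed

text \<open>The end points are the trivial bound and Plancherel. In between, the truncation argument
  already uses the s-th power integral A of \<open>g\<close>, so its bound A^(\<tau>-1) has the
  right homogeneity: its power 1 - \<sigma> is A^\<sigma>.\<close>

theorem Hausdorff_Young:
  assumes \<sigma>: "1/2 \<le> \<sigma>" "\<sigma> \<le> 1"
  shows "\<exists>C>0. \<forall>g::'a::euclidean_space \<Rightarrow> complex. integrable lborel g \<longrightarrow>
    nLq (1 - \<sigma>) (fourier g) \<le> ennreal C * nLq \<sigma> g"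
proof -
  consider "\<sigma> = 1" | "\<sigma> = 1/2" | "1/2 < \<sigma>" "\<sigma> < 1" using \<sigma> by linarith
  then show ?thesis
  proof cases
    case 1
    have "nLq 0 (fourier g) \<le> ennreal 1 * nLq 1 g"
      if g: "integrable lborel g" for g :: "'a \<Rightarrow> complex"
    proof -
      note [measurable] = integrable_lborel_measurable[OF g]
      have "ennorm (fourier g \<xi>) \<le> (\<integral>\<^sup>+ y. ennorm (g y) \<partial>lborel)" for \<xi>
        using norm_fourier_le[OF g, of \<xi>] g by (simp add: nn_integral_eq_integral ennreal_leI)
      then show ?thesis unfolding Lq_0 Lq_1 by (intro esssup_I) auto
    qed
    then show ?thesis unfolding 1 by (intro exI[of _ 1]) auto
  next
    case 2
    have "nLq (1/2) (fourier g) \<le>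
        ennreal (((2 * pi) ^ DIM('a)) powr (1/2)) * nLq (1/2) g"
      if g: "integrable lborel g" for g :: "'a \<Rightarrow> complex"
    proof -
      have "epow (\<integral>\<^sup>+ \<xi>. ennreal ((norm (fourier g \<xi>))\<^sup>2) \<partial>lborel) (1/2) \<le>
         epow (ennreal ((2 * pi) ^ DIM('a)) * (\<integral>\<^sup>+ y. ennreal ((norm (g y))\<^sup>2) \<partial>lborel)) (1/2)"
        by (intro epow_mono nn_integral_fourier_square_le g) simp
      moreover have "epow (ennreal (norm z)) 2 = ennreal ((norm z)\<^sup>2)" for z :: complex
        by (simp add: epow_ennreal powr_numeral)
      ultimately show ?thesis by (simp add: Lq_pos epow_mult epow_ennreal)
    qed
    moreover have "(0::real) < ((2 * pi) ^ DIM('a)) powr (1/2)" by simp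
    moreover have "1 - \<sigma> = 1/2" using 2 by simp
    ultimately show ?thesis unfolding 2 by (intro exI[of _ "((2 * pi) ^ DIM('a)) powr (1/2)"]) auto
  next
    case 3
    define s where "s = 1 / \<sigma>"
    define \<tau> where "\<tau> = s / (s - 1)"
    define K where "K = 2 powr \<tau> * \<tau> * (2 * pi) ^ DIM('a) / (\<tau> - 2)"
    have s: "1 < s" "s < 2" using 3 by (auto simp: s_def field_simps)
    have \<tau>: "\<tau> = 1 / (1 - \<sigma>)" "2 < \<tau>" "(\<tau> - 1) * (1 - \<sigma>) = \<sigma>"
      using 3 by (auto simp: \<tau>_def s_def field_simps)
    have K: "0 < K" using \<tau>(2) by (simp add: K_def)
    have "nLq (1 - \<sigma>) (fourier g) \<le>
        ennreal (K powr (1 - \<sigma>)) * nLq \<sigma> g"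
      if g: "integrable lborel g" for g :: "'a \<Rightarrow> complex"
    proof -
      note [measurable] = integrable_lborel_measurable[OF g]
      define I where "I = (\<integral>\<^sup>+ y. ennreal (norm (g y) powr s) \<partial>lborel)"
      have LI: "nLq \<sigma> g = epow I \<sigma>"
        using 3 by (simp add: Lq_pos I_def s_def epow_ennreal)
      \<comment> \<open>The truncation heights divide by the level and are powers of A, hence a
        positive finite A is required there.\<close>
      consider "I = 0" | "I = \<top>" | A where "0 < A" "I = ennreal A"
        by (cases I) (auto simp: less_le)
      then show ?thesis
      proof cases
        case 1
        then have "AE y in lborel. g y = 0"
          unfolding I_def by (subst (asm) nn_integral_0_iff_AE) auto
        then have "fourier g \<xi> = 0" for \<xi> by (rule fourier_eq_0_AE)
        then show ?thesis using 3 by simp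
      next
        case 2
        then show ?thesis using K by (simp add: LI ennreal_mult_top)
      next
        case (3 A)
        have "(\<integral>\<^sup>+ \<xi>. ennreal (norm (fourier g \<xi>) powr \<tau>) \<partial>lborel) \<le> ennreal (K * A powr (\<tau> - 1))"
          unfolding K_def \<tau>_def using s 3 by (intro fourier_Marcinkiewicz[OF g]) (auto simp: I_def)
        then have "epow (\<integral>\<^sup>+ \<xi>. ennreal (norm (fourier g \<xi>) powr \<tau>) \<partial>lborel) (1 - \<sigma>) \<le>
            epow (ennreal (K * A powr (\<tau> - 1))) (1 - \<sigma>)"
          using \<sigma> by (intro epow_mono) auto
        also have "\<dots> = ennreal (K powr (1 - \<sigma>)) * ennreal (A powr \<sigma>)"
          using K 3(1) \<tau>(3) by (simp add: epow_ennreal epow_mult powr_powr ennreal_mult)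
        finally show ?thesis
          using \<open>\<sigma> < 1\<close> 3 \<tau>(1) by (simp add: LI Lq_pos[of "1 - \<sigma>"] epow_ennreal)
      qed
    qed
    moreover have "0 < K powr (1 - \<sigma>)" using K by simp
    ultimately show ?thesis by blast
  qed
qed

section \<open>Dyadic cutoff functions\<close>

definition clamp01 :: "real \<Rightarrow> real" where
  "clamp01 t = max 0 (min 1 t)"

lemma clamp01_range: "0 \<le> clamp01 t" "clamp01 t \<le> 1"
  by (auto simp: clamp01_def)

lemma isCont_clamp01: "isCont clamp01 t"
  unfolding clamp01_def by (intro continuous_intros)

text \<open>Clamping has corners only at 0 and 1, and the vanishing of \<open>g'\<close> there
  flattens them.\<close>

lemma DERIV_clamp01:
  assumes g: "\<And>v. (g has_real_derivative g' v) (at v)" and "g' 0 = 0" "g' 1 = 0"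
  shows "((\<lambda>t. g (clamp01 t)) has_real_derivative g' (clamp01 t)) (at t)"
proof (cases "0 < t \<and> t < 1")
  case True
  show ?thesis
  proof (rule has_field_derivative_transform_within_open)
    show "(g has_real_derivative g' (clamp01 t)) (at t)" using g[of t] True by (simp add: clamp01_def)
    show "open {0<..<1::real}" "t \<in> {0<..<1}" using True by auto
    show "\<And>x. x \<in> {0<..<1} \<Longrightarrow> g x = g (clamp01 x)" by (auto simp: clamp01_def)
  qed
next
  case False
  then have "g' (clamp01 t) = 0" using assms by (auto simp: clamp01_def)
  \<comment> \<open>Caratheodory's slope function of \<open>g\<close> at the clamped point. Clamping
    is 1-Lipschitz, so the difference quotient is dominated by the slope, which tends to 0.\<close>
  obtain h where hh: "(\<forall>z. g z - g (clamp01 t) = h z * (z - clamp01 t)) \<and>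
      isCont h (clamp01 t) \<and> h (clamp01 t) = g' (clamp01 t)"
    using CARAT_DERIV[THEN iffD1, OF g[of "clamp01 t"]] by (rule exE)
  note h = hh[THEN conjunct1, THEN spec] hh[THEN conjunct2, THEN conjunct1] hh[THEN conjunct2, THEN conjunct2]
  have "isCont (\<lambda>k. t + k) 0" by (intro continuous_intros)
  then have "isCont (\<lambda>k. clamp01 (t + k)) 0"
    by (rule isCont_o2) (rule isCont_clamp01)
  then have "isCont (\<lambda>k. h (clamp01 (t + k))) 0"
    by (rule isCont_o2) (use h(2) in simp)
  then have lim: "((\<lambda>k. h (clamp01 (t + k))) \<longlongrightarrow> 0) (at 0)"
    using h(3) \<open>g' (clamp01 t) = 0\<close> by (simp add: isCont_def)
  have le: "norm ((g (clamp01 (t + k)) - g (clamp01 t)) / k) \<le> norm (h (clamp01 (t + k)))" if "k \<noteq> 0" for k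
  proof -
    have "\<bar>clamp01 (t + k) - clamp01 t\<bar> \<le> \<bar>k\<bar>" by (auto simp: clamp01_def)
    then have "\<bar>h (clamp01 (t + k))\<bar> * \<bar>clamp01 (t + k) - clamp01 t\<bar> \<le> \<bar>h (clamp01 (t + k))\<bar> * \<bar>k\<bar>"
      by (intro mult_left_mono) auto
    then show ?thesis using that by (simp add: h(1) abs_mult divide_le_eq)
  qed
  have "((\<lambda>k. (g (clamp01 (t + k)) - g (clamp01 t)) / k) \<longlongrightarrow> 0) (at 0)"
  proof (rule Lim_null_comparison[OF _ tendsto_norm_zero[OF lim]])
    show "\<forall>\<^sub>F k in at 0. norm ((g (clamp01 (t + k)) - g (clamp01 t)) / k) \<le> norm (h (clamp01 (t + k)))"
      unfolding eventually_at_filter using le by (intro always_eventually allI impI)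
  qed
  then show ?thesis using \<open>g' (clamp01 t) = 0\<close> by (simp add: DERIV_def)
qed

text \<open>The quintic smoothstep on the unit interval and its first two derivatives, which vanish
  at both end points.\<close>

definition sstep :: "nat \<Rightarrow> real \<Rightarrow> real" where
  "sstep j t = (if j = 0 then 10 * t^3 - 15 * t^4 + 6 * t^5
     else if j = 1 then 30 * t^2 - 60 * t^3 + 30 * t^4
     else if j = 2 then 60 * t - 180 * t^2 + 120 * t^3 else 0)"

lemma sstep_0: "sstep j 0 = 0"
  by (simp add: sstep_def)

lemma sstep_1: "sstep j 1 = (if j = 0 then 1 else 0)"
  by (simp add: sstep_def)

lemma DERIV_sstep: "j < 2 \<Longrightarrow> (sstep j has_real_derivative sstep (Suc j) t) (at t)"
  unfolding sstep_def[abs_def]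
  by (cases "j = 0"; cases "j = 1") (auto intro!: derivative_eq_intros simp: algebra_simps)

text \<open>400 is a round bound above the sum of the absolute coefficients, at most 60 + 180 +
  120.\<close>

lemma abs_sstep_le:
  assumes "0 \<le> t" "t \<le> 1"
  shows "\<bar>sstep j t\<bar> \<le> 400"
proof -
  have p: "0 \<le> t ^ n" "t ^ n \<le> 1" for n using assms by (auto simp: power_le_one)
  have "\<bar>10 * t^3 - 15 * t^4 + 6 * t^5\<bar> \<le> 400" "\<bar>30 * t^2 - 60 * t^3 + 30 * t^4\<bar> \<le> 400"
    "\<bar>60 * t - 180 * t^2 + 120 * t^3\<bar> \<le> 400"
    using assms p[of 2] p[of 3] p[of 4] p[of 5] by linarith+
  then show ?thesis unfolding sstep_def by auto
qed

text \<open>For j = 0 a plateau: it rises on [-2,-1], equals 1 on [-1,1] and falls on [1,2]; the 1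
  is subtracted because both steps are 1 on the plateau. The index j is the order of the derivative,
  and (-1)^j comes from the chain rule in 2 - t.\<close>

definition bump :: "nat \<Rightarrow> real \<Rightarrow> real" where
  "bump j t = sstep j (clamp01 (2 + t)) + (-1) ^ j * sstep j (clamp01 (2 - t)) - (if j = 0 then 1 else 0)"

lemma DERIV_bump:
  assumes "j < 2"
  shows "(bump j has_real_derivative bump (Suc j) t) (at t)"
proof -
  have d: "((\<lambda>t. sstep j (clamp01 t)) has_real_derivative sstep (Suc j) (clamp01 t)) (at t)" for t
    by (rule DERIV_clamp01) (use assms in \<open>auto simp: DERIV_sstep sstep_0 sstep_1\<close>)
  show ?thesis
    unfolding bump_def[abs_def]
    by (rule derivative_eq_intros DERIV_chain2[OF d] refl | simp)+
qed

text \<open>801 = 400 + 400 + 1, two smoothsteps and the constant.\<close>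

lemma abs_bump_le: "\<bar>bump j t\<bar> \<le> 801"
proof -
  have "\<bar>sstep j (clamp01 (2 + t))\<bar> \<le> 400" "\<bar>(-1) ^ j * sstep j (clamp01 (2 - t))\<bar> \<le> 400"
    by (simp_all add: abs_mult abs_sstep_le clamp01_range)
  then show ?thesis unfolding bump_def by (auto simp: abs_le_iff)
qed

lemma bump_eq_0: "2 \<le> \<bar>t\<bar> \<Longrightarrow> bump j t = 0"
  by (cases "0 \<le> t") (auto simp: bump_def clamp01_def sstep_0 sstep_1)

lemma bump_inner: "\<bar>t\<bar> \<le> 1 \<Longrightarrow> bump j t = (if j = 0 then 1 else 0)"
  by (auto simp: bump_def clamp01_def sstep_1 abs_le_iff min_def max_def)

lemma borel_measurable_bump [measurable]: "bump j \<in> borel_measurable borel"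
  unfolding bump_def clamp01_def sstep_def by measurable

text \<open>The list names the directions already differentiated. In a product over coordinates only
  multiplicities matter, hence \<open>count_list\<close>. The formula is the actual iterated
  derivative as long as no direction occurs more than twice.\<close>

definition cutoff :: "real \<Rightarrow> 'c list \<Rightarrow> 'c::euclidean_space \<Rightarrow> real" where
  "cutoff R l z = (\<Prod>c\<in>Basis. (1 / R) ^ count_list l c * bump (count_list l c) ((z \<bullet> c) / R))"

lemma borel_measurable_cutoff [measurable]: "cutoff R l \<in> borel_measurable borel"
  unfolding cutoff_def by measurable

lemma DERIV_cutoff:
  fixes z b :: "'c::euclidean_space"
  assumes b: "b \<in> Basis" and l: "count_list l b < 2" and R: "0 < R"
  shows "((\<lambda>t. cutoff R l (z + t *\<^sub>R b)) has_real_derivative cutoff R (b # l) z) (at 0)"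
proof -
  define r where "r = (\<Prod>c\<in>Basis - {b}. (1 / R) ^ count_list l c * bump (count_list l c) ((z \<bullet> c) / R))"
  have 1: "cutoff R l (z + t *\<^sub>R b) = (1 / R) ^ count_list l b * bump (count_list l b) ((z \<bullet> b + t) / R) * r" for t
  proof -
    have "(\<Prod>c\<in>Basis - {b}. (1 / R) ^ count_list l c * bump (count_list l c) (((z + t *\<^sub>R b) \<bullet> c) / R)) = r"
      unfolding r_def by (intro prod.cong refl) (use b in \<open>auto simp: inner_add_left inner_not_same_Basis\<close>)
    then show ?thesis
      unfolding cutoff_def using b by (subst prod.remove[of _ b]) (auto simp: inner_add_left)
  qed
  have 2: "cutoff R (b # l) z = (1 / R) ^ Suc (count_list l b) * bump (Suc (count_list l b)) ((z \<bullet> b) / R) * r"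
  proof -
    have "(\<Prod>c\<in>Basis - {b}. (1 / R) ^ count_list (b # l) c * bump (count_list (b # l) c) ((z \<bullet> c) / R)) = r"
      unfolding r_def by (intro prod.cong refl) auto
    then show ?thesis
      unfolding cutoff_def using b by (subst prod.remove[of _ b]) auto
  qed
  have "((\<lambda>t. bump (count_list l b) ((z \<bullet> b + t) / R)) has_real_derivative
      bump (Suc (count_list l b)) ((z \<bullet> b + 0) / R) * (1 / R)) (at 0)"
    by (rule DERIV_chain2[OF DERIV_bump[OF l]]) (use R in \<open>auto intro!: derivative_eq_intros\<close>)
  then have "((\<lambda>t. (1 / R) ^ count_list l b * bump (count_list l b) ((z \<bullet> b + t) / R) * r) has_real_derivative
      (1 / R) ^ count_list l b * (bump (Suc (count_list l b)) ((z \<bullet> b + 0) / R) * (1 / R)) * r) (at 0)"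
    by (intro DERIV_cmult_right DERIV_cmult)
  then show ?thesis unfolding 1 2 by (simp add: mult_ac)
qed

lemma abs_cutoff_le:
  fixes z :: "'c::euclidean_space"
  assumes R: "0 < R" and l: "set l \<subseteq> Basis"
  shows "\<bar>cutoff R l z\<bar> \<le> 801 ^ DIM('c) * (1 / R) ^ length l"
proof -
  have "(\<Sum>c\<in>Basis. count_list l c) = length l"
    using l by (subst sum_count_set) auto
  then have e: "(\<Prod>c\<in>(Basis::'c set). (1 / R) ^ count_list l c) = (1 / R) ^ length l"
    by (simp add: power_sum[symmetric])
  have "\<bar>cutoff R l z\<bar> = (\<Prod>c\<in>Basis. (1 / R) ^ count_list l c * \<bar>bump (count_list l c) ((z \<bullet> c) / R)\<bar>)"
    using R unfolding cutoff_def by (simp add: abs_prod abs_mult)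
  also have "\<dots> \<le> (\<Prod>c\<in>(Basis::'c set). (1 / R) ^ count_list l c * 801)"
    using R by (intro prod_mono conjI mult_left_mono abs_bump_le) auto
  also have "\<dots> = 801 ^ DIM('c) * (1 / R) ^ length l"
    by (simp add: prod.distrib e)
  finally show ?thesis .
qed

lemma cutoff_eq_0:
  assumes "c \<in> Basis" "2 * R \<le> \<bar>z \<bullet> c\<bar>" "0 < R"
  shows "cutoff R l z = 0"
proof -
  have "bump (count_list l c) ((z \<bullet> c) / R) = 0"
    using assms by (intro bump_eq_0) (simp add: pos_le_divide_eq)
  then show ?thesis unfolding cutoff_def using assms by (intro prod_zero) auto
qed

lemma cutoff_inner:
  fixes z :: "'c::euclidean_space"
  assumes "\<And>c. c \<in> Basis \<Longrightarrow> \<bar>z \<bullet> c\<bar> \<le> R" "0 < R" "set l \<subseteq> Basis"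
  shows "cutoff R l z = (if l = [] then 1 else 0)"
proof -
  have b: "bump j ((z \<bullet> c) / R) = (if j = 0 then 1 else 0)" if "c \<in> Basis" for c j
    using assms(1)[OF that] assms(2) by (intro bump_inner) (simp add: divide_le_eq)
  show ?thesis
  proof (cases l)
    case Nil
    then show ?thesis by (simp add: cutoff_def b)
  next
    case (Cons d l')
    then have "d \<in> Basis" using assms by auto
    then have "cutoff R l z = 0" unfolding cutoff_def
      by (intro prod_zero bexI[of _ d]) (auto simp: b Cons)
    then show ?thesis by (simp add: Cons)
  qed
qed

text \<open>Consecutive differences telescope to a partition of unity. Products of one-dimensional
  plateaus make the shells cubical rather than round.\<close>

definition dyad :: "nat \<Rightarrow> 'c list \<Rightarrow> 'c::euclidean_space \<Rightarrow> real" where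
  "dyad k l z = (if k = 0 then cutoff 1 l z else cutoff (2 ^ k) l z - cutoff (2 ^ (k - 1)) l z)"

lemma borel_measurable_dyad [measurable]: "dyad k l \<in> borel_measurable borel"
  unfolding dyad_def by measurable

lemma DERIV_dyad:
  assumes "b \<in> Basis" "count_list l b < 2"
  shows "((\<lambda>t. dyad k l (z + t *\<^sub>R b)) has_real_derivative dyad k (b # l) z) (at 0)"
  unfolding dyad_def using assms
  by (cases "k = 0") (auto intro!: DERIV_cutoff derivative_intros)

text \<open>The subtracted cutoff lives at half the scale, so each of its derivatives costs an extra
  factor 2; this gives 2 ^ length l.\<close>

lemma abs_dyad_le:
  fixes z :: "'c::euclidean_space"
  assumes l: "set l \<subseteq> Basis"
  shows "\<bar>dyad k l z\<bar> \<le> 801 ^ DIM('c) * (1 + 2 ^ length l) * (1 / 2 ^ k) ^ length l"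
proof (cases k)
  case 0
  then show ?thesis
    using abs_cutoff_le[of 1, OF _ l, of z]
      mult_left_mono[of "1::real" "1 + 2 ^ length l" "801 ^ DIM('c)"]
    by (auto simp: dyad_def intro: order_trans)
next
  case (Suc j)
  have e: "(1 / 2 ^ j) = 2 * (1 / 2 ^ k :: real)" by (simp add: Suc)
  have "\<bar>dyad k l z\<bar> \<le> \<bar>cutoff (2 ^ k) l z\<bar> + \<bar>cutoff (2 ^ j) l z\<bar>"
    by (simp add: dyad_def Suc)
  also have "\<dots> \<le> 801 ^ DIM('c) * (1 / 2 ^ k) ^ length l + 801 ^ DIM('c) * (1 / 2 ^ j) ^ length l"
    by (intro add_mono abs_cutoff_le l) auto
  also have "\<dots> = 801 ^ DIM('c) * (1 + 2 ^ length l) * (1 / 2 ^ k) ^ length l"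
    unfolding e power_mult_distrib by (simp add: algebra_simps)
  finally show ?thesis .
qed

text \<open>Outside the larger support both cutoffs vanish, and on the smaller plateau they agree.
  Hence on the support the norm is comparable to 2 ^ k, except that the piece k = 0 reaches the
  origin.\<close>

lemma dyad_nonzero:
  assumes "dyad k l z \<noteq> 0" and l: "set l \<subseteq> Basis"
  shows "\<And>c. c \<in> Basis \<Longrightarrow> \<bar>z \<bullet> c\<bar> \<le> 2 * 2 ^ k"
    and "k = 0 \<or> (\<exists>c\<in>Basis. 2 ^ k \<le> 2 * \<bar>z \<bullet> c\<bar>)"
proof -
  show "\<bar>z \<bullet> c\<bar> \<le> 2 * 2 ^ k" if c: "c \<in> Basis" for c
  proof (rule ccontr)
    assume n: "\<not> \<bar>z \<bullet> c\<bar> \<le> 2 * 2 ^ k"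
    then have "cutoff (2 ^ k) l z = 0" by (intro cutoff_eq_0[OF c]) auto
    moreover have "cutoff (2 ^ (k - 1)) l z = 0" if "k \<noteq> 0"
    proof -
      have "(2::real) ^ (k - 1) \<le> 2 ^ k" by (intro power_increasing) auto
      then have "2 * 2 ^ (k - 1) \<le> \<bar>z \<bullet> c\<bar>" using n by linarith
      then show ?thesis by (intro cutoff_eq_0[OF c]) auto
    qed
    ultimately show False using assms by (auto simp: dyad_def split: if_splits)
  qed
  show "k = 0 \<or> (\<exists>c\<in>Basis. 2 ^ k \<le> 2 * \<bar>z \<bullet> c\<bar>)"
  proof (rule ccontr)
    assume n: "\<not> ?thesis"
    then obtain j where k: "k = Suc j" by (cases k) auto
    have *: "\<bar>z \<bullet> c\<bar> \<le> 2 ^ j" if "c \<in> Basis" for c using n that by (force simp: k)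
    then have "\<bar>z \<bullet> c\<bar> \<le> 2 ^ k" if "c \<in> Basis" for c
      using that power_increasing[of j k "2::real"] by (force simp: k)
    then have "cutoff (2 ^ k) l z = (if l = [] then 1 else 0)" by (intro cutoff_inner l) auto
    moreover have "cutoff (2 ^ j) l z = (if l = [] then 1 else 0)" using * by (intro cutoff_inner l) auto
    ultimately show False using assms by (simp add: dyad_def k)
  qed
qed

lemma sum_dyad: "(\<Sum>k\<le>n. dyad k l z) = cutoff (2 ^ n) l z"
  by (induction n) (auto simp: dyad_def)

lemma cutoff_tendsto_1: "(\<lambda>n. cutoff (2 ^ n) [] z) \<longlonglongrightarrow> 1"
proof -
  obtain N :: nat where N: "norm z \<le> real N" using real_arch_simple by blast
  have "\<forall>n\<ge>N. cutoff (2 ^ n) [] z = 1"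
  proof (intro allI impI)
    fix n assume "N \<le> n"
    then have "real N \<le> 2 ^ n"
      using of_nat_less_two_power[of N, where ?'a=real] power_increasing[of N n "2::real"] by linarith
    then have "\<bar>z \<bullet> c\<bar> \<le> 2 ^ n" if "c \<in> Basis" for c
      using Basis_le_norm[OF that, of z] N by linarith
    then show "cutoff (2 ^ n) [] z = 1" by (subst cutoff_inner) auto
  qed
  then show ?thesis by (intro tendsto_eventually) (auto simp: eventually_sequentially)
qed

section \<open>Integration by parts\<close>

lemma integrable_bounded_support:
  fixes u :: "'c::euclidean_space \<Rightarrow> complex"
  assumes [measurable]: "u \<in> borel_measurable borel"
    and B: "\<And>z. norm (u z) \<le> B" and S: "\<And>z. r < norm z \<Longrightarrow> u z = 0"
  shows "integrable lborel u"
proof (rule Bochner_Integration.integrable_bound)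
  have "emeasure lborel (cball (0::'c) r) < \<infinity>"
    by (intro emeasure_bounded_finite bounded_cball)
  then show "integrable lborel (\<lambda>z. B * indicat_real (cball (0::'c) r) z)" by simp
  have "0 \<le> B" using B[of 0] norm_ge_zero order_trans by blast
  then show "AE z in lborel. norm (u z) \<le> norm (B * indicat_real (cball 0 r) z)"
    using B S by (intro AE_I2) (auto split: split_indicator simp: not_le)
qed measurable

lemma lborel_integral_translate:
  fixes u :: "'c::euclidean_space \<Rightarrow> 'b::{banach,second_countable_topology}"
  assumes [measurable]: "u \<in> borel_measurable borel"
  shows "(\<integral>z. u (z + b) \<partial>lborel) = (\<integral>z. u z \<partial>lborel)"
  by (subst (2) lborel_distr_plus[of b, symmetric]) (simp add: integral_distr add.commute)

text \<open>Difference quotients of an integrable function have integral 0 by translation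
  invariance. Dominated convergence carries this to the derivative, with the majorant from the mean
  value inequality; continuity of the derivative is not involved.\<close>

lemma integral_directional_derivative_eq_0:
  fixes w w' :: "'c::euclidean_space \<Rightarrow> complex"
  assumes [measurable]: "w \<in> borel_measurable borel" "w' \<in> borel_measurable borel"
    and D: "\<And>z. ((\<lambda>t. w (z + t *\<^sub>R b)) has_vector_derivative w' z) (at 0)"
    and B: "\<And>z. norm (w z) \<le> B" "\<And>z. norm (w' z) \<le> B"
    and S: "\<And>z. r < norm z \<Longrightarrow> w z = 0"
  shows "(\<integral>z. w' z \<partial>lborel) = 0"
proof -
  define h where "h n = 1 / real (Suc n)" for n
  have h: "0 < h n" "h n \<le> 1" for n by (auto simp: h_def)
  define s where "s n z = (w (z + h n *\<^sub>R b) - w z) /\<^sub>R h n" for n z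
  have [measurable]: "s n \<in> borel_measurable borel" for n unfolding s_def by measurable
  have B0: "0 \<le> B" using B(1)[of 0] norm_ge_zero order_trans by blast
  \<comment> \<open>The hypothesis at t = 0, applied at every base point of the line, gives
    differentiability along the whole line.\<close>
  have D': "((\<lambda>t. w (z + t *\<^sub>R b)) has_vector_derivative w' (z + t0 *\<^sub>R b)) (at t0)" for z t0
  proof -
    have "((\<lambda>t. w ((z + t0 *\<^sub>R b) + t *\<^sub>R b)) has_vector_derivative w' (z + t0 *\<^sub>R b)) (at (t0 - t0))"
      using D[of "z + t0 *\<^sub>R b"] by simp
    then have "((\<lambda>t. w ((z + t0 *\<^sub>R b) + (t - t0) *\<^sub>R b)) has_vector_derivative 1 *\<^sub>R w' (z + t0 *\<^sub>R b)) (at t0)"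
      by (intro vector_diff_chain_at[where f = "\<lambda>t. t - t0" and g = "\<lambda>t. w ((z + t0 *\<^sub>R b) + t *\<^sub>R b)", unfolded o_def])
         (auto intro!: derivative_eq_intros)
    then show ?thesis by (simp add: algebra_simps)
  qed
  have MVT: "norm (w (z + t *\<^sub>R b) - w z) \<le> B * \<bar>t\<bar>" for z t
  proof -
    have "norm (w (z + t *\<^sub>R b) - w (z + 0 *\<^sub>R b)) \<le> B * norm (t - 0)"
    proof (rule differentiable_bound[of UNIV "\<lambda>t. w (z + t *\<^sub>R b)" "\<lambda>t h. h *\<^sub>R w' (z + t *\<^sub>R b)"])
      show "((\<lambda>t. w (z + t *\<^sub>R b)) has_derivative (\<lambda>h. h *\<^sub>R w' (z + x *\<^sub>R b))) (at x within UNIV)" for x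
        using D'[of z x] by (simp add: has_vector_derivative_def)
      show "onorm (\<lambda>h. h *\<^sub>R w' (z + x *\<^sub>R b)) \<le> B" for x
        using B(2) by (intro onorm_le) (auto simp: mult.commute[of B] intro: mult_left_mono)
    qed auto
    then show ?thesis by simp
  qed
  have lim: "(\<lambda>n. s n z) \<longlonglongrightarrow> w' z" for z
  proof -
    have "((\<lambda>t. (w (z + t *\<^sub>R b) - w z) /\<^sub>R t) \<longlongrightarrow> w' z) (at 0)"
    proof -
      have "((\<lambda>t. norm (w (z + t *\<^sub>R b) - w z - t *\<^sub>R w' z) / norm t) \<longlongrightarrow> 0) (at 0)"
        using D[of z] unfolding has_vector_derivative_def has_derivative_at by simp
      moreover have "norm (w (z + t *\<^sub>R b) - w z - t *\<^sub>R w' z) / norm t =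
          norm ((w (z + t *\<^sub>R b) - w z) /\<^sub>R t - w' z)" if "t \<noteq> 0" for t
      proof -
        have "(w (z + t *\<^sub>R b) - w z) /\<^sub>R t - w' z = (w (z + t *\<^sub>R b) - w z - t *\<^sub>R w' z) /\<^sub>R t"
          using that by (simp add: scaleR_right_diff_distrib)
        then show ?thesis by (simp add: divide_inverse_commute)
      qed
      ultimately have "((\<lambda>t. norm ((w (z + t *\<^sub>R b) - w z) /\<^sub>R t - w' z)) \<longlongrightarrow> 0) (at 0)"
        by - (erule Lim_transform_eventually, simp add: eventually_at_filter)
      then show ?thesis by (simp add: tendsto_norm_zero_iff Lim_null[symmetric])
    qed
    moreover have "filterlim h (at 0) sequentially"
      unfolding filterlim_at h_def using lim_1_over_n[THEN LIMSEQ_Suc] by (auto simp: eventually_sequentially)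
    ultimately show ?thesis unfolding s_def by (rule filterlim_compose)
  qed
  \<comment> \<open>The steps \<open>h n\<close> are at most 1, so the quotients live at most
    \<open>norm b\<close> outside the original ball.\<close>
  define r' where "r' = r + norm b"
  have s0: "s n z = 0" if "r' < norm z" for n z
  proof -
    have "norm (h n *\<^sub>R b) \<le> norm b" using h[of n] by (auto simp: mult_left_le_one_le)
    moreover have "norm z - norm (h n *\<^sub>R b) \<le> norm (z + h n *\<^sub>R b)"
      using norm_diff_ineq[of z "h n *\<^sub>R b"] by simp
    ultimately have "r < norm (z + h n *\<^sub>R b)" using that by (simp add: r'_def)
    moreover have "r < norm z" using that norm_ge_zero[of b] unfolding r'_def by linarith
    ultimately show ?thesis by (simp add: s_def S)
  qed
  have sB: "norm (s n z) \<le> B * indicat_real (cball 0 r') z" for n z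
  proof (cases "r' < norm z")
    case False
    have "norm (s n z) = norm (w (z + h n *\<^sub>R b) - w z) / h n"
      using h[of n] by (simp add: s_def divide_inverse_commute)
    also have "\<dots> \<le> B" using MVT[of z "h n"] h[of n] by (simp add: pos_divide_le_eq)
    finally show ?thesis using False by (simp add: not_less)
  qed (simp add: s0)
  have iw: "integrable lborel w" using B S by (intro integrable_bounded_support) auto
  have "(\<lambda>n. \<integral>z. s n z \<partial>lborel) \<longlonglongrightarrow> (\<integral>z. w' z \<partial>lborel)"
  proof (rule integral_dominated_convergence)
    have "emeasure lborel (cball (0::'c) r') < \<infinity>"
      by (intro emeasure_bounded_finite bounded_cball)
    then show "integrable lborel (\<lambda>z. B * indicat_real (cball (0::'c) r') z)" by simp
  qed (use sB lim in auto)
  moreover have "(\<integral>z. s n z \<partial>lborel) = 0" for n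
  proof -
    have "integrable lborel (\<lambda>z. w (z + h n *\<^sub>R b))"
    proof (rule integrable_bounded_support)
      fix z :: 'c assume "r + norm b < norm z"
      moreover have "norm (h n *\<^sub>R b) \<le> norm b" using h[of n] by (auto simp: mult_left_le_one_le)
      moreover have "norm z - norm (h n *\<^sub>R b) \<le> norm (z + h n *\<^sub>R b)"
        using norm_diff_ineq[of z "h n *\<^sub>R b"] by simp
      ultimately show "w (z + h n *\<^sub>R b) = 0" by (intro S) linarith
    qed (use B in auto)
    then show ?thesis unfolding s_def using iw by (simp add: lborel_integral_translate)
  qed
  ultimately show ?thesis by (simp add: LIMSEQ_const_iff)
qed

lemma integral_by_parts_cis:
  fixes u u' :: "'c::euclidean_space \<Rightarrow> complex"
  assumes [measurable]: "u \<in> borel_measurable borel" "u' \<in> borel_measurable borel"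
    and D: "\<And>z. ((\<lambda>t. u (z + t *\<^sub>R b)) has_vector_derivative u' z) (at 0)"
    and B: "\<And>z. norm (u z) \<le> B" "\<And>z. norm (u' z) \<le> B"
    and S: "\<And>z. r < norm z \<Longrightarrow> u z = 0" "\<And>z. r < norm z \<Longrightarrow> u' z = 0"
  shows "(\<integral>z. u' z * cis (v \<bullet> z) \<partial>lborel) = - \<i> * of_real (v \<bullet> b) * (\<integral>z. u z * cis (v \<bullet> z) \<partial>lborel)"
proof -
  let ?w = "\<lambda>z. u z * cis (v \<bullet> z)"
  let ?w' = "\<lambda>z. u' z * cis (v \<bullet> z) + \<i> * of_real (v \<bullet> b) * (u z * cis (v \<bullet> z))"
  have B0: "0 \<le> B" using B(1)[of 0] norm_ge_zero order_trans by blast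
  have "(\<integral>z. ?w' z \<partial>lborel) = 0"
  proof (rule integral_directional_derivative_eq_0)
    fix z
    have "((\<lambda>t. cis (v \<bullet> (z + t *\<^sub>R b))) has_vector_derivative (v \<bullet> b) *\<^sub>R (\<i> * cis (v \<bullet> z))) (at 0)"
    proof -
      have 1: "((\<lambda>t. v \<bullet> (z + t *\<^sub>R b)) has_vector_derivative (v \<bullet> b)) (at 0)"
        unfolding has_real_derivative_iff_has_vector_derivative[symmetric] inner_add_right inner_scaleR_right
        by (auto intro!: derivative_eq_intros)
      have 2: "(cis has_vector_derivative (\<i> * cis x)) (at x)" for x
      proof -
        have "((\<lambda>t. exp (\<i> * complex_of_real t)) has_vector_derivative \<i> * exp (\<i> * complex_of_real x)) (at x)"
          using has_vector_derivative_iexp[of x UNIV] by simp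
        then show ?thesis by (simp add: cis_conv_exp[abs_def])
      qed
      show ?thesis using vector_diff_chain_at[OF 1 2] by (simp add: o_def)
    qed
    from has_vector_derivative_mult[OF D this]
    show "((\<lambda>t. ?w (z + t *\<^sub>R b)) has_vector_derivative ?w' z) (at 0)"
      by (simp add: scaleR_conv_of_real algebra_simps)
    show "norm (?w z) \<le> B + \<bar>v \<bullet> b\<bar> * B" using B(1)[of z] B0
      by (simp add: norm_mult) (smt (verit) mult_nonneg_nonneg abs_ge_zero)
    have "norm (?w' z) \<le> norm (u' z) + \<bar>v \<bullet> b\<bar> * norm (u z)"
      by (rule order_trans[OF norm_triangle_ineq]) (simp add: norm_mult)
    also have "\<dots> \<le> B + \<bar>v \<bullet> b\<bar> * B" by (intro add_mono mult_left_mono B) simp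
    finally show "norm (?w' z) \<le> B + \<bar>v \<bullet> b\<bar> * B" .
    show "r < norm z \<Longrightarrow> ?w z = 0" by (simp add: S)
  qed measurable
  moreover have "integrable lborel u" "integrable lborel u'"
    using B S by (auto intro!: integrable_bounded_support)
  then have "integrable lborel ?w" "integrable lborel (\<lambda>z. u' z * cis (v \<bullet> z))"
    by (auto intro!: integrable_cis_mult)
  ultimately have "(\<integral>z. u' z * cis (v \<bullet> z) \<partial>lborel) + \<i> * of_real (v \<bullet> b) * (\<integral>z. ?w z \<partial>lborel) = 0"
    by simp
  then show ?thesis by (simp add: add_eq_0_iff)
qed

text \<open>
  \<open>leib \<delta> A P bs [] []\<close> is the result of applying the operators \<open>1 - \<delta> * partial b\<close>,
  b in bs, to \<open>A [] * P []\<close>, expanded by the Leibniz rule; \<open>A l\<close> and \<open>P l\<close> stand for the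
  iterated derivatives along l. New directions are appended on the right, i.e. innermost, so that
  no two partial derivatives ever have to be exchanged.
\<close>

fun leib :: "real \<Rightarrow> ('c list \<Rightarrow> 'c \<Rightarrow> complex) \<Rightarrow> ('c list \<Rightarrow> 'c \<Rightarrow> real) \<Rightarrow>
    'c list \<Rightarrow> 'c list \<Rightarrow> 'c list \<Rightarrow> 'c \<Rightarrow> complex" where
  "leib \<delta> A P [] l1 l2 z = A l1 z * of_real (P l2 z)"
| "leib \<delta> A P (b # bs) l1 l2 z = leib \<delta> A P bs l1 l2 z
     - of_real \<delta> * leib \<delta> A P bs (l1 @ [b]) l2 z - of_real \<delta> * leib \<delta> A P bs l1 (l2 @ [b]) z"

text \<open>Derivatives are given as families indexed by direction lists, the latest one in front.
  \<open>P_deriv\<close> stops at two derivatives per direction, the smoothness of the cutoff. The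
  compact support of \<open>P\<close> is what bounds the products, as \<open>A\<close> is merely
  continuous.\<close>

locale symbol_cutoff =
  fixes A :: "'c::euclidean_space list \<Rightarrow> 'c \<Rightarrow> complex" and P :: "'c list \<Rightarrow> 'c \<Rightarrow> real" and r :: real
  assumes A_deriv: "\<And>l b z. set l \<subseteq> Basis \<Longrightarrow> b \<in> Basis \<Longrightarrow>
      ((\<lambda>t. A l (z + t *\<^sub>R b)) has_vector_derivative A (b # l) z) (at 0)"
    and A_cont: "\<And>l. set l \<subseteq> Basis \<Longrightarrow> continuous_on UNIV (A l)"
    and P_deriv: "\<And>l b z. set l \<subseteq> Basis \<Longrightarrow> b \<in> Basis \<Longrightarrow> count_list l b < 2 \<Longrightarrow>
      ((\<lambda>t. P l (z + t *\<^sub>R b)) has_real_derivative P (b # l) z) (at 0)"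
    and P_meas [measurable]: "\<And>l. P l \<in> borel_measurable borel"
    and P_bound: "\<And>l. set l \<subseteq> Basis \<Longrightarrow> \<exists>B. \<forall>z. \<bar>P l z\<bar> \<le> B"
    and P_supp: "\<And>l z. set l \<subseteq> Basis \<Longrightarrow> r < norm z \<Longrightarrow> P l z = 0"
begin

lemma A_meas: "set l \<subseteq> Basis \<Longrightarrow> A l \<in> borel_measurable borel"
  by (intro borel_measurable_continuous_onI A_cont)

lemma leib_meas:
  "set bs \<subseteq> Basis \<Longrightarrow> set l1 \<subseteq> Basis \<Longrightarrow> leib \<delta> A P bs l1 l2 \<in> borel_measurable borel"
proof (induction bs arbitrary: l1 l2)
  case Nil
  then have [measurable]: "A l1 \<in> borel_measurable borel" by (intro A_meas)
  show ?case by simp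
next
  case (Cons b bs)
  have [measurable]: "leib \<delta> A P bs l1 l2 \<in> borel_measurable borel" "leib \<delta> A P bs (l1 @ [b]) l2 \<in> borel_measurable borel"
     "leib \<delta> A P bs l1 (l2 @ [b]) \<in> borel_measurable borel" using Cons by auto
  show ?case by simp
qed

lemma leib_supp:
  "set bs \<subseteq> Basis \<Longrightarrow> set l2 \<subseteq> Basis \<Longrightarrow> r < norm z \<Longrightarrow> leib \<delta> A P bs l1 l2 z = 0"
  by (induction bs arbitrary: l1 l2) (auto simp: P_supp)

lemma leib_bound:
  "set bs \<subseteq> Basis \<Longrightarrow> set l1 \<subseteq> Basis \<Longrightarrow> set l2 \<subseteq> Basis \<Longrightarrow> \<exists>B. \<forall>z. norm (leib \<delta> A P bs l1 l2 z) \<le> B"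
proof (induction bs arbitrary: l1 l2)
  case Nil
  have "compact (A l1 ` cball 0 r)"
    using Nil by (intro compact_continuous_image continuous_on_subset[OF A_cont]) auto
  then obtain BA where BA: "\<And>z. z \<in> cball 0 r \<Longrightarrow> norm (A l1 z) \<le> BA"
    by (meson bounded_iff compact_imp_bounded imageI)
  obtain BP where BP: "\<And>z. \<bar>P l2 z\<bar> \<le> BP" using P_bound Nil by blast
  have "norm (leib \<delta> A P [] l1 l2 z) \<le> \<bar>BA\<bar> * BP" for z
  proof (cases "r < norm z")
    case True
    then show ?thesis using P_supp[of l2 z] Nil BP[of z] by simp
  next
    case False
    then have "norm (A l1 z) \<le> \<bar>BA\<bar>" using BA[of z] by (auto simp: not_less)
    then show ?thesis using BP[of z] by (auto simp: norm_mult intro!: mult_mono)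
  qed
  then show ?case by blast
next
  case (Cons b bs)
  obtain B1 where 1: "\<And>z. norm (leib \<delta> A P bs l1 l2 z) \<le> B1" using Cons.IH[of l1 l2] Cons.prems by auto
  obtain B2 where 2: "\<And>z. norm (leib \<delta> A P bs (l1 @ [b]) l2 z) \<le> B2" using Cons.IH[of "l1 @ [b]" l2] Cons.prems by auto
  obtain B3 where 3: "\<And>z. norm (leib \<delta> A P bs l1 (l2 @ [b]) z) \<le> B3" using Cons.IH[of l1 "l2 @ [b]"] Cons.prems by auto
  have "norm (leib \<delta> A P (b # bs) l1 l2 z) \<le> B1 + \<bar>\<delta>\<bar> * B2 + \<bar>\<delta>\<bar> * B3" for z
  proof -
    have "norm (leib \<delta> A P (b # bs) l1 l2 z) \<le> norm (leib \<delta> A P bs l1 l2 z)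
       + norm (of_real \<delta> * leib \<delta> A P bs (l1 @ [b]) l2 z) + norm (of_real \<delta> * leib \<delta> A P bs l1 (l2 @ [b]) z)"
      unfolding leib.simps by (intro order_trans[OF norm_triangle_ineq4] add_mono order_refl norm_triangle_ineq4)
    also have "\<dots> \<le> B1 + \<bar>\<delta>\<bar> * B2 + \<bar>\<delta>\<bar> * B3"
      unfolding norm_mult norm_of_real by (intro add_mono mult_left_mono 1 2 3) auto
    finally show ?thesis .
  qed
  then show ?case by blast
qed

text \<open>The bound counts \<open>b\<close> in \<open>bs @ l2\<close> because in the worst term of
  the expansion all of \<open>bs\<close> falls on the cutoff.\<close>

lemma leib_deriv:
  assumes "b \<in> Basis"
  shows "set bs \<subseteq> Basis \<Longrightarrow> set l1 \<subseteq> Basis \<Longrightarrow> set l2 \<subseteq> Basis \<Longrightarrow> count_list (bs @ l2) b < 2 \<Longrightarrow>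
    ((\<lambda>t. leib \<delta> A P bs l1 l2 (z + t *\<^sub>R b)) has_vector_derivative
      leib \<delta> A P bs (b # l1) l2 z + leib \<delta> A P bs l1 (b # l2) z) (at 0)"
proof (induction bs arbitrary: l1 l2)
  case Nil
  have 1: "((\<lambda>t. A l1 (z + t *\<^sub>R b)) has_vector_derivative A (b # l1) z) (at 0)"
    using Nil assms by (intro A_deriv) auto
  have 2: "((\<lambda>t. complex_of_real (P l2 (z + t *\<^sub>R b))) has_vector_derivative complex_of_real (P (b # l2) z)) (at 0)"
    using Nil assms by (intro has_vector_derivative_of_real P_deriv) auto
  show ?case using has_vector_derivative_mult[OF 1 2] by (simp add: add.commute)
next
  case (Cons d bs)
  have 1: "((\<lambda>t. leib \<delta> A P bs l1 l2 (z + t *\<^sub>R b)) has_vector_derivative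
      leib \<delta> A P bs (b # l1) l2 z + leib \<delta> A P bs l1 (b # l2) z) (at 0)"
    using Cons.prems by (intro Cons.IH) (auto split: if_splits)
  have 2: "((\<lambda>t. leib \<delta> A P bs (l1 @ [d]) l2 (z + t *\<^sub>R b)) has_vector_derivative
      leib \<delta> A P bs (b # (l1 @ [d])) l2 z + leib \<delta> A P bs (l1 @ [d]) (b # l2) z) (at 0)"
    using Cons.prems by (intro Cons.IH) (auto split: if_splits)
  have 3: "((\<lambda>t. leib \<delta> A P bs l1 (l2 @ [d]) (z + t *\<^sub>R b)) has_vector_derivative
      leib \<delta> A P bs (b # l1) (l2 @ [d]) z + leib \<delta> A P bs l1 (b # (l2 @ [d])) z) (at 0)"
    using Cons.prems by (intro Cons.IH) (auto split: if_splits)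
  show ?case
    unfolding leib.simps
    by (rule has_vector_derivative_eq_rhs[OF has_vector_derivative_diff[OF has_vector_derivative_diff[OF 1
          has_vector_derivative_mult_right[OF 2]] has_vector_derivative_mult_right[OF 3]]])
       (simp add: algebra_simps)
qed

text \<open>By parts, the derivative along \<open>b\<close> turns into multiplication by - i (v .
  b), so each operator 1 - \<delta> * \<open>partial b\<close> becomes the factor 1 + i \<delta> (v
  . b). At most two occurrences of a direction leave at most one in the tail, as differentiation
  requires.\<close>

lemma integral_leib:
  assumes "set bs \<subseteq> Basis" "\<And>c. count_list bs c \<le> 2"
  shows "(\<integral>z. leib \<delta> A P bs [] [] z * cis (v \<bullet> z) \<partial>lborel) =
    (\<Prod>b\<leftarrow>bs. 1 + \<i> * of_real (\<delta> * (v \<bullet> b))) * (\<integral>z. A [] z * of_real (P [] z) * cis (v \<bullet> z) \<partial>lborel)"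
  using assms
proof (induction bs)
  case (Cons b bs)
  have b: "b \<in> Basis" "set bs \<subseteq> Basis" using Cons.prems by auto
  have c: "count_list bs b < 2" using Cons.prems(2)[of b] by simp
  have c': "count_list bs x \<le> 2" for x using Cons.prems(2)[of x] by (simp split: if_splits)
  \<comment> \<open>On empty lists prepending and appending \<open>b\<close> agree; so the
    derivative delivered by \<open>leib_deriv\<close> is the one subtracted in the definition of
    \<open>leib\<close>.\<close>
  let ?u = "leib \<delta> A P bs [] []" and ?u' = "\<lambda>z. leib \<delta> A P bs [b] [] z + leib \<delta> A P bs [] [b] z"
  have m[measurable]: "?u \<in> borel_measurable borel" "leib \<delta> A P bs [b] [] \<in> borel_measurable borel"
     "leib \<delta> A P bs [] [b] \<in> borel_measurable borel" using b by (auto intro!: leib_meas)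
  obtain B1 where 1: "\<And>z. norm (?u z) \<le> B1" using leib_bound[of bs "[]" "[]" \<delta>] b by auto
  obtain B2 where 2: "\<And>z. norm (leib \<delta> A P bs [b] [] z) \<le> B2" using leib_bound[of bs "[b]" "[]" \<delta>] b by auto
  obtain B3 where 3: "\<And>z. norm (leib \<delta> A P bs [] [b] z) \<le> B3" using leib_bound[of bs "[]" "[b]" \<delta>] b by auto
  have B0: "0 \<le> B1" "0 \<le> B2" "0 \<le> B3" using 1 2 3 norm_ge_zero order_trans by blast+
  have u': "norm (?u' z) \<le> B2 + B3" for z by (rule norm_triangle_le) (intro add_mono 2 3)
  have IBP: "(\<integral>z. ?u' z * cis (v \<bullet> z) \<partial>lborel) = - \<i> * of_real (v \<bullet> b) * (\<integral>z. ?u z * cis (v \<bullet> z) \<partial>lborel)"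
  proof (rule integral_by_parts_cis)
    show "((\<lambda>t. ?u (z + t *\<^sub>R b)) has_vector_derivative ?u' z) (at 0)" for z
      using b c by (intro leib_deriv) auto
    show "norm (?u z) \<le> B1 + B2 + B3" for z using 1[of z] B0 by linarith
    show "norm (?u' z) \<le> B1 + B2 + B3" for z using u'[of z] B0 by linarith
    show "r < norm z \<Longrightarrow> ?u z = 0" "r < norm z \<Longrightarrow> ?u' z = 0" for z using b by (simp_all add: leib_supp)
  qed measurable
  have i: "integrable lborel ?u" "integrable lborel ?u'"
    using 1 u' b by (auto intro!: integrable_bounded_support[where r = r] simp: leib_supp)
  then have i: "integrable lborel (\<lambda>z. ?u z * cis (v \<bullet> z))" "integrable lborel (\<lambda>z. ?u' z * cis (v \<bullet> z))"
    by (auto intro!: integrable_cis_mult)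
  have "(\<integral>z. leib \<delta> A P (b # bs) [] [] z * cis (v \<bullet> z) \<partial>lborel) =
     (\<integral>z. ?u z * cis (v \<bullet> z) - of_real \<delta> * (?u' z * cis (v \<bullet> z)) \<partial>lborel)"
    by (intro Bochner_Integration.integral_cong refl) (simp add: algebra_simps)
  also have "\<dots> = (\<integral>z. ?u z * cis (v \<bullet> z) \<partial>lborel) - of_real \<delta> * (\<integral>z. ?u' z * cis (v \<bullet> z) \<partial>lborel)"
    using i by simp
  also have "\<dots> = (1 + \<i> * of_real (\<delta> * (v \<bullet> b))) * (\<integral>z. ?u z * cis (v \<bullet> z) \<partial>lborel)"
    unfolding IBP by (simp add: algebra_simps)
  finally show ?case using Cons.IH[OF b(2) c'] by (simp add: mult.assoc)
qed simp

end

section \<open>Dyadic pieces of a rough symbol\<close>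

text \<open>Rounding the second argument down to the grid of mesh 1/(n+1) leaves countably many
  values, where joint measurability is clear; continuity gives the limit.\<close>

lemma borel_measurable_Caratheodory:
  fixes f :: "'x \<Rightarrow> 'z::euclidean_space \<Rightarrow> 'b::real_normed_vector"
  assumes m: "\<And>z. (\<lambda>x. f x z) \<in> borel_measurable M"
    and c: "\<And>x. continuous_on UNIV (f x)"
  shows "(\<lambda>p. f (fst p) (snd p)) \<in> borel_measurable (M \<Otimes>\<^sub>M borel)"
proof -
  define g where "g n z = (\<Sum>b\<in>Basis. (of_int \<lfloor>real (Suc n) * (z \<bullet> b)\<rfloor> / real (Suc n)) *\<^sub>R b)" for n and z :: 'z
  have [measurable]: "g n \<in> borel_measurable borel" for n unfolding g_def by measurable
  have cnt: "countable (range (g n))" for n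
  proof (rule countable_subset)
    show "range (g n) \<subseteq> (\<lambda>q. \<Sum>b\<in>Basis. (of_int (q b) / real (Suc n)) *\<^sub>R b) ` (Basis \<rightarrow>\<^sub>E (UNIV::int set))"
    proof safe
      fix z :: 'z
      show "g n z \<in> (\<lambda>q. \<Sum>b\<in>Basis. (of_int (q b) / real (Suc n)) *\<^sub>R b) ` (Basis \<rightarrow>\<^sub>E (UNIV::int set))"
        unfolding g_def
        by (intro image_eqI[of _ _ "restrict (\<lambda>b. \<lfloor>real (Suc n) * (z \<bullet> b)\<rfloor>) Basis"]) auto
    qed
    show "countable ((\<lambda>q. \<Sum>b\<in>Basis. (of_int (q b) / real (Suc n)) *\<^sub>R b) ` (Basis \<rightarrow>\<^sub>E (UNIV::int set)))"
      by (intro countable_image countable_PiE) auto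
  qed
  have fm: "(\<lambda>p. f (fst p) (g n (snd p))) \<in> borel_measurable (M \<Otimes>\<^sub>M borel)" for n
  proof (rule measurable_compose_countable'[of "range (g n)" "\<lambda>z p. f (fst p) z" _ _ "\<lambda>p. g n (snd p)"])
    show "(\<lambda>p. f (fst p) z) \<in> borel_measurable (M \<Otimes>\<^sub>M borel)" for z
      by (rule measurable_compose[OF measurable_fst m])
    show "(\<lambda>p. g n (snd p)) \<in> measurable (M \<Otimes>\<^sub>M borel) (count_space (range (g n)))"
    proof (subst measurable_count_space_eq_countable[OF cnt], intro conjI ballI)
      fix a :: 'z
      have [measurable]: "(\<lambda>p. g n (snd p)) \<in> borel_measurable (M \<Otimes>\<^sub>M borel)" by measurable
      show "(\<lambda>p. g n (snd p)) -` {a} \<inter> space (M \<Otimes>\<^sub>M borel) \<in> sets (M \<Otimes>\<^sub>M borel)"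
        by (rule measurable_sets[of _ _ borel]) auto
    qed auto
  qed (rule cnt)
  have gl: "(\<lambda>n. g n z) \<longlonglongrightarrow> z" for z
  proof -
    have "(\<lambda>n. of_int \<lfloor>real (Suc n) * t\<rfloor> / real (Suc n)) \<longlonglongrightarrow> t" for t :: real
    proof (rule real_tendsto_sandwich)
      show "\<forall>\<^sub>F n in sequentially. t - 1 / real (Suc n) \<le> of_int \<lfloor>real (Suc n) * t\<rfloor> / real (Suc n)"
      proof (intro always_eventually allI)
        fix n
        have "real (Suc n) * t - 1 \<le> of_int \<lfloor>real (Suc n) * t\<rfloor>" by linarith
        then have "(real (Suc n) * t - 1) / real (Suc n) \<le> of_int \<lfloor>real (Suc n) * t\<rfloor> / real (Suc n)"
          by (rule divide_right_mono) simp
        then show "t - 1 / real (Suc n) \<le> of_int \<lfloor>real (Suc n) * t\<rfloor> / real (Suc n)"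
          by (simp add: diff_divide_distrib del: of_nat_Suc)
      qed
      show "\<forall>\<^sub>F n in sequentially. of_int \<lfloor>real (Suc n) * t\<rfloor> / real (Suc n) \<le> t"
        by (intro always_eventually allI) (simp add: divide_le_eq mult.commute del: of_nat_Suc)
      have "(\<lambda>n. t - 1 / real (Suc n)) \<longlonglongrightarrow> t - 0"
        by (intro tendsto_diff tendsto_const lim_1_over_n[THEN LIMSEQ_Suc])
      then show "(\<lambda>n. t - 1 / real (Suc n)) \<longlonglongrightarrow> t" by simp
    qed auto
    then have "(\<lambda>n. g n z) \<longlonglongrightarrow> (\<Sum>b\<in>Basis. (z \<bullet> b) *\<^sub>R b)"
      unfolding g_def by (intro tendsto_sum tendsto_scaleR tendsto_const)
    then show ?thesis by (simp add: euclidean_representation)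
  qed
  show ?thesis
  proof (rule borel_measurable_LIMSEQ_metric[OF fm])
    fix p
    have "isCont (f (fst p)) (snd p)" using c by (simp add: continuous_on_eq_continuous_at)
    then show "(\<lambda>n. f (fst p) (g n (snd p))) \<longlonglongrightarrow> f (fst p) (snd p)"
      by (rule isCont_tendsto_compose) (rule gl)
  qed
qed

text \<open>Contains the support of \<open>dyad k\<close>. It is polymorphic so that the cube in the
  pair (\<xi>, \<eta>) is the product of the cubes in \<xi> and in \<eta>.\<close>

definition cube :: "nat \<Rightarrow> 'c::euclidean_space set" where
  "cube k = {z. \<forall>c\<in>Basis. \<bar>z \<bullet> c\<bar> \<le> 2 * 2 ^ k}"

lemma cube_eq_cbox: "cube k = cbox (- (\<Sum>b\<in>Basis. (2 * 2 ^ k) *\<^sub>R b)) (\<Sum>b\<in>Basis. (2 * 2 ^ k) *\<^sub>R b)"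
  by (auto simp: cube_def mem_box abs_le_iff) (metis minus_le_iff)+

lemma sets_cube [measurable]: "cube k \<in> sets borel"
  by (simp add: cube_eq_cbox)

lemma emeasure_cube: "emeasure lborel (cube k :: 'c::euclidean_space set) = ennreal ((4 * 2 ^ k) ^ DIM('c))"
proof -
  let ?u = "\<Sum>b\<in>(Basis::'c set). (2 * 2 ^ k) *\<^sub>R b"
  have u: "?u \<bullet> b = 2 * 2 ^ k" if "b \<in> Basis" for b
    using that by simp
  have "emeasure lborel (cube k :: 'c set) = ennreal (\<Prod>b\<in>Basis. (?u - (- ?u)) \<bullet> b)"
    unfolding cube_eq_cbox by (subst emeasure_lborel_cbox) (auto simp only: u inner_minus_left, simp)
  also have "(\<Prod>b\<in>(Basis::'c set). (?u - (- ?u)) \<bullet> b) = (\<Prod>b\<in>(Basis::'c set). 4 * 2 ^ k)"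
    by (intro prod.cong refl) (simp add: inner_add_left)
  finally show ?thesis by simp
qed

lemma norm_le_cube:
  fixes z :: "'c::euclidean_space"
  assumes "z \<in> cube k"
  shows "norm z \<le> real DIM('c) * (2 * 2 ^ k)"
proof -
  have "norm z \<le> (\<Sum>b\<in>Basis. \<bar>z \<bullet> b\<bar>)" by (rule norm_le_l1)
  also have "\<dots> \<le> (\<Sum>b\<in>(Basis::'c set). 2 * 2 ^ k)"
    using assms by (intro sum_mono) (auto simp: cube_def)
  finally show ?thesis by simp
qed

lemma cube_prod: "z \<in> cube k \<longleftrightarrow> fst z \<in> cube k \<and> snd z \<in> cube k"
  by (cases z) (auto simp: cube_def Basis_prod_def ball_Un)

text \<open>Both bounds on t are used, according to the sign of e: the order of the differentiated
  symbol may be negative.\<close>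

lemma powr_comparable:
  fixes s t K e :: real
  assumes "0 < s" "s / 2 \<le> t" "t \<le> K * s" "1 \<le> K"
  shows "t powr e \<le> (2 * K) powr \<bar>e\<bar> * s powr e"
proof (cases "0 \<le> e")
  case True
  have "t powr e \<le> (2 * K * s) powr e"
    using assms True by (intro powr_mono2) auto
  then show ?thesis using True assms by (simp add: powr_mult)
next
  case False
  have "t powr e \<le> (s / 2) powr e" using assms False by (intro powr_mono2') auto
  also have "\<dots> = 2 powr \<bar>e\<bar> * s powr e"
    using False assms by (simp add: powr_divide powr_minus divide_simps)
  also have "\<dots> \<le> (2 * K) powr \<bar>e\<bar> * s powr e"
    using assms by (intro mult_right_mono powr_mono2) auto
  finally show ?thesis .
qed

text \<open>The symbol enters with its whole family of derivatives, and \<theta> stands for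
  1/p.\<close>

locale Lp_symbol =
  fixes A :: "'a::euclidean_space \<Rightarrow> ('a \<times> 'a) list \<Rightarrow> 'a \<times> 'a \<Rightarrow> complex" and \<theta> m \<rho> :: real
  assumes \<theta>: "0 \<le> \<theta>" "\<theta> \<le> 1" and \<rho>: "0 \<le> \<rho>" "\<rho> \<le> 1"
    and A_deriv: "\<And>x l b z. set l \<subseteq> Basis \<Longrightarrow> b \<in> Basis \<Longrightarrow>
      ((\<lambda>t. A x l (z + t *\<^sub>R b)) has_vector_derivative A x (b # l) z) (at 0)"
    and A_cont: "\<And>x l. set l \<subseteq> Basis \<Longrightarrow> continuous_on UNIV (A x l)"
    and A_meas: "\<And>l z. set l \<subseteq> Basis \<Longrightarrow> (\<lambda>x. A x l z) \<in> borel_measurable borel"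
    and A_norm: "\<And>l. set l \<subseteq> Basis \<Longrightarrow> \<exists>C. \<forall>z. nLq \<theta> (\<lambda>x. A x l z) \<le>
       ennreal (C * (1 + norm (fst z) + norm (snd z)) powr (m - \<rho> * real (length l)))"
begin

lemma A_joint_measurable:
  "set l \<subseteq> Basis \<Longrightarrow> (\<lambda>p. A (fst p) l (snd p)) \<in> borel_measurable (borel \<Otimes>\<^sub>M borel)"
  by (intro borel_measurable_Caratheodory[of "\<lambda>x. A x l"] A_meas A_cont)

sublocale sc: symbol_cutoff "A x" "dyad k" "real DIM('a \<times> 'a) * (2 * 2 ^ k)" for x :: 'a and k :: nat
proof
  fix l :: "('a \<times> 'a) list" and z :: "'a \<times> 'a"
  assume l: "set l \<subseteq> Basis"
  show "\<exists>B. \<forall>z. \<bar>dyad k l z\<bar> \<le> B" using abs_dyad_le[OF l] by blast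
  assume r: "real DIM('a \<times> 'a) * (2 * 2 ^ k) < norm z"
  show "dyad k l z = 0"
  proof (rule ccontr)
    assume "dyad k l z \<noteq> 0"
    then have "z \<in> cube k" using dyad_nonzero(1)[OF _ l] by (auto simp: cube_def)
    then show False using norm_le_cube[of z k] r by simp
  qed
qed (rule A_deriv A_cont DERIV_dyad borel_measurable_dyad; assumption)+

text \<open>R^\<rho> with R = 2 ^ k: a derivative of the symbol gains its reciprocal, so \<delta> =
  \<open>scale k\<close> keeps every term of \<open>leib\<close> at the same size.\<close>

definition scale :: "nat \<Rightarrow> real" where "scale k = (2 ^ k) powr \<rho>"

lemma scale_pos: "0 < scale k"
  by (simp add: scale_def)

lemma leib_joint_measurable:
  "set bs \<subseteq> Basis \<Longrightarrow> set l1 \<subseteq> Basis \<Longrightarrow>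
    (\<lambda>p. leib \<delta> (A (fst p)) (dyad k) bs l1 l2 (snd p)) \<in> borel_measurable (borel \<Otimes>\<^sub>M borel)"
proof (induction bs arbitrary: l1 l2)
  case Nil
  then have [measurable]: "(\<lambda>p. A (fst p) l1 (snd p)) \<in> borel_measurable (borel \<Otimes>\<^sub>M borel)"
    by (intro A_joint_measurable)
  show ?case by simp
next
  case (Cons b bs)
  have [measurable]: "(\<lambda>p. leib \<delta> (A (fst p)) (dyad k) bs l1 l2 (snd p)) \<in> borel_measurable (borel \<Otimes>\<^sub>M borel)"
     "(\<lambda>p. leib \<delta> (A (fst p)) (dyad k) bs (l1 @ [b]) l2 (snd p)) \<in> borel_measurable (borel \<Otimes>\<^sub>M borel)"
     "(\<lambda>p. leib \<delta> (A (fst p)) (dyad k) bs l1 (l2 @ [b]) (snd p)) \<in> borel_measurable (borel \<Otimes>\<^sub>M borel)"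
    using Cons by auto
  show ?case by simp
qed

lemma leib_measurable_fst:
  assumes "set bs \<subseteq> Basis" "set l1 \<subseteq> Basis"
  shows "(\<lambda>x. leib \<delta> (A x) (dyad k) bs l1 l2 z) \<in> borel_measurable borel"
  using measurable_compose[OF measurable_Pair2' leib_joint_measurable[OF assms, of \<delta> k l2], of z] by simp

lemma leib_outside_cube:
  "set bs \<subseteq> Basis \<Longrightarrow> set l2 \<subseteq> Basis \<Longrightarrow> z \<notin> cube k \<Longrightarrow> leib \<delta> (A x) (dyad k) bs l1 l2 z = 0"
proof (induction bs arbitrary: l1 l2)
  case Nil
  then have "dyad k l2 z = 0" using dyad_nonzero(1)[of k l2 z] by (auto simp: cube_def)
  then show ?case by simp
qed auto

text \<open>On the support of the cutoff 1 + |\<xi>| + |\<eta>| is comparable to R, so the symbol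
  estimate becomes a power of R, uniformly in k.\<close>

lemma Lq_symbol_piece:
  assumes l: "set l1 \<subseteq> Basis" "set l2 \<subseteq> Basis"
  shows "\<exists>C\<ge>0. \<forall>k z. nLq \<theta> (\<lambda>x. A x l1 z * of_real (dyad k l2 z)) \<le>
     ennreal (C * (2 ^ k) powr m / scale k ^ (length l1 + length l2))"
proof -
  obtain C0 where C0: "\<And>z. nLq \<theta> (\<lambda>x. A x l1 z) \<le>
       ennreal (C0 * (1 + norm (fst z) + norm (snd z)) powr (m - \<rho> * real (length l1)))"
    using A_norm[OF l(1)] by blast
  define e where "e = m - \<rho> * real (length l1)"
  define K where "K = 1 + 4 * real DIM('a)"
  define D where "D = (801::real) ^ DIM('a \<times> 'a) * (1 + 2 ^ length l2)"
  define C where "C = D * (\<bar>C0\<bar> * (2 * K) powr \<bar>e\<bar>)"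
  have K: "1 \<le> K" by (simp add: K_def)
  have D: "0 \<le> D" by (simp add: D_def)
  have [measurable]: "(\<lambda>x. A x l1 z) \<in> borel_measurable borel" for z by (rule A_meas[OF l(1)])
  have "nLq \<theta> (\<lambda>x. A x l1 z * of_real (dyad k l2 z)) \<le>
     ennreal (C * (2 ^ k) powr m / scale k ^ (length l1 + length l2))" for k z
  proof (cases "dyad k l2 z = 0")
    case True
    then show ?thesis using \<theta> by simp
  next
    case False
    define s :: real where "s = 2 ^ k"
    define t where "t = 1 + norm (fst z) + norm (snd z)"
    have s: "1 \<le> s" by (simp add: s_def)
    have zc: "z \<in> cube k" using dyad_nonzero(1)[OF False l(2)] by (auto simp: cube_def)
    have t1: "t \<le> K * s"
    proof -
      have "norm (fst z) \<le> real DIM('a) * (2 * s)" "norm (snd z) \<le> real DIM('a) * (2 * s)"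
        using zc norm_le_cube[of "fst z" k] norm_le_cube[of "snd z" k] by (simp_all add: cube_prod s_def)
      then have "t \<le> 1 + 4 * real DIM('a) * s" by (simp add: t_def)
      also have "\<dots> \<le> s + 4 * real DIM('a) * s" using s by simp
      finally show ?thesis by (simp add: K_def algebra_simps)
    qed
    have t2: "s / 2 \<le> t"
      using dyad_nonzero(2)[OF False l(2)]
    proof
      assume "\<exists>c\<in>Basis. 2 ^ k \<le> 2 * \<bar>z \<bullet> c\<bar>"
      then obtain c where c: "c \<in> Basis" "s \<le> 2 * \<bar>z \<bullet> c\<bar>" by (auto simp: s_def)
      have "\<bar>z \<bullet> c\<bar> \<le> norm (fst z) + norm (snd z)"
        using Basis_le_norm[OF c(1), of z] norm_Pair_le[of "fst z" "snd z"] by simp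
      then show ?thesis using c(2) by (simp add: t_def)
    next
      assume "k = 0"
      then show ?thesis using norm_ge_zero[of "fst z"] norm_ge_zero[of "snd z"] by (simp add: s_def t_def)
    qed
    have te: "t powr e \<le> (2 * K) powr \<bar>e\<bar> * s powr e"
      using s t1 t2 K by (intro powr_comparable) auto
    have sk: "scale k ^ j = s powr (\<rho> * real j)" for j
      using s by (simp add: scale_def s_def powr_powr mult.assoc flip: powr_realpow)
    have dl: "\<bar>dyad k l2 z\<bar> \<le> D * (s powr (- real (length l2)))"
      using abs_dyad_le[OF l(2), of k z] s
      by (simp add: D_def s_def[symmetric] powr_minus powr_realpow power_one_over inverse_eq_divide)
    have "nLq \<theta> (\<lambda>x. A x l1 z * of_real (dyad k l2 z)) =
        Lq \<theta> lborel (\<lambda>x. ennreal \<bar>dyad k l2 z\<bar> * ennorm (A x l1 z))"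
      by (simp add: norm_mult ennreal_mult mult.commute)
    also have "\<dots> \<le> ennreal \<bar>dyad k l2 z\<bar> * nLq \<theta> (\<lambda>x. A x l1 z)"
      using \<theta> by (intro Lq_cmult_le) auto
    also have "\<dots> \<le> ennreal (D * (s powr (- real (length l2)))) * ennreal (\<bar>C0\<bar> * ((2 * K) powr \<bar>e\<bar> * s powr e))"
    proof (intro mult_mono ennreal_leI dl)
      have "C0 * t powr e \<le> \<bar>C0\<bar> * ((2 * K) powr \<bar>e\<bar> * s powr e)"
        using te by (intro mult_mono) auto
      then show "nLq \<theta> (\<lambda>x. A x l1 z) \<le> ennreal (\<bar>C0\<bar> * ((2 * K) powr \<bar>e\<bar> * s powr e))"
        using C0[of z] by (simp add: t_def e_def) (meson ennreal_leI order_trans)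
    qed auto
    also have "\<dots> = ennreal (C * (s powr (- real (length l2)) * s powr e))"
      using D by (simp add: C_def ennreal_mult[symmetric] mult_ac)
    also have "\<dots> \<le> ennreal (C * (s powr m / s powr (\<rho> * real (length l1 + length l2))))"
    proof (intro ennreal_leI mult_left_mono)
      have "s powr (- real (length l2)) * s powr e = s powr (e - real (length l2))"
        by (simp add: powr_add[symmetric])
      \<comment> \<open>A derivative on the cutoff gains R^(-1), which is at least as good as
        R^(-\<rho>) because \<rho> <= 1 and R >= 1.\<close>
      also have "\<dots> \<le> s powr (m - \<rho> * real (length l1 + length l2))"
        using s \<rho> mult_right_mono[of \<rho> 1 "real (length l2)"]
        by (intro powr_mono) (auto simp: e_def algebra_simps)
      also have "\<dots> = s powr m / s powr (\<rho> * real (length l1 + length l2))"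
        by (rule powr_diff)
      finally show "s powr (- real (length l2)) * s powr e \<le> s powr m / s powr (\<rho> * real (length l1 + length l2))" .
    qed (use D in \<open>simp add: C_def\<close>)
    finally show ?thesis by (simp only: sk s_def times_divide_eq_right)
  qed
  moreover have "0 \<le> C" using D by (simp add: C_def)
  ultimately show ?thesis by blast
qed

text \<open>Each new direction brings one factor \<open>scale k\<close> and one more derivative,
  which cancel; the power of R does not change along the induction.\<close>

lemma Lq_leib:
  "set bs \<subseteq> Basis \<Longrightarrow> set l1 \<subseteq> Basis \<Longrightarrow> set l2 \<subseteq> Basis \<Longrightarrow>
   \<exists>C\<ge>0. \<forall>k z. nLq \<theta> (\<lambda>x. leib (scale k) (A x) (dyad k) bs l1 l2 z) \<le>
     ennreal (C * (2 ^ k) powr m / scale k ^ (length l1 + length l2))"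
proof (induction bs arbitrary: l1 l2)
  case Nil
  then show ?case using Lq_symbol_piece by simp
next
  case (Cons b bs)
  have bs: "set bs \<subseteq> Basis" "set (l1 @ [b]) \<subseteq> Basis" "set (l2 @ [b]) \<subseteq> Basis" using Cons.prems by auto
  let ?L = "\<lambda>k. leib (scale k)"
  obtain C1 where C1: "0 \<le> C1" "\<And>k z. nLq \<theta> (\<lambda>x. ?L k (A x) (dyad k) bs l1 l2 z) \<le>
     ennreal (C1 * (2 ^ k) powr m / scale k ^ (length l1 + length l2))"
    using Cons.IH[OF bs(1), of l1 l2] Cons.prems by blast
  obtain C2 where C2: "0 \<le> C2" "\<And>k z. nLq \<theta> (\<lambda>x. ?L k (A x) (dyad k) bs (l1 @ [b]) l2 z) \<le>
     ennreal (C2 * (2 ^ k) powr m / scale k ^ (length (l1 @ [b]) + length l2))"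
    using Cons.IH[OF bs(1,2), of l2] Cons.prems by blast
  obtain C3 where C3: "0 \<le> C3" "\<And>k z. nLq \<theta> (\<lambda>x. ?L k (A x) (dyad k) bs l1 (l2 @ [b]) z) \<le>
     ennreal (C3 * (2 ^ k) powr m / scale k ^ (length l1 + length (l2 @ [b])))"
    using Cons.IH[OF bs(1) _ bs(3), of l1] Cons.prems by blast
  have "nLq \<theta> (\<lambda>x. ?L k (A x) (dyad k) (b # bs) l1 l2 z) \<le>
     ennreal (3 * (C1 + C2 + C3) * (2 ^ k) powr m / scale k ^ (length l1 + length l2))" for k z
  proof -
    let ?n1 = "\<lambda>x. ennorm (?L k (A x) (dyad k) bs l1 l2 z)"
    let ?n2 = "\<lambda>x. ennorm (?L k (A x) (dyad k) bs (l1 @ [b]) l2 z)"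
    let ?n3 = "\<lambda>x. ennorm (?L k (A x) (dyad k) bs l1 (l2 @ [b]) z)"
    let ?S = "ennreal ((C1 + C2 + C3) * (2 ^ k) powr m / scale k ^ (length l1 + length l2))"
    have [measurable]: "(\<lambda>x. ?L k (A x) (dyad k) bs l1 l2 z) \<in> borel_measurable borel"
      "(\<lambda>x. ?L k (A x) (dyad k) bs (l1 @ [b]) l2 z) \<in> borel_measurable borel"
      "(\<lambda>x. ?L k (A x) (dyad k) bs l1 (l2 @ [b]) z) \<in> borel_measurable borel"
      "(\<lambda>x. ?L k (A x) (dyad k) (b # bs) l1 l2 z) \<in> borel_measurable borel"
      using Cons.prems bs by (auto intro!: leib_measurable_fst simp del: leib.simps)
    have "nLq \<theta> (\<lambda>x. ?L k (A x) (dyad k) (b # bs) l1 l2 z) \<le>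
        Lq \<theta> lborel (\<lambda>x. ?n1 x + ennreal (scale k) * ?n2 x + ennreal (scale k) * ?n3 x)"
    proof (rule Lq_mono[OF \<theta>(1)])
      fix x
      have "norm (?L k (A x) (dyad k) (b # bs) l1 l2 z) \<le> norm (?L k (A x) (dyad k) bs l1 l2 z)
         + norm (of_real (scale k) * ?L k (A x) (dyad k) bs (l1 @ [b]) l2 z)
         + norm (of_real (scale k) * ?L k (A x) (dyad k) bs l1 (l2 @ [b]) z)"
        unfolding leib.simps by (intro order_trans[OF norm_triangle_ineq4] add_mono order_refl norm_triangle_ineq4)
      then show "ennorm (?L k (A x) (dyad k) (b # bs) l1 l2 z) \<le>
           ?n1 x + ennreal (scale k) * ?n2 x + ennreal (scale k) * ?n3 x"
        using scale_pos[of k] unfolding norm_mult norm_of_real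
        by (simp add: ennreal_mult[symmetric] ennreal_plus[symmetric] ennreal_leI del: ennreal_plus leib.simps)
    qed measurable
    also have "\<dots> \<le> 3 * ?S"
    proof (rule Lq_add3_le[OF \<theta>])
      show "Lq \<theta> lborel ?n1 \<le> ?S"
        using C1 C2(1) C3(1) scale_pos[of k]
        by (intro order_trans[OF C1(2)] ennreal_leI divide_right_mono mult_right_mono) auto
      have S: "Lq \<theta> lborel (\<lambda>x. ennreal (scale k) * n x) \<le> ?S"
        if "Lq \<theta> lborel n \<le> ennreal (D * (2 ^ k) powr m / scale k ^ Suc (length l1 + length l2))"
          and [measurable]: "n \<in> borel_measurable borel" and D: "0 \<le> D" "D \<le> C1 + C2 + C3" for D n
      proof -
        have "Lq \<theta> lborel (\<lambda>x. ennreal (scale k) * n x) \<le> ennreal (scale k) * Lq \<theta> lborel n"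
          using \<theta> by (intro Lq_cmult_le) auto
        also have "\<dots> \<le> ennreal (scale k) * ennreal (D * (2 ^ k) powr m / scale k ^ Suc (length l1 + length l2))"
          by (intro mult_left_mono that) simp
        also have "\<dots> = ennreal (D * (2 ^ k) powr m / scale k ^ (length l1 + length l2))"
          using D scale_pos[of k] by (simp add: ennreal_mult[symmetric])
        also have "\<dots> \<le> ?S"
          using D scale_pos[of k] by (intro ennreal_leI divide_right_mono mult_right_mono) auto
        finally show ?thesis .
      qed
      show "Lq \<theta> lborel (\<lambda>x. ennreal (scale k) * ?n2 x) \<le> ?S"
        using C2(2)[of k z] C1(1) C2(1) C3(1) by (intro S[of _ C2]) auto
      show "Lq \<theta> lborel (\<lambda>x. ennreal (scale k) * ?n3 x) \<le> ?S"
        using C3(2)[of k z] C1(1) C2(1) C3(1) by (intro S[of _ C3]) auto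
    qed measurable
    also have "3 * ?S = ennreal (3 * (C1 + C2 + C3) * (2 ^ k) powr m / scale k ^ (length l1 + length l2))"
      using C1(1) C2(1) C3(1) scale_pos[of k]
      by (simp add: numeral_mult_ennreal mult.assoc)
    finally show ?thesis .
  qed
  moreover have "0 \<le> 3 * (C1 + C2 + C3)" using C1 C2 C3 by simp
  ultimately show ?case by blast
qed

end

text \<open>Two operators per direction, the least number that makes the resulting kernel weight
  integrable. The enumeration of the basis is arbitrary.\<close>

definition twice_Basis :: "'c::euclidean_space list" where
  "twice_Basis = (let L = SOME L. set L = Basis \<and> distinct L in L @ L)"

lemma twice_Basis_eq: "\<exists>L. set L = (Basis :: 'c::euclidean_space set) \<and> distinct L \<and> twice_Basis = L @ L"
proof -
  have "\<exists>L. set L = (Basis :: 'c set) \<and> distinct L"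
    by (rule finite_distinct_list) simp
  from someI_ex[OF this] show ?thesis by (auto simp: twice_Basis_def Let_def)
qed

lemma set_twice_Basis: "set twice_Basis = (Basis :: 'c::euclidean_space set)"
proof -
  obtain L where L: "set L = (Basis :: 'c set)" "twice_Basis = L @ L"
    using twice_Basis_eq[where ?'c = 'c] by metis
  show ?thesis unfolding L(2) set_append L(1) by (rule Un_absorb)
qed

lemma count_list_twice_Basis: "count_list twice_Basis c \<le> 2"
proof -
  obtain L where L: "set L = (Basis :: 'a set)" "distinct L" "twice_Basis = L @ L"
    using twice_Basis_eq by metis
  have "count_list xs c \<le> 1" if "distinct xs" for xs :: "'a list"
    using that by (induction xs) auto
  from this[OF L(2)] show ?thesis by (simp add: L(3))
qed

lemma prod_list_twice_Basis:
  fixes f :: "'c::euclidean_space \<Rightarrow> complex"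
  shows "(\<Prod>b\<leftarrow>twice_Basis. f b) = (\<Prod>b\<in>Basis. f b)\<^sup>2"
proof -
  obtain L where L: "set L = (Basis :: 'c set)" "distinct L" "twice_Basis = L @ L"
    using twice_Basis_eq by metis
  show ?thesis
    by (simp add: L(3) power2_eq_square prod.distinct_set_conv_list[OF L(2), of f, unfolded L(1)])
qed

text \<open>The inverse of the multiplier created by \<open>twice_Basis\<close>. It is kept complex
  because the kernel identity is exact; the modulus is taken only at the end. On pairs it
  factorises, which lets one factor go to f and one to g.\<close>

definition cwt :: "real \<Rightarrow> 'c::euclidean_space \<Rightarrow> complex" where
  "cwt \<delta> v = inverse ((\<Prod>b\<in>Basis. 1 + \<i> * of_real (\<delta> * (v \<bullet> b)))\<^sup>2)"

lemma norm_cwt: "norm (cwt \<delta> v) = wt \<delta> v"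
proof -
  have "(norm (1 + \<i> * of_real s))\<^sup>2 = 1 + s\<^sup>2" for s :: real
    by (simp add: cmod_power2)
  then show ?thesis
    by (simp add: cwt_def wt_def norm_inverse norm_power prod_norm[symmetric] prod_power_distrib
      prod_inversef[symmetric] o_def del: of_real_mult)
qed

lemma cwt_nonzero: "cwt \<delta> v \<noteq> 0"
  using norm_cwt[of \<delta> v] wt_pos[of \<delta> v] by force

lemma cwt_Pair: "cwt \<delta> (v1, v2) = cwt \<delta> v1 * cwt \<delta> v2"
proof -
  have "(\<Prod>b\<in>Basis. 1 + \<i> * of_real (\<delta> * ((v1, v2) \<bullet> b))) =
     (\<Prod>b\<in>Basis. 1 + \<i> * of_real (\<delta> * (v1 \<bullet> b))) * (\<Prod>b\<in>Basis. 1 + \<i> * of_real (\<delta> * (v2 \<bullet> b)))"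
    unfolding Basis_prod_def
    by (subst prod.union_disjoint) (auto simp: prod.reindex inj_on_def)
  then show ?thesis by (simp add: cwt_def power_mult_distrib)
qed

lemma borel_measurable_cwt [measurable]: "cwt \<delta> \<in> borel_measurable borel"
  unfolding cwt_def by measurable

lemma integrable_mult_cwt:
  assumes f: "integrable lborel f"
  shows "integrable lborel (\<lambda>y. f y * cwt \<delta> (x - y))"
proof (rule Bochner_Integration.integrable_bound[OF f])
  note [measurable] = integrable_lborel_measurable[OF f]
  show "(\<lambda>y. f y * cwt \<delta> (x - y)) \<in> borel_measurable lborel" by measurable
  show "AE y in lborel. norm (f y * cwt \<delta> (x - y)) \<le> norm (f y)"
    by (intro AE_I2) (simp add: norm_mult norm_cwt wt_le_1 less_imp_le[OF wt_pos] mult_left_le)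
qed

lemma fourier_tensor:
  fixes f g :: "'a::euclidean_space \<Rightarrow> complex"
  assumes f: "integrable lborel f" and g: "integrable lborel g"
  shows "fourier (\<lambda>v::'a\<times>'a. f (fst v) * g (snd v)) z = fourier f (fst z) * fourier g (snd z)"
proof -
  note [measurable] = integrable_lborel_measurable[OF f] integrable_lborel_measurable[OF g]
  have i: "integrable (lborel \<Otimes>\<^sub>M lborel) (\<lambda>(y, y'). (f y * cis (- (y \<bullet> fst z))) * (g y' * cis (- (y' \<bullet> snd z))))"
    using integrable_pair_mult[OF integrable_cis_mult[OF f, of "\<lambda>y. - (y \<bullet> fst z)"] integrable_cis_mult[OF g, of "\<lambda>y. - (y \<bullet> snd z)"]]
    by (simp add: split_beta')
  have "fourier (\<lambda>v::'a\<times>'a. f (fst v) * g (snd v)) z =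
     (\<integral>(y, y'). (f y * cis (- (y \<bullet> fst z))) * (g y' * cis (- (y' \<bullet> snd z))) \<partial>(lborel \<Otimes>\<^sub>M lborel))"
    unfolding fourier_def lborel_prod[symmetric]
  proof (intro Bochner_Integration.integral_cong refl)
    fix v :: "'a \<times> 'a"
    have "cis (- (v \<bullet> z)) = cis (- (fst v \<bullet> fst z)) * cis (- (snd v \<bullet> snd z))"
      by (simp add: inner_prod_def cis_mult)
    then show "f (fst v) * g (snd v) * cis (- (v \<bullet> z)) =
       (case v of (y, y') \<Rightarrow> (f y * cis (- (y \<bullet> fst z))) * (g y' * cis (- (y' \<bullet> snd z))))"
      by (simp add: split_beta' mult_ac)
  qed
  also have "\<dots> = (\<integral>y. \<integral>y'. (f y * cis (- (y \<bullet> fst z))) * (g y' * cis (- (y' \<bullet> snd z))) \<partial>lborel \<partial>lborel)"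
    using lborel_pair.integral_fst'[OF i] by simp
  also have "\<dots> = fourier f (fst z) * fourier g (snd z)"
    by (simp add: fourier_def)
  finally show ?thesis .
qed

section \<open>The integrated symbol, its majorant and the pointwise bound for one piece\<close>

context Lp_symbol
begin

definition Q :: "nat \<Rightarrow> 'a \<Rightarrow> 'a \<times> 'a \<Rightarrow> complex" where
  "Q k x z = leib (scale k) (A x) (dyad k) twice_Basis [] [] z"

lemma Q_joint_measurable [measurable]: "(\<lambda>p. Q k (fst p) (snd p)) \<in> borel_measurable (borel \<Otimes>\<^sub>M borel)"
  unfolding Q_def by (intro leib_joint_measurable) (auto simp: set_twice_Basis)

lemma Q_joint_measurable' [measurable]: "(\<lambda>p. Q k (snd p) (fst p)) \<in> borel_measurable (borel \<Otimes>\<^sub>M borel)"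
  using measurable_pair_swap[OF Q_joint_measurable[of k]] by (simp add: split_beta')

lemma Q_measurable [measurable]: "Q k x \<in> borel_measurable borel" "(\<lambda>x. Q k x z) \<in> borel_measurable borel"
  using measurable_compose[OF measurable_Pair1'[of x borel borel] Q_joint_measurable[of k]]
    measurable_compose[OF measurable_Pair2'[of z borel borel] Q_joint_measurable[of k]] by simp_all

lemma Q_outside_cube: "z \<notin> cube k \<Longrightarrow> Q k x z = 0"
  unfolding Q_def by (intro leib_outside_cube) (auto simp: set_twice_Basis)

lemma integrable_Q: "integrable lborel (Q k x)"
proof -
  obtain B where "\<And>z. norm (Q k x z) \<le> B"
    using sc.leib_bound[of twice_Basis "[]" "[]" "scale k" x k] by (auto simp: Q_def set_twice_Basis)
  then show ?thesis
    using sc.leib_supp[of twice_Basis "[]" k _ "scale k" x "[]"]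
    by (intro integrable_bounded_support[where r = "real DIM('a \<times> 'a) * (2 * 2 ^ k)"]) (auto simp: Q_def set_twice_Basis)
qed

lemma Lq_Q:
  "\<exists>C\<ge>0. \<forall>k z. nLq \<theta> (\<lambda>x. Q k x z) \<le> ennreal (C * (2 ^ k) powr m) * indicator (cube k) z"
proof -
  obtain C where C: "0 \<le> C" "\<And>k z. nLq \<theta> (\<lambda>x. Q k x z) \<le> ennreal (C * (2 ^ k) powr m)"
    using Lq_leib[of twice_Basis "[]" "[]"] unfolding Q_def by (auto simp: set_twice_Basis)
  have "nLq \<theta> (\<lambda>x. Q k x z) \<le> ennreal (C * (2 ^ k) powr m) * indicator (cube k) z" for k z
    using C(2) \<theta> by (cases "z \<in> cube k") (auto simp: Q_outside_cube)
  then show ?thesis using C(1) by blast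
qed

text \<open>The dual form of "the L^p norm of \<open>Q k x\<close> in frequency is at most b". In
  this form a constant can serve for p = \<infinity>, and the essential supremum in frequency never
  has to be measured as a function of x.\<close>

abbreviation dominated :: "nat \<Rightarrow> 'a \<Rightarrow> ennreal \<Rightarrow> bool" where
  "dominated k x b \<equiv> \<forall>\<Psi>. \<Psi> \<in> borel_measurable borel \<longrightarrow>
     (\<integral>\<^sup>+ z. ennorm (Q k x z) * \<Psi> z \<partial>lborel) \<le> b * Lq (1 - \<theta>) lborel \<Psi>"

text \<open>
  The L^p norm in (\<xi>,\<eta>) is taken with the same p as in x; hence Fubini's theorem suffices here and
  no mixed-norm Minkowski inequality is needed.
\<close>

lemma Q_majorant:
  "\<exists>C\<ge>0. \<forall>k. \<exists>B. B \<in> borel_measurable borel \<and>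
     Lq \<theta> lborel B \<le> ennreal (C * (2 ^ k) powr (m + 2 * real DIM('a) * \<theta>)) \<and>
     (AE x in lborel. dominated k x (B x))"
proof -
  obtain C where C: "0 \<le> C" "\<And>k z. nLq \<theta> (\<lambda>x. Q k x z) \<le>
      ennreal (C * (2 ^ k) powr m) * indicator (cube k) z"
    using Lq_Q by blast
  have Qm[measurable]: "(\<lambda>p. Q k (fst p) (snd p)) \<in> borel_measurable (lborel \<Otimes>\<^sub>M lborel)" for k
    using Q_joint_measurable[of k] by (simp cong: measurable_cong_sets)
  show ?thesis
  proof (cases "\<theta> = 0")
    case True
    have "\<exists>B. B \<in> borel_measurable borel \<and> Lq \<theta> lborel B \<le> ennreal (C * (2 ^ k) powr (m + 2 * real DIM('a) * \<theta>)) \<and>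
     (AE x in lborel. dominated k x (B x))" for k
    proof (intro exI[of _ "\<lambda>_. ennreal (C * (2 ^ k) powr m)"] conjI)
      let ?K = "ennreal (C * (2 ^ k) powr m)"
      show "Lq \<theta> lborel (\<lambda>_::'a. ?K) \<le> ennreal (C * (2 ^ k) powr (m + 2 * real DIM('a) * \<theta>))"
        unfolding True Lq_0 by (intro esssup_I) auto
      \<comment> \<open>For p = \<infinity> the exceptional set of x depends on z; Fubini for null
        sets exchanges the two quantifiers.\<close>
      have "AE z in lborel. AE x in lborel. ennorm (Q k x z) \<le> ?K"
      proof (rule AE_I2)
        fix z :: "'a \<times> 'a"
        have "esssup lborel (\<lambda>x. ennorm (Q k x z)) \<le> ?K"
          using C(2)[of k z] unfolding True Lq_0
          by (rule order_trans) (auto split: split_indicator)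
        then show "AE x in lborel. ennorm (Q k x z) \<le> ?K"
          using esssup_AE[of "\<lambda>x. ennorm (Q k x z)" lborel] by (auto elim!: eventually_mono intro: order_trans)
      qed
      moreover have "(AE x in lborel. AE z in lborel. ennorm (Q k x z) \<le> ?K) \<longleftrightarrow>
          (AE z in lborel. AE x in lborel. ennorm (Q k x z) \<le> ?K)"
        by (rule lborel_pair.AE_commute) measurable
      ultimately have "AE x in lborel. AE z in lborel. ennorm (Q k x z) \<le> ?K"
        by (rule iffD2[rotated])
      then show "AE x in lborel. dominated k x ?K"
      proof (rule eventually_mono, intro allI impI)
        fix x and \<Psi> :: "'a \<times> 'a \<Rightarrow> ennreal"
        assume x: "AE z in lborel. ennorm (Q k x z) \<le> ?K" and [measurable]: "\<Psi> \<in> borel_measurable borel"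
        have "(\<integral>\<^sup>+ z. ennorm (Q k x z) * \<Psi> z \<partial>lborel) \<le> (\<integral>\<^sup>+ z. ?K * \<Psi> z \<partial>lborel)"
          by (rule nn_integral_mono_AE, rule eventually_mono[OF x]) (rule mult_right_mono, auto)
        then show "(\<integral>\<^sup>+ z. ennorm (Q k x z) * \<Psi> z \<partial>lborel) \<le> ?K * Lq (1 - \<theta>) lborel \<Psi>"
          by (simp add: True Lq_1 nn_integral_cmult)
      qed
    qed simp
    then show ?thesis using C(1) by blast
  next
    case False
    then have t: "0 < \<theta>" using \<theta> by simp
    let ?D = "real DIM('a)"
    \<comment> \<open>The cube in dimension 2n has side 4 * 2 ^ k; its volume to the power \<theta>
      gives 4^(2n\<theta>) and the factor R^(2n\<theta>).\<close>
    define C' where "C' = C * 4 powr (2 * ?D * \<theta>)"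
    have "\<exists>B. B \<in> borel_measurable borel \<and> Lq \<theta> lborel B \<le> ennreal (C' * (2 ^ k) powr (m + 2 * ?D * \<theta>)) \<and>
     (AE x in lborel. dominated k x (B x))" for k
    proof (intro exI[of _ "\<lambda>x. nLq \<theta> (\<lambda>z. Q k x z)"] conjI AE_I2 allI impI)
      show "(\<lambda>x. nLq \<theta> (\<lambda>z. Q k x z)) \<in> borel_measurable borel"
        using t by (simp add: Lq_pos)
      have "(\<integral>\<^sup>+ x. \<integral>\<^sup>+ z. epow (ennorm (Q k x z)) (1/\<theta>) \<partial>lborel \<partial>lborel) =
         (\<integral>\<^sup>+ z. \<integral>\<^sup>+ x. epow (ennorm (Q k x z)) (1/\<theta>) \<partial>lborel \<partial>lborel)"
        by (rule lborel_pair.Fubini') measurable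
      also have "\<dots> = (\<integral>\<^sup>+ z. epow (nLq \<theta> (\<lambda>x. Q k x z)) (1/\<theta>) \<partial>lborel)"
        by (simp add: epow_Lq[OF t])
      also have "\<dots> \<le> (\<integral>\<^sup>+ z. epow (ennreal (C * (2 ^ k) powr m) * indicator (cube k :: ('a\<times>'a) set) z) (1/\<theta>) \<partial>lborel)"
        using t by (intro nn_integral_mono epow_mono C(2)) auto
      also have "\<dots> = (\<integral>\<^sup>+ z. epow (ennreal (C * (2 ^ k) powr m)) (1/\<theta>) * indicator (cube k :: ('a\<times>'a) set) z \<partial>lborel)"
        by (intro nn_integral_cong) (simp split: split_indicator)
      also have "\<dots> = epow (ennreal (C * (2 ^ k) powr m)) (1/\<theta>) * ennreal ((4 * 2 ^ k) ^ DIM('a \<times> 'a))"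
        by (subst nn_integral_cmult) (auto simp: emeasure_cube)
      finally have le: "(\<integral>\<^sup>+ x. \<integral>\<^sup>+ z. epow (ennorm (Q k x z)) (1/\<theta>) \<partial>lborel \<partial>lborel) \<le> \<dots>" .
      have "Lq \<theta> lborel (\<lambda>x. nLq \<theta> (\<lambda>z. Q k x z)) =
         epow (\<integral>\<^sup>+ x. \<integral>\<^sup>+ z. epow (ennorm (Q k x z)) (1/\<theta>) \<partial>lborel \<partial>lborel) \<theta>"
        using t by (subst Lq_pos) (auto simp: epow_Lq)
      also have "\<dots> \<le> epow (epow (ennreal (C * (2 ^ k) powr m)) (1/\<theta>) * ennreal ((4 * 2 ^ k) ^ DIM('a \<times> 'a))) \<theta>"
        using t by (intro epow_mono le) auto
      also have "\<dots> = ennreal (C * (2 ^ k) powr m) * ennreal (((4 * 2 ^ k) ^ DIM('a \<times> 'a)) powr \<theta>)"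
        using t by (simp only: epow_mult epow_epow) (simp add: epow_ennreal)
      also have "((4 * 2 ^ k) ^ DIM('a \<times> 'a)) powr \<theta> = (4 * 2 ^ k) powr (2 * ?D * \<theta>)"
      proof -
        have "(4 * 2 ^ k :: real) ^ DIM('a \<times> 'a) = (4 * 2 ^ k) powr real DIM('a \<times> 'a)"
          by (rule powr_realpow[symmetric]) simp
        moreover have "real DIM('a \<times> 'a) * \<theta> = 2 * ?D * \<theta>" by simp
        ultimately show ?thesis by (simp only: powr_powr)
      qed
      also have "\<dots> = 4 powr (2 * ?D * \<theta>) * (2 ^ k) powr (2 * ?D * \<theta>)"
        by (rule powr_mult)
      also have "ennreal (C * (2 ^ k) powr m) * ennreal (4 powr (2 * ?D * \<theta>) * (2 ^ k) powr (2 * ?D * \<theta>)) =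
         ennreal (C' * (2 ^ k) powr (m + 2 * ?D * \<theta>))"
        using C(1) by (simp add: C'_def ennreal_mult[symmetric] powr_add mult_ac)
      finally show "Lq \<theta> lborel (\<lambda>x. nLq \<theta> (\<lambda>z. Q k x z)) \<le>
          ennreal (C' * (2 ^ k) powr (m + 2 * ?D * \<theta>))" by simp
      fix x and \<Psi> :: "'a \<times> 'a \<Rightarrow> ennreal" assume [measurable]: "\<Psi> \<in> borel_measurable borel"
      show "(\<integral>\<^sup>+ z. ennorm (Q k x z) * \<Psi> z \<partial>lborel) \<le>
          nLq \<theta> (\<lambda>z. Q k x z) * Lq (1 - \<theta>) lborel \<Psi>"
        using Lq_Holder[of \<theta> "1 - \<theta>" "\<lambda>z. ennorm (Q k x z)" lborel \<Psi>] \<theta>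
        by (simp add: Lq_1)
    qed
    moreover have "0 \<le> C'" using C(1) by (simp add: C'_def)
    ultimately show ?thesis by blast
  qed
qed

definition piece :: "nat \<Rightarrow> ('a \<Rightarrow> complex) \<Rightarrow> ('a \<Rightarrow> complex) \<Rightarrow> 'a \<Rightarrow> complex" where
  "piece k f g x = (\<integral>z. A x [] z * of_real (dyad k [] z) * cis (x \<bullet> (fst z + snd z)) * fourier f (fst z) * fourier g (snd z) \<partial>lborel)"

text \<open>The transforms of f and g are opened, the oscillatory kernel is exchanged for that of
  \<open>Q\<close> times \<open>cwt\<close>, the factor \<open>cwt\<close> is absorbed into f and g,
  and the transforms are closed again. The indicators cost nothing as \<open>Q\<close> vanishes off
  the cube, and later they allow Hoelder on a bounded set.\<close>

lemma piece_le:
  fixes k :: nat and x :: 'a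
  assumes f: "integrable lborel f" and g: "integrable lborel g"
  defines "F \<equiv> \<lambda>y. f y * cwt (scale k) (x - y)" and "G \<equiv> \<lambda>y. g y * cwt (scale k) (x - y)"
  shows "ennorm (piece k f g x) \<le> (\<integral>\<^sup>+ z. ennorm (Q k x z) *
     ((indicator (cube k) (fst z) * ennorm (fourier F (fst z))) *
      (indicator (cube k) (snd z) * ennorm (fourier G (snd z)))) \<partial>lborel)"
proof -
  let ?R = "\<lambda>z. (indicator (cube k) (fst z) * ennorm (fourier F (fst z))) *
      (indicator (cube k) (snd z) * ennorm (fourier G (snd z)))"
  note [measurable] = integrable_lborel_measurable[OF f] integrable_lborel_measurable[OF g]
  let ?X = "(x, x) :: 'a \<times> 'a"
  let ?u = "\<lambda>z. A x [] z * of_real (dyad k [] z)"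
  define h where "h = (\<lambda>v::'a\<times>'a. f (fst v) * g (snd v))"
  define H where "H = (\<lambda>v::'a\<times>'a. h v * cwt (scale k) (?X - v))"
  have h: "integrable lborel h"
    unfolding h_def lborel_prod[symmetric] by (rule integrable_pair_mult[OF f g])
  have H: "integrable lborel H" unfolding H_def by (rule integrable_mult_cwt[OF h])
  have Heq: "H = (\<lambda>v. F (fst v) * G (snd v))"
  proof
    fix v :: "'a \<times> 'a"
    have "?X - v = (x - fst v, x - snd v)" by (cases v) simp
    then show "H v = F (fst v) * G (snd v)" by (simp add: H_def h_def F_def G_def cwt_Pair mult_ac)
  qed
  have FG: "integrable lborel F" "integrable lborel G"
    unfolding F_def G_def by (intro integrable_mult_cwt f g)+
  have u: "integrable lborel ?u"
  proof -
    have "?u = leib (scale k) (A x) (dyad k) [] [] []" by auto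
    moreover obtain B where "\<And>z. norm (leib (scale k) (A x) (dyad k) [] [] [] z) \<le> B"
      using sc.leib_bound[of "[]" "[]" "[]" "scale k" x k] by auto
    moreover have "leib (scale k) (A x) (dyad k) [] [] [] \<in> borel_measurable borel"
      by (rule sc.leib_meas) auto
    ultimately show ?thesis using sc.leib_supp[of "[]" "[]" k _ "scale k" x "[]"]
      by (intro integrable_bounded_support[where r = "real DIM('a \<times> 'a) * (2 * 2 ^ k)"]) auto
  qed
  \<comment> \<open>The phase is that of the diagonal point (x, x), so a bilinear operator on the
    space is treated as a linear one on its square.\<close>
  have inner: "x \<bullet> (fst z + snd z) = ?X \<bullet> z" for z :: "'a \<times> 'a"
    by (cases z) (simp add: inner_add_right)
  have kern: "(\<integral>z. ?u z * cis (v \<bullet> z) \<partial>lborel) = cwt (scale k) v * (\<integral>z. Q k x z * cis (v \<bullet> z) \<partial>lborel)" for v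
  proof -
    have "(\<integral>z. Q k x z * cis (v \<bullet> z) \<partial>lborel) =
      (\<Prod>b\<in>Basis. 1 + \<i> * of_real (scale k * (v \<bullet> b)))\<^sup>2 * (\<integral>z. ?u z * cis (v \<bullet> z) \<partial>lborel)"
      unfolding Q_def prod_list_twice_Basis[symmetric]
      by (rule sc.integral_leib) (auto simp: set_twice_Basis count_list_twice_Basis)
    moreover have "(\<Prod>b\<in>Basis. 1 + \<i> * of_real (scale k * (v \<bullet> b)))\<^sup>2 \<noteq> 0"
      using cwt_nonzero[of "scale k" v] unfolding cwt_def by (metis inverse_zero)
    ultimately show ?thesis unfolding cwt_def by (simp add: divide_simps)
  qed
  have "piece k f g x = (\<integral>z. (?u z * cis (?X \<bullet> z)) * fourier h z \<partial>lborel)"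
    unfolding piece_def h_def fourier_tensor[OF f g] by (simp add: inner mult_ac)
  also have "\<dots> = (\<integral>v. h v * (\<integral>z. (?u z * cis (?X \<bullet> z)) * cis (- (v \<bullet> z)) \<partial>lborel) \<partial>lborel)"
    unfolding fourier_def
    by (rule integral_swap_cis[OF integrable_cis_mult[OF u] h]) measurable
  also have "\<dots> = (\<integral>v. h v * (\<integral>z. ?u z * cis ((?X - v) \<bullet> z) \<partial>lborel) \<partial>lborel)"
    by (simp add: mult.assoc cis_mult inner_diff_left)
  \<comment> \<open>The weight is evaluated at (x, x) - v, and so depends on x: f and g are
    localised around the point of evaluation.\<close>
  also have "\<dots> = (\<integral>v. H v * (\<integral>z. Q k x z * cis ((?X - v) \<bullet> z) \<partial>lborel) \<partial>lborel)"
    unfolding kern by (simp add: H_def mult.assoc)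
  also have "\<dots> = (\<integral>v. H v * (\<integral>z. (Q k x z * cis (?X \<bullet> z)) * cis (- (v \<bullet> z)) \<partial>lborel) \<partial>lborel)"
    by (simp add: mult.assoc cis_mult inner_diff_left)
  also have "\<dots> = (\<integral>z. (Q k x z * cis (?X \<bullet> z)) * fourier H z \<partial>lborel)"
    unfolding fourier_def
    by (rule integral_swap_cis[OF integrable_cis_mult[OF integrable_Q] H, symmetric]) measurable
  finally have eq: "piece k f g x = \<dots>" .
  have "ennorm (piece k f g x) \<le> (\<integral>\<^sup>+ z. ennorm ((Q k x z * cis (?X \<bullet> z)) * fourier H z) \<partial>lborel)"
    unfolding eq by (rule ennreal_norm_integral_le)
  also have "\<dots> = (\<integral>\<^sup>+ z. ennorm (Q k x z) *
     ?R z \<partial>lborel)"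
  proof (intro nn_integral_cong)
    fix z :: "'a \<times> 'a"
    show "ennorm ((Q k x z * cis (?X \<bullet> z)) * fourier H z) = ennorm (Q k x z) *
     ?R z"
    proof (cases "z \<in> cube k")
      case True
      then show ?thesis unfolding Heq fourier_tensor[OF FG]
        by (simp add: norm_mult ennreal_mult cube_prod)
    qed (simp add: Q_outside_cube)
  qed
  finally show ?thesis .
qed

end

section \<open>Summation of the pieces\<close>

text \<open>Adding the nonnegative off-diagonal terms decouples the three factors, so that each
  series can be estimated in its own space.\<close>

lemma suminf_mult3_le:
  fixes a b c :: "nat \<Rightarrow> ennreal"
  shows "(\<Sum>k. a k * b k * c k) \<le> (\<Sum>k. a k) * (\<Sum>k. b k) * (\<Sum>k. c k)"
proof -
  have le: "u k \<le> (\<Sum>k. u k)" for u :: "nat \<Rightarrow> ennreal" and k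
    using sum_le_suminf[of u "{k}"] by simp
  have "(\<Sum>k. a k * b k * c k) \<le> (\<Sum>k. (\<Sum>k. a k) * (\<Sum>k. b k) * c k)"
    by (intro suminf_le mult_mono le) auto
  then show ?thesis by simp
qed

lemma Lq_indicator_cube:
  assumes "0 \<le> \<tau>"
  shows "Lq \<tau> lborel (indicator (cube k :: 'c::euclidean_space set)) \<le> ennreal ((4 * 2 ^ k) powr (real DIM('c) * \<tau>))"
proof (cases "\<tau> = 0")
  case True
  then show ?thesis unfolding True Lq_0
    by (intro esssup_I) (auto intro!: AE_I2 simp: indicator_def)
next
  case False
  have "(\<integral>\<^sup>+ z. epow (indicator (cube k :: 'c set) z) (1/\<tau>) \<partial>lborel) = (\<integral>\<^sup>+ z. indicator (cube k :: 'c set) z \<partial>lborel)"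
    by (intro nn_integral_cong) (simp split: split_indicator)
  also have "\<dots> = ennreal ((4 * 2 ^ k) ^ DIM('c))" by (simp add: emeasure_cube)
  finally have "Lq \<tau> lborel (indicator (cube k :: 'c set)) = epow (ennreal ((4 * 2 ^ k) ^ DIM('c))) \<tau>"
    by (simp only: Lq_pos[OF False])
  also have "\<dots> = ennreal (((4 * 2 ^ k) powr real DIM('c)) powr \<tau>)"
    by (subst powr_realpow) (auto simp: epow_ennreal)
  finally show ?thesis by (simp add: powr_powr)
qed

text \<open>Hoelder against the indicator lowers the exponent on the Fourier side, by (\<sigma> -
  \<theta>) + (1 - \<sigma>) = 1 - \<theta>; the price is the volume of the cube to the power
  \<sigma> - \<theta>.\<close>

lemma Hausdorff_Young_cube:
  assumes \<sigma>: "1/2 \<le> \<sigma>" "\<sigma> \<le> 1" and \<theta>: "0 \<le> \<theta>" "\<theta> \<le> \<sigma>"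
  shows "\<exists>C>0. \<forall>k (F::'a::euclidean_space \<Rightarrow> complex). integrable lborel F \<longrightarrow>
    Lq (1 - \<theta>) lborel (\<lambda>\<xi>. indicator (cube k) \<xi> * ennorm (fourier F \<xi>)) \<le>
      ennreal (C * (2 ^ k) powr (real DIM('a) * (\<sigma> - \<theta>))) * nLq \<sigma> F"
proof -
  obtain C where C: "0 < C" "\<And>F::'a \<Rightarrow> complex. integrable lborel F \<Longrightarrow>
    nLq (1 - \<sigma>) (fourier F) \<le> ennreal C * nLq \<sigma> F"
    using Hausdorff_Young[OF \<sigma>, where ?'a = 'a] by blast
  let ?e = "real DIM('a) * (\<sigma> - \<theta>)"
  have "Lq (1 - \<theta>) lborel (\<lambda>\<xi>. indicator (cube k) \<xi> * ennorm (fourier F \<xi>)) \<le>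
      ennreal (4 powr ?e * C * (2 ^ k) powr ?e) * nLq \<sigma> F"
    if F: "integrable lborel F" for k and F :: "'a \<Rightarrow> complex"
  proof -
    note [measurable] = integrable_lborel_measurable[OF F]
    have "Lq ((\<sigma> - \<theta>) + (1 - \<sigma>)) lborel (\<lambda>\<xi>. indicator (cube k) \<xi> * ennorm (fourier F \<xi>)) \<le>
       Lq (\<sigma> - \<theta>) lborel (indicator (cube k :: 'a set)) * nLq (1 - \<sigma>) (fourier F)"
      using assms by (intro Lq_Holder) auto
    also have "\<dots> \<le> ennreal ((4 * 2 ^ k) powr ?e) * (ennreal C * nLq \<sigma> F)"
      using \<theta> by (intro mult_mono Lq_indicator_cube C(2) F) auto
    also have "\<dots> = ennreal (4 powr ?e * C * (2 ^ k) powr ?e) * nLq \<sigma> F"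
      using C(1) by (simp add: mult.assoc[symmetric] ennreal_mult[symmetric] powr_mult) (simp add: mult_ac)
    finally show ?thesis by simp
  qed
  moreover have "0 < 4 powr ?e * C" using C(1) by simp
  ultimately show ?thesis by blast
qed

context Lp_symbol
begin

definition pdo :: "('a \<Rightarrow> complex) \<Rightarrow> ('a \<Rightarrow> complex) \<Rightarrow> 'a \<Rightarrow> complex" where
  "pdo f g x = (\<integral>z. A x [] z * cis (x \<bullet> (fst z + snd z)) * fourier f (fst z) * fourier g (snd z) \<partial>lborel)"

lemma pdo_measurable:
  assumes [measurable]: "f \<in> borel_measurable borel" "g \<in> borel_measurable borel"
  shows "pdo f g \<in> borel_measurable borel"
proof -
  have "(\<lambda>p. A (fst p) [] (snd p)) \<in> borel_measurable (borel \<Otimes>\<^sub>M borel)"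
    by (rule A_joint_measurable) simp
  then have [measurable]: "(\<lambda>p. A (fst p) [] (snd p)) \<in> borel_measurable (borel \<Otimes>\<^sub>M (borel \<Otimes>\<^sub>M borel))"
    by (simp add: borel_prod)
  have "(\<lambda>(x, z). A x [] z * cis (x \<bullet> (fst z + snd z)) * fourier f (fst z) * fourier g (snd z))
      \<in> borel_measurable (borel \<Otimes>\<^sub>M (borel \<Otimes>\<^sub>M borel))"
    unfolding split_beta' by measurable
  moreover have "sets (borel \<Otimes>\<^sub>M lborel :: ('a \<times> 'a \<times> 'a) measure) = sets (borel \<Otimes>\<^sub>M (borel \<Otimes>\<^sub>M borel) :: ('a \<times> 'a \<times> 'a) measure)"
    by (rule sets_pair_measure_cong[OF refl]) (simp only: sets_lborel borel_prod)
  ultimately have "(\<lambda>(x, z). A x [] z * cis (x \<bullet> (fst z + snd z)) * fourier f (fst z) * fourier g (snd z))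
      \<in> borel_measurable (borel \<Otimes>\<^sub>M lborel)"
    using measurable_cong_sets[OF _ refl] by blast
  then show ?thesis unfolding pdo_def by (rule lborel.borel_measurable_lebesgue_integral)
qed

text \<open>Partial sums of pieces carry the cutoff at scale 2 ^ n, which is uniformly bounded and
  tends to 1; dominated convergence applies.\<close>

lemma pdo_le_suminf_piece: "ennorm (pdo f g x) \<le> (\<Sum>k. ennorm (piece k f g x))"
proof -
  define w where "w z = A x [] z * cis (x \<bullet> (fst z + snd z)) * fourier f (fst z) * fourier g (snd z)" for z
  show ?thesis
  proof (cases "integrable lborel w")
    \<comment> \<open>A nonintegrable integrand makes the operator value 0 by convention.\<close>
    case False
    then have "pdo f g x = 0" unfolding pdo_def w_def by (rule not_integrable_integral_eq)
    then show ?thesis by simp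
  next
    case w: True
    note [measurable] = integrable_lborel_measurable[OF w]
    have id: "integrable lborel (\<lambda>z. of_real (dyad k [] z) * w z)" for k
    proof (rule Bochner_Integration.integrable_bound)
      show "integrable lborel (\<lambda>z. of_real (801 ^ DIM('a\<times>'a) * 2) * w z)" using w by simp
      show "AE z in lborel. norm (of_real (dyad k [] z) * w z) \<le> norm (of_real (801 ^ DIM('a\<times>'a) * 2) * w z)"
        using abs_dyad_le[where ?'c = "'a \<times> 'a" and l = "[]" and k = k]
        by (intro AE_I2) (auto simp: norm_mult norm_power intro!: mult_right_mono)
    qed measurable
    have p: "piece k f g x = (\<integral>z. of_real (dyad k [] z) * w z \<partial>lborel)" for k
      unfolding piece_def w_def by (simp add: mult_ac)
    have s: "(\<Sum>k\<le>n. piece k f g x) = (\<integral>z. of_real (cutoff (2 ^ n) [] z) * w z \<partial>lborel)" for n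
      unfolding p sum_dyad[symmetric] of_real_sum sum_distrib_right
      by (rule Bochner_Integration.integral_sum[symmetric]) (rule id)
    have "(\<lambda>n. \<integral>z. of_real (cutoff (2 ^ n) [] z) * w z \<partial>lborel) \<longlonglongrightarrow> (\<integral>z. w z \<partial>lborel)"
    proof (rule integral_dominated_convergence)
      show "integrable lborel (\<lambda>z. 801 ^ DIM('a\<times>'a) * norm (w z))" using w by simp
      show "AE z in lborel. (\<lambda>n. of_real (cutoff (2 ^ n) [] z) * w z) \<longlonglongrightarrow> w z"
      proof (rule AE_I2)
        fix z
        have "(\<lambda>n. of_real (cutoff (2 ^ n) [] z) * w z) \<longlonglongrightarrow> of_real 1 * w z"
          by (intro tendsto_mult tendsto_of_real cutoff_tendsto_1 tendsto_const)
        then show "(\<lambda>n. of_real (cutoff (2 ^ n) [] z) * w z) \<longlonglongrightarrow> w z" by simp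
      qed
      show "AE z in lborel. norm (of_real (cutoff (2 ^ n) [] z) * w z) \<le> 801 ^ DIM('a\<times>'a) * norm (w z)" for n
        using abs_cutoff_le[where ?'c = "'a \<times> 'a" and R = "2 ^ n" and l = "[]"]
        by (intro AE_I2) (auto simp: norm_mult intro!: mult_right_mono)
    qed measurable
    then have "(\<lambda>n. \<Sum>k\<le>n. piece k f g x) \<longlonglongrightarrow> pdo f g x" by (simp add: s pdo_def w_def)
    then have lim: "(\<lambda>n. ennorm (\<Sum>k\<le>n. piece k f g x)) \<longlonglongrightarrow> ennorm (pdo f g x)"
      by (intro tendsto_ennrealI tendsto_norm)
    have "ennorm (\<Sum>k\<le>n. piece k f g x) \<le> (\<Sum>k. ennorm (piece k f g x))" for n
    proof -
      have "ennorm (\<Sum>k\<le>n. piece k f g x) \<le> ennreal (\<Sum>k\<le>n. norm (piece k f g x))"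
        by (intro ennreal_leI norm_sum)
      also have "\<dots> = (\<Sum>k\<le>n. ennorm (piece k f g x))" by (simp add: sum_ennreal)
      also have "\<dots> \<le> (\<Sum>k. ennorm (piece k f g x))" by (intro sum_le_suminf) auto
      finally show ?thesis .
    qed
    then show ?thesis by (intro LIMSEQ_le_const2[OF lim]) auto
  qed
qed

definition avg :: "real \<Rightarrow> nat \<Rightarrow> ('a \<Rightarrow> complex) \<Rightarrow> 'a \<Rightarrow> ennreal" where
  "avg \<sigma> k f x = Lq \<sigma> lborel (\<lambda>y. ennreal (wt (scale k) (x - y)) * ennorm (f y))"

lemma avg_measurable:
  assumes [measurable]: "f \<in> borel_measurable borel" and "0 < \<sigma>"
  shows "avg \<sigma> k f \<in> borel_measurable borel"
  unfolding avg_def using assms by (simp add: Lq_pos)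

text \<open>The prefactor compensates the mass of the weight, so the normalised averages are bounded
  uniformly in k.\<close>

lemma Lq_avg_le:
  assumes \<theta>1: "0 \<le> \<theta>1" "\<theta>1 \<le> \<sigma>" and \<sigma>: "0 < \<sigma>" "\<sigma> \<le> 1" and [measurable]: "f \<in> borel_measurable borel"
  shows "Lq \<theta>1 lborel (\<lambda>x. ennreal ((2 ^ k) powr (\<rho> * real DIM('a) * \<sigma>)) * avg \<sigma> k f x) \<le>
     ennreal (pi powr (real DIM('a) * \<sigma>)) * nLq \<theta>1 f"
proof -
  let ?c = "ennreal ((2 ^ k) powr (\<rho> * real DIM('a) * \<sigma>))"
  note [measurable] = avg_measurable[OF assms(5) \<sigma>(1)]
  have "Lq \<theta>1 lborel (\<lambda>x. ?c * avg \<sigma> k f x) \<le> ?c * Lq \<theta>1 lborel (avg \<sigma> k f)"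
    using \<theta>1 by (intro Lq_cmult_le) auto
  also have "\<dots> \<le> ?c * (epow (ennreal ((pi / scale k) ^ DIM('a))) \<sigma> * nLq \<theta>1 f)"
    unfolding avg_def by (intro mult_left_mono Lq_wt_conv_le assms scale_pos) (use assms in auto)
  also have "epow (ennreal ((pi / scale k) ^ DIM('a))) \<sigma> = ennreal (pi powr (real DIM('a) * \<sigma>) * (2 ^ k) powr (- (\<rho> * real DIM('a) * \<sigma>)))"
  proof -
    have "(pi / scale k) ^ DIM('a) = (pi / scale k) powr real DIM('a)"
      using scale_pos[of k] by (intro powr_realpow[symmetric]) simp
    also have "\<dots> powr \<sigma> = pi powr (real DIM('a) * \<sigma>) * (scale k powr (- (real DIM('a) * \<sigma>)))"
      using scale_pos[of k] by (simp add: powr_powr powr_divide powr_minus_divide)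
    also have "scale k powr (- (real DIM('a) * \<sigma>)) = (2 ^ k) powr (- (\<rho> * real DIM('a) * \<sigma>))"
      by (simp add: scale_def powr_powr mult.assoc)
    finally show ?thesis using scale_pos[of k] by (simp add: epow_ennreal)
  qed
  also have "?c * (ennreal (pi powr (real DIM('a) * \<sigma>) * (2 ^ k) powr (- (\<rho> * real DIM('a) * \<sigma>))) * nLq \<theta>1 f) =
     ennreal (pi powr (real DIM('a) * \<sigma>)) * nLq \<theta>1 f"
  proof -
    have "?c * ennreal (pi powr (real DIM('a) * \<sigma>) * (2 ^ k) powr (- (\<rho> * real DIM('a) * \<sigma>))) = ennreal (pi powr (real DIM('a) * \<sigma>))"
      by (subst ennreal_mult[symmetric]) (auto simp: powr_minus)
    then show ?thesis by (simp add: mult.assoc[symmetric])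
  qed
  finally show ?thesis .
qed

text \<open>The majorants \<open>B k\<close> and the constants are chosen before f and g, as the
  final constant must depend on the symbol alone.\<close>

lemma piece_estimate:
  assumes s1: "1/2 \<le> \<sigma>1" "\<sigma>1 \<le> 1" "\<theta> \<le> \<sigma>1" and s2: "1/2 \<le> \<sigma>2" "\<sigma>2 \<le> 1" "\<theta> \<le> \<sigma>2"
  shows "\<exists>CB\<ge>0. \<exists>C\<ge>0. \<exists>B. (\<forall>k. B k \<in> borel_measurable borel \<and>
     Lq \<theta> lborel (B k) \<le> ennreal (CB * (2 ^ k) powr (m + 2 * real DIM('a) * \<theta>))) \<and>
     (\<forall>f g. integrable lborel f \<longrightarrow> integrable lborel g \<longrightarrow> (\<forall>k. AE x in lborel.
       ennorm (piece k f g x) \<le>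
         ennreal (C * (2 ^ k) powr (real DIM('a) * (\<sigma>1 + \<sigma>2 - 2 * \<theta>))) * B k x * avg \<sigma>1 k f x * avg \<sigma>2 k g x))"
proof -
  let ?D = "real DIM('a)"
  obtain CB where CB: "0 \<le> CB" "\<forall>k. \<exists>B. B \<in> borel_measurable borel \<and>
     Lq \<theta> lborel B \<le> ennreal (CB * (2 ^ k) powr (m + 2 * ?D * \<theta>)) \<and>
     (AE x in lborel. dominated k x (B x))"
    using Q_majorant by blast
  from choice[OF CB(2)] obtain B where B: "\<And>k. B k \<in> borel_measurable borel"
     "\<And>k. Lq \<theta> lborel (B k) \<le> ennreal (CB * (2 ^ k) powr (m + 2 * ?D * \<theta>))"
     "\<And>k. AE x in lborel. dominated k x (B k x)"
    by blast
  obtain C1 where C1: "0 < C1" "\<And>k (F::'a \<Rightarrow> complex). integrable lborel F \<Longrightarrow>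
    Lq (1 - \<theta>) lborel (\<lambda>\<xi>. indicator (cube k) \<xi> * ennorm (fourier F \<xi>)) \<le>
      ennreal (C1 * (2 ^ k) powr (?D * (\<sigma>1 - \<theta>))) * nLq \<sigma>1 F"
    using Hausdorff_Young_cube[OF s1(1,2) \<theta>(1) s1(3), where ?'a = 'a] by blast
  obtain C2 where C2: "0 < C2" "\<And>k (F::'a \<Rightarrow> complex). integrable lborel F \<Longrightarrow>
    Lq (1 - \<theta>) lborel (\<lambda>\<xi>. indicator (cube k) \<xi> * ennorm (fourier F \<xi>)) \<le>
      ennreal (C2 * (2 ^ k) powr (?D * (\<sigma>2 - \<theta>))) * nLq \<sigma>2 F"
    using Hausdorff_Young_cube[OF s2(1,2) \<theta>(1) s2(3), where ?'a = 'a] by blast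
  have main: "AE x in lborel. ennorm (piece k f g x) \<le>
         ennreal (C1 * C2 * (2 ^ k) powr (?D * (\<sigma>1 + \<sigma>2 - 2 * \<theta>))) * B k x * avg \<sigma>1 k f x * avg \<sigma>2 k g x"
    if f: "integrable lborel f" and g: "integrable lborel g" for f g k
    using B(3)[of k]
  proof (rule eventually_mono)
    fix x
    assume x: "dominated k x (B k x)"
    note [measurable] = integrable_lborel_measurable[OF f] integrable_lborel_measurable[OF g]
    define F where "F = (\<lambda>y. f y * cwt (scale k) (x - y))"
    define G where "G = (\<lambda>y. g y * cwt (scale k) (x - y))"
    have FG: "integrable lborel F" "integrable lborel G"
      unfolding F_def G_def by (intro integrable_mult_cwt f g)+
    have [measurable]: "F \<in> borel_measurable borel" "G \<in> borel_measurable borel"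
      unfolding F_def G_def by measurable
    define u where "u = (\<lambda>\<xi>. indicator (cube k) \<xi> * ennorm (fourier F \<xi>))"
    define v where "v = (\<lambda>\<xi>. indicator (cube k) \<xi> * ennorm (fourier G \<xi>))"
    have [measurable]: "u \<in> borel_measurable borel" "v \<in> borel_measurable borel"
      unfolding u_def v_def by measurable
    have aF: "nLq \<sigma>1 F = avg \<sigma>1 k f x"
      unfolding avg_def F_def by (simp add: norm_mult norm_cwt ennreal_mult less_imp_le[OF wt_pos] mult.commute)
    have aG: "nLq \<sigma>2 G = avg \<sigma>2 k g x"
      unfolding avg_def G_def by (simp add: norm_mult norm_cwt ennreal_mult less_imp_le[OF wt_pos] mult.commute)
    have "ennorm (piece k f g x) \<le> (\<integral>\<^sup>+ z. ennorm (Q k x z) * (u (fst z) * v (snd z)) \<partial>lborel)"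
      unfolding u_def v_def F_def G_def by (rule piece_le[OF f g])
    also have "\<dots> \<le> B k x * Lq (1 - \<theta>) lborel (\<lambda>z. u (fst z) * v (snd z))"
      using x by (auto simp: borel_prod[symmetric])
    also have "Lq (1 - \<theta>) lborel (\<lambda>z. u (fst z) * v (snd z)) \<le> Lq (1 - \<theta>) lborel u * Lq (1 - \<theta>) lborel v"
      unfolding lborel_prod[symmetric] using \<theta>
      by (intro Lq_tensor_le) (auto intro: lborel.sigma_finite_measure_axioms)
    also have "\<dots> \<le> (ennreal (C1 * (2 ^ k) powr (?D * (\<sigma>1 - \<theta>))) * avg \<sigma>1 k f x) *
        (ennreal (C2 * (2 ^ k) powr (?D * (\<sigma>2 - \<theta>))) * avg \<sigma>2 k g x)"
      using C1(2)[OF FG(1), of k] C2(2)[OF FG(2), of k] unfolding aF aG u_def v_def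
      by (intro mult_mono) auto
    also have "B k x * \<dots> = ennreal (C1 * C2 * (2 ^ k) powr (?D * (\<sigma>1 + \<sigma>2 - 2 * \<theta>))) * B k x * avg \<sigma>1 k f x * avg \<sigma>2 k g x"
    proof -
      have "?D * (\<sigma>1 + \<sigma>2 - 2 * \<theta>) = ?D * (\<sigma>1 - \<theta>) + ?D * (\<sigma>2 - \<theta>)" by (simp add: algebra_simps)
      then have eq: "C1 * C2 * (2 ^ k) powr (?D * (\<sigma>1 + \<sigma>2 - 2 * \<theta>)) =
          (C1 * (2 ^ k) powr (?D * (\<sigma>1 - \<theta>))) * (C2 * (2 ^ k) powr (?D * (\<sigma>2 - \<theta>)))"
        by (simp only: powr_add) (simp add: mult_ac)
      have "ennreal (C1 * C2 * (2 ^ k) powr (?D * (\<sigma>1 + \<sigma>2 - 2 * \<theta>))) =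
          ennreal (C1 * (2 ^ k) powr (?D * (\<sigma>1 - \<theta>))) * ennreal (C2 * (2 ^ k) powr (?D * (\<sigma>2 - \<theta>)))"
        unfolding eq using C1(1) C2(1) by (intro ennreal_mult) auto
      then show ?thesis by (simp only: mult_ac)
    qed
    finally show "ennorm (piece k f g x) \<le>
         ennreal (C1 * C2 * (2 ^ k) powr (?D * (\<sigma>1 + \<sigma>2 - 2 * \<theta>))) * B k x * avg \<sigma>1 k f x * avg \<sigma>2 k g x"
      by (simp add: mult_left_mono)
  qed
  have "0 \<le> C1 * C2" using C1(1) C2(1) by simp
  then show ?thesis using CB(1) B(1,2) main by blast
qed

text \<open>The indices \<sigma>i are free parameters: [1/2, 1] is the Hausdorff-Young range,
  \<theta> <= \<sigma>i permits Hoelder on the cube, and \<theta>i <= \<sigma>i bounds the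
  averages.\<close>

theorem Lq_pdo_le:
  assumes s1: "1/2 \<le> \<sigma>1" "\<sigma>1 \<le> 1" "\<theta> \<le> \<sigma>1" and s2: "1/2 \<le> \<sigma>2" "\<sigma>2 \<le> 1" "\<theta> \<le> \<sigma>2"
    and t1: "0 \<le> \<theta>1" "\<theta>1 \<le> \<sigma>1" and t2: "0 \<le> \<theta>2" "\<theta>2 \<le> \<sigma>2"
    and m: "m < real DIM('a) * (\<rho> - 1) * (\<sigma>1 + \<sigma>2)"
  shows "\<exists>C\<ge>0. \<forall>f g. integrable lborel f \<longrightarrow> integrable lborel g \<longrightarrow>
    nLq (\<theta> + \<theta>1 + \<theta>2) (\<lambda>x. pdo f g x) \<le>
      ennreal C * nLq \<theta>1 f * nLq \<theta>2 g"
proof -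
  let ?D = "real DIM('a)"
  let ?P = "\<lambda>f g B C k x. ennreal (C * (2 ^ k) powr (?D * (\<sigma>1 + \<sigma>2 - 2 * \<theta>))) * B k x * avg \<sigma>1 k f x * avg \<sigma>2 k g x"
  obtain CB C B where CB: "0 \<le> CB" and C: "0 \<le> C"
    and B12: "\<forall>k. B k \<in> borel_measurable borel \<and>
      Lq \<theta> lborel (B k) \<le> ennreal (CB * (2 ^ k) powr (m + 2 * ?D * \<theta>))"
    and P': "\<forall>f g. integrable lborel f \<longrightarrow> integrable lborel g \<longrightarrow> (\<forall>k. AE x in lborel.
       ennorm (piece k f g x) \<le>
         ?P f g B C k x)"
    using piece_estimate[OF s1 s2] by (elim exE conjE) (rule that; assumption)
  have B[measurable]: "B k \<in> borel_measurable borel" for k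
    using B12[THEN spec, of k] by (rule conjunct1)
  have BL: "Lq \<theta> lborel (B k) \<le> ennreal (CB * (2 ^ k) powr (m + 2 * ?D * \<theta>))" for k
    using B12[THEN spec, of k] by (rule conjunct2)
  note P = P'[THEN spec, THEN spec, THEN mp, THEN mp, THEN spec]
  \<comment> \<open>The gap in the strict inequality for m; the k-th piece decays like
    R^(-e).\<close>
  define e where "e = ?D * (\<rho> - 1) * (\<sigma>1 + \<sigma>2) - m"
  have e: "0 < e" using m by (simp add: e_def)
  \<comment> \<open>A third of the decay for each of the three series.\<close>
  define c where "c k = (2 ^ k :: real) powr (- e / 3)" for k :: nat
  have c0: "0 \<le> c k" for k by (simp add: c_def)
  have c_geo: "c k = (2 powr (- e / 3)) ^ k" for k
    by (simp add: c_def powr_realpow[symmetric] powr_powr mult.commute)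
  have q: "0 < 2 powr (- e / 3)" "2 powr (- e / 3) < (1::real)" using e by (auto simp: powr_less_one)
  define S where "S = 1 / (1 - 2 powr (- e / 3))"
  have S0: "0 < S" using q by (simp add: S_def)
  have S: "(\<Sum>k. ennreal (c k)) = ennreal S"
    unfolding c_geo S_def using q
    by (subst suminf_ennreal2) (auto simp: suminf_geometric summable_geometric)
  define b where "b k x = ennreal ((2 ^ k) powr (- (m + 2 * ?D * \<theta>))) * B k x" for k x
  have [measurable]: "b k \<in> borel_measurable borel" for k unfolding b_def by measurable
  have bL: "Lq \<theta> lborel (b k) \<le> ennreal CB" for k
  proof -
    have "Lq \<theta> lborel (b k) \<le> ennreal ((2 ^ k) powr (- (m + 2 * ?D * \<theta>))) * Lq \<theta> lborel (B k)"
      unfolding b_def using \<theta> by (intro Lq_cmult_le) auto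
    also have "\<dots> \<le> ennreal ((2 ^ k) powr (- (m + 2 * ?D * \<theta>))) * ennreal (CB * (2 ^ k) powr (m + 2 * ?D * \<theta>))"
      by (intro mult_left_mono BL) simp
    also have "\<dots> = ennreal CB"
    proof -
      have "(2 ^ k :: real) powr (- (m + 2 * ?D * \<theta>)) * (2 ^ k) powr (m + 2 * ?D * \<theta>) = 1"
        by (simp add: powr_add[symmetric])
      then have "(2 ^ k) powr (- (m + 2 * ?D * \<theta>)) * (CB * (2 ^ k) powr (m + 2 * ?D * \<theta>)) = CB"
        by (metis mult.left_commute mult.right_neutral)
      then show ?thesis using CB by (subst ennreal_mult[symmetric]) auto
    qed
    finally show ?thesis .
  qed
  define K where "K = C * (S * CB) * (S * pi powr (?D * \<sigma>1)) * (S * pi powr (?D * \<sigma>2))"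
  have "nLq (\<theta> + \<theta>1 + \<theta>2) (\<lambda>x. pdo f g x) \<le>
      ennreal K * nLq \<theta>1 f * nLq \<theta>2 g"
    if f: "integrable lborel f" and g: "integrable lborel g" for f g
  proof -
    note [measurable] = integrable_lborel_measurable[OF f] integrable_lborel_measurable[OF g]
    let ?Nf = "nLq \<theta>1 f" and ?Ng = "nLq \<theta>2 g"
    define F where "F k x = ennreal ((2 ^ k) powr (\<rho> * ?D * \<sigma>1)) * avg \<sigma>1 k f x" for k x
    define G where "G k x = ennreal ((2 ^ k) powr (\<rho> * ?D * \<sigma>2)) * avg \<sigma>2 k g x" for k x
    let ?t = "\<lambda>k x. (ennreal (c k) * b k x) * (ennreal (c k) * F k x) * (ennreal (c k) * G k x)"
    have [measurable]: "F k \<in> borel_measurable borel" "G k \<in> borel_measurable borel" for k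
      using avg_measurable[of f \<sigma>1 k] avg_measurable[of g \<sigma>2 k] s1 s2 unfolding F_def G_def by auto
    have FL: "Lq \<theta>1 lborel (F k) \<le> ennreal (pi powr (?D * \<sigma>1)) * ?Nf" for k
      unfolding F_def using s1 t1 by (intro Lq_avg_le) auto
    have GL: "Lq \<theta>2 lborel (G k) \<le> ennreal (pi powr (?D * \<sigma>2)) * ?Ng" for k
      unfolding G_def using s2 t2 by (intro Lq_avg_le) auto
    define Sb where "Sb x = (\<Sum>k. ennreal (c k) * b k x)" for x
    define SF where "SF x = (\<Sum>k. ennreal (c k) * F k x)" for x
    define SG where "SG x = (\<Sum>k. ennreal (c k) * G k x)" for x
    have [measurable]: "Sb \<in> borel_measurable borel" "SF \<in> borel_measurable borel" "SG \<in> borel_measurable borel"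
      unfolding Sb_def SF_def SG_def by measurable
    have SbL: "Lq \<theta> lborel Sb \<le> ennreal S * ennreal CB"
      unfolding Sb_def S[symmetric] using \<theta> by (intro Lq_suminf_le bL) auto
    have SFL: "Lq \<theta>1 lborel SF \<le> ennreal S * (ennreal (pi powr (?D * \<sigma>1)) * ?Nf)"
      unfolding SF_def S[symmetric] using t1 s1 by (intro Lq_suminf_le FL) auto
    have SGL: "Lq \<theta>2 lborel SG \<le> ennreal S * (ennreal (pi powr (?D * \<sigma>2)) * ?Ng)"
      unfolding SG_def S[symmetric] using t2 s2 by (intro Lq_suminf_le GL) auto
    \<comment> \<open>The powers of R are redistributed so that \<open>b\<close>, \<open>F\<close>
      and \<open>G\<close> have norms bounded in k and only the three factors \<open>c k\<close>
      remain.\<close>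
    have split: "?P f g B C k x =
       ennreal C * ?t k x" for k x
    proof -
      have "?D * (\<sigma>1 + \<sigma>2 - 2 * \<theta>) = (- e / 3) + (- (m + 2 * ?D * \<theta>)) + (- e / 3) + (\<rho> * ?D * \<sigma>1) + (- e / 3) + (\<rho> * ?D * \<sigma>2)"
        by (simp add: e_def field_simps)
      then have "(2 ^ k :: real) powr (?D * (\<sigma>1 + \<sigma>2 - 2 * \<theta>)) =
          c k * (2 ^ k) powr (- (m + 2 * ?D * \<theta>)) * c k * (2 ^ k) powr (\<rho> * ?D * \<sigma>1) * c k * (2 ^ k) powr (\<rho> * ?D * \<sigma>2)"
        unfolding c_def by (simp only: powr_add)
      then have "ennreal (C * (2 ^ k) powr (?D * (\<sigma>1 + \<sigma>2 - 2 * \<theta>))) =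
         ennreal C * (ennreal (c k) * ennreal ((2 ^ k) powr (- (m + 2 * ?D * \<theta>))) * ennreal (c k) *
           ennreal ((2 ^ k) powr (\<rho> * ?D * \<sigma>1)) * ennreal (c k) * ennreal ((2 ^ k) powr (\<rho> * ?D * \<sigma>2)))"
        using C c0[of k] by (simp add: ennreal_mult)
      then show ?thesis unfolding b_def F_def G_def by (simp only: mult_ac)
    qed
    have "AE x in lborel. \<forall>k. ennorm (piece k f g x) \<le>
       ennreal C * ?t k x"
      using P[OF f g] unfolding split by (simp add: AE_all_countable)
    then have "AE x in lborel. ennorm (pdo f g x) \<le> ennreal C * ((Sb x * SF x) * SG x)"
    proof (rule eventually_mono)
      fix x assume *: "\<forall>k. ennorm (piece k f g x) \<le>
         ennreal C * ?t k x"
      have "ennorm (pdo f g x) \<le> (\<Sum>k. ennorm (piece k f g x))"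
        by (rule pdo_le_suminf_piece)
      also have "\<dots> \<le> (\<Sum>k. ennreal C * ?t k x)"
        using * by (intro suminf_le) auto
      also have "\<dots> = ennreal C * (\<Sum>k. ?t k x)"
        by simp
      also have "\<dots> \<le> ennreal C * ((Sb x * SF x) * SG x)"
        unfolding Sb_def SF_def SG_def by (intro mult_left_mono suminf_mult3_le) simp
      finally show "ennorm (pdo f g x) \<le> ennreal C * ((Sb x * SF x) * SG x)" .
    qed
    then have "nLq (\<theta> + \<theta>1 + \<theta>2) (\<lambda>x. pdo f g x) \<le>
       Lq (\<theta> + \<theta>1 + \<theta>2) lborel (\<lambda>x. ennreal C * ((Sb x * SF x) * SG x))"
      using \<theta> t1 t2 pdo_measurable[of f g] by (intro Lq_mono_AE) auto
    also have "\<dots> \<le> ennreal C * Lq (\<theta> + \<theta>1 + \<theta>2) lborel (\<lambda>x. (Sb x * SF x) * SG x)"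
      using \<theta> t1 t2 by (intro Lq_cmult_le) auto
    also have "\<dots> \<le> ennreal C * (Lq (\<theta> + \<theta>1) lborel (\<lambda>x. Sb x * SF x) * Lq \<theta>2 lborel SG)"
      using \<theta> t1 t2 by (intro mult_left_mono Lq_Holder) auto
    also have "\<dots> \<le> ennreal C * ((Lq \<theta> lborel Sb * Lq \<theta>1 lborel SF) * Lq \<theta>2 lborel SG)"
      using \<theta> t1 t2 by (intro mult_left_mono mult_right_mono Lq_Holder) auto
    also have "\<dots> \<le> ennreal C * (((ennreal S * ennreal CB) * (ennreal S * (ennreal (pi powr (?D * \<sigma>1)) * ?Nf))) *
        (ennreal S * (ennreal (pi powr (?D * \<sigma>2)) * ?Ng)))"
      by (intro mult_left_mono mult_mono SbL SFL SGL) auto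
    also have "\<dots> = ennreal K * ?Nf * ?Ng"
    proof -
      have "ennreal K = ennreal C * (ennreal S * ennreal CB) * (ennreal S * ennreal (pi powr (?D * \<sigma>1))) * (ennreal S * ennreal (pi powr (?D * \<sigma>2)))"
        unfolding K_def using C CB S0 by (simp add: ennreal_mult)
      then show ?thesis by (simp only: mult_ac)
    qed
    finally show ?thesis .
  qed
  moreover have "0 \<le> K" unfolding K_def using C CB S0 by simp
  ultimately show ?thesis by blast
qed

end

section \<open>Schwartz functions, and the exponents of the statement\<close>

lemma inverse_wt_le:
  fixes x :: "'a::euclidean_space"
  shows "inverse (wt 1 x) \<le> 2 ^ DIM('a) * (1 + norm x ^ (2 * DIM('a)))"
proof -
  have p2: "(1 + t) ^ n \<le> 2 ^ n * (1 + t ^ n)" if "0 \<le> t" for t :: real and n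
  proof (cases "t \<le> 1")
    case True
    have "(1 + t) ^ n \<le> 2 ^ n" using True that by (intro power_mono) auto
    also have "\<dots> \<le> 2 ^ n * (1 + t ^ n)" using that by simp
    finally show ?thesis .
  next
    case False
    have "(1 + t) ^ n \<le> (2 * t) ^ n" using False by (intro power_mono) auto
    also have "\<dots> \<le> 2 ^ n * (1 + t ^ n)" by (simp add: power_mult_distrib)
    finally show ?thesis .
  qed
  have "inverse (wt 1 x) = (\<Prod>b\<in>Basis. 1 + (x \<bullet> b)\<^sup>2)"
    by (simp add: wt_def prod_inversef[symmetric, unfolded o_def])
  also have "\<dots> \<le> (\<Prod>b\<in>(Basis::'a set). 1 + (norm x)\<^sup>2)"
  proof (intro prod_mono conjI add_mono order_refl)
    fix b :: 'a assume "b \<in> Basis"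
    then show "(x \<bullet> b)\<^sup>2 \<le> (norm x)\<^sup>2" using Basis_le_norm[of b x] by (simp add: abs_le_square_iff[symmetric])
  qed auto
  also have "\<dots> = (1 + (norm x)\<^sup>2) ^ DIM('a)" by simp
  also have "\<dots> \<le> 2 ^ DIM('a) * (1 + norm x ^ (2 * DIM('a)))"
    using p2[of "(norm x)\<^sup>2" "DIM('a)"] by (simp add: power_mult)
  finally show ?thesis .
qed

text \<open>The decay bounds of orders 0 and 2n together dominate f by a multiple of the integrable
  weight \<open>wt 1\<close>.\<close>

lemma schwartz_integrable:
  fixes f :: "'a::euclidean_space \<Rightarrow> complex"
  assumes "schwartz f"
  shows "integrable lborel f"
proof -
  have d: "f differentiable (at x)" for x
    using assms unfolding schwartz_def by (metis empty_subsetI iter_partial.simps(1) list.set(1))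
  then have [measurable]: "f \<in> borel_measurable borel"
    by (intro borel_measurable_continuous_onI continuous_at_imp_continuous_on ballI differentiable_imp_continuous_within)
  have "bounded (range (\<lambda>x. norm x ^ j * norm (f x)))" for j
    using assms unfolding schwartz_def by (metis empty_subsetI iter_partial.simps(1) list.set(1))
  then have "\<exists>B. \<forall>x. norm x ^ j * norm (f x) \<le> B" for j
    unfolding bounded_iff by (metis UNIV_I abs_ge_self image_eqI order_trans real_norm_def)
  then obtain B where B: "\<And>j x. norm x ^ j * norm (f x) \<le> B j" by metis
  let ?n = "DIM('a)"
  define K where "K = 2 ^ ?n * (B 0 + B (2 * ?n))"
  have "norm (f x) \<le> K * wt 1 x" for x
  proof -
    have "inverse (wt 1 x) * norm (f x) \<le> 2 ^ ?n * (1 + norm x ^ (2 * ?n)) * norm (f x)"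
      by (intro mult_right_mono inverse_wt_le) simp
    also have "\<dots> = 2 ^ ?n * (norm x ^ 0 * norm (f x) + norm x ^ (2 * ?n) * norm (f x))"
      by (simp add: algebra_simps)
    also have "\<dots> \<le> K" unfolding K_def by (intro mult_left_mono add_mono B) simp
    finally show ?thesis using wt_pos[of 1 x] by (simp add: field_simps)
  qed
  moreover have "integrable lborel (\<lambda>x::'a. K * wt 1 x)"
  proof -
    have "integrable lborel (wt 1 :: 'a \<Rightarrow> real)"
      by (rule integrableI_bounded) (auto simp: nn_integral_wt less_imp_le[OF wt_pos])
    then show ?thesis by simp
  qed
  ultimately show ?thesis
    by (intro Bochner_Integration.integrable_bound[of lborel "\<lambda>x. K * wt 1 x" f] AE_I2)
       (auto intro: order_trans abs_ge_self)
qed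

lemma has_vector_derivative_partial:
  assumes "f differentiable (at z)"
  shows "((\<lambda>t. f (z + t *\<^sub>R b)) has_vector_derivative partial b f z) (at 0)"
proof -
  have "(\<lambda>t. f (z + t *\<^sub>R b)) differentiable (at (0::real))"
    by (rule differentiable_compose[of f]) (use assms in \<open>auto intro!: derivative_intros\<close>)
  then show ?thesis unfolding partial_def by (simp add: vector_derivative_works)
qed

lemma ennreal_inverse_antimono:
  fixes a b :: ennreal
  assumes "a \<le> b"
  shows "inverse b \<le> inverse a"
proof (cases "a = 0 \<or> b = \<top>")
  case False
  then obtain r s where "a = ennreal r" "b = ennreal s" "0 < r" "0 < s"
    using assms by (cases a; cases b) (auto simp: top_unique less_le)
  then show ?thesis using assms by (simp add: inverse_ennreal le_imp_inverse_le)
qed auto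

lemma ennreal_inverse_inverse: "inverse (inverse x) = (x::ennreal)"
proof (cases "x = 0 \<or> x = \<top>")
  case False
  then obtain r where "x = ennreal r" "0 < r" by (cases x) (auto simp: less_le)
  then show ?thesis by (simp add: inverse_ennreal)
qed auto

lemma enn2real_inverse_min:
  assumes "a \<noteq> 0" "b \<noteq> (0::ennreal)"
  shows "enn2real (inverse (min a b)) = max (enn2real (inverse a)) (enn2real (inverse b))"
proof -
  have fin: "inverse a < \<top>" "inverse b < \<top>" using assms by (auto simp: less_top[symmetric])
  show ?thesis
  proof (cases "a \<le> b")
    case True
    then have "enn2real (inverse b) \<le> enn2real (inverse a)"
      using fin by (intro enn2real_mono ennreal_inverse_antimono) auto
    then show ?thesis using True by (simp add: min_def)
  next
    case False
    then have "enn2real (inverse a) \<le> enn2real (inverse b)"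
      using fin by (intro enn2real_mono ennreal_inverse_antimono) auto
    then show ?thesis using False by (simp add: min_def)
  qed
qed

lemma enn2real_inverse_le_1:
  assumes "1 \<le> (p::ennreal)"
  shows "enn2real (inverse p) \<le> 1" "inverse p \<noteq> \<top>" "p \<noteq> 0" "inverse p \<le> 1"
proof -
  show le: "inverse p \<le> 1" using ennreal_inverse_antimono[OF assms] by simp
  then show "enn2real (inverse p) \<le> 1" using enn2real_mono[OF le] by simp
  show "inverse p \<noteq> \<top>" using le by (auto simp: top_unique)
  show "p \<noteq> 0" using assms by auto
qed

lemma LpS_imp_Lp_symbol:
  assumes p: "1 \<le> p" and "0 \<le> \<rho>" "\<rho> \<le> 1" and a: "LpS p m \<rho> a"
  shows "Lp_symbol (\<lambda>x l. iter_partial l (\<lambda>z. a x (fst z) (snd z))) (enn2real (inverse p)) m \<rho>"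
proof
  have d: "iter_partial l (\<lambda>z. a x (fst z) (snd z)) differentiable (at z)" if "set l \<subseteq> Basis" for x l z
    using a that unfolding LpS_def by blast
  show "0 \<le> enn2real (inverse p)" "enn2real (inverse p) \<le> 1" "0 \<le> \<rho>" "\<rho> \<le> 1"
    using enn2real_inverse_le_1[OF p] assms by auto
  fix l :: "('a \<times> 'a) list" assume l: "set l \<subseteq> Basis"
  show "((\<lambda>t. iter_partial l (\<lambda>z. a x (fst z) (snd z)) (z + t *\<^sub>R b)) has_vector_derivative
      iter_partial (b # l) (\<lambda>z. a x (fst z) (snd z)) z) (at 0)" for x b z
    using has_vector_derivative_partial[OF d[OF l]] by simp
  show "continuous_on UNIV (iter_partial l (\<lambda>z. a x (fst z) (snd z)))" for x
    using d[OF l] by (intro continuous_at_imp_continuous_on ballI differentiable_imp_continuous_within)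
  have m: "(\<lambda>x. iter_partial l (\<lambda>z. a x (fst z) (snd z)) (fst z, snd z)) \<in> borel_measurable lborel" for z
    using a l unfolding LpS_def by blast
  then show "(\<lambda>x. iter_partial l (\<lambda>z. a x (fst z) (snd z)) z) \<in> borel_measurable borel" for z
    by simp
  obtain C where C: "\<And>\<xi> \<eta>. Lp_norm p (\<lambda>x. iter_partial l (\<lambda>z. a x (fst z) (snd z)) (\<xi>, \<eta>))
       \<le> ennreal (C * (1 + norm \<xi> + norm \<eta>) powr (m - \<rho> * real (length l)))"
    using a l unfolding LpS_def by blast
  show "\<exists>C. \<forall>z. nLq (enn2real (inverse p)) (\<lambda>x. iter_partial l (\<lambda>z. a x (fst z) (snd z)) z)
       \<le> ennreal (C * (1 + norm (fst z) + norm (snd z)) powr (m - \<rho> * real (length l)))"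
    using C enn2real_inverse_le_1(3)[OF p] by (intro exI[of _ C]) (auto simp: Lp_norm_eq_Lq)
qed

theorem theorem5p17:
  fixes a :: "'a::euclidean_space \<Rightarrow> 'a \<Rightarrow> 'a \<Rightarrow> complex"
    and p q1 q2 r :: ennreal and m \<rho> :: real
  assumes "1 \<le> p" and "1 \<le> q1" and "1 \<le> q2"
    and "inverse r = inverse p + inverse q1 + inverse q2"
    and "max q1 q2 \<ge> conj_exp p"
    and "0 \<le> \<rho>" and "\<rho> \<le> 1"
    and "LpS p m \<rho> a"
    and "m < real DIM('a) * (\<rho> - 1) *
           enn2real (inverse (min 2 (min (max q1 q2) p))
             + inverse (min 2 (min (min q1 q2) (inverse (inverse p + inverse (max q1 q2))))))"
  shows "\<exists>C. \<forall>f g. schwartz f \<longrightarrow> schwartz g \<longrightarrow>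
           Lp_norm r (bilinear_pdo a f g) \<le> ennreal C * Lp_norm q1 f * Lp_norm q2 g"
proof -
  interpret Lp_symbol "\<lambda>x l. iter_partial l (\<lambda>z. a x (fst z) (snd z))" "enn2real (inverse p)" m \<rho>
    using assms by (intro LpS_imp_Lp_symbol)
  note P = enn2real_inverse_le_1[OF assms(1)]
  note Q1 = enn2real_inverse_le_1[OF assms(2)]
  note Q2 = enn2real_inverse_le_1[OF assms(3)]
  let ?p = "enn2real (inverse p)" and ?q1 = "enn2real (inverse q1)" and ?q2 = "enn2real (inverse q2)"
  have pdo: "bilinear_pdo a f g = pdo f g" for f g
    unfolding bilinear_pdo_def pdo_def by (simp add: fun_eq_iff)
  have "inverse r \<noteq> \<top>" unfolding assms(4) using P(2) Q1(2) Q2(2) by simp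
  then have r0: "r \<noteq> 0" by auto
  have lt: "inverse p < \<top>" "inverse q1 < \<top>" "inverse q2 < \<top>"
    using P(2) Q1(2) Q2(2) by (simp_all only: less_top)
  have r: "enn2real (inverse r) = ?p + ?q1 + ?q2"
    unfolding assms(4) by (simp add: enn2real_plus lt)
  have half: "enn2real (inverse 2) = 1/2"
    by (subst ennreal_half[symmetric], rule enn2real_ennreal) simp
  have *: "\<exists>C. \<forall>f g. schwartz f \<longrightarrow> schwartz g \<longrightarrow>
           Lp_norm r (bilinear_pdo a f g) \<le> ennreal C * Lp_norm q1 f * Lp_norm q2 g"
    if s: "1/2 \<le> \<sigma>1" "\<sigma>1 \<le> 1" "?p \<le> \<sigma>1" "1/2 \<le> \<sigma>2" "\<sigma>2 \<le> 1" "?p \<le> \<sigma>2" "?q1 \<le> \<sigma>1" "?q2 \<le> \<sigma>2"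
      and m: "m < real DIM('a) * (\<rho> - 1) * (\<sigma>1 + \<sigma>2)" for \<sigma>1 \<sigma>2
  proof -
    obtain C where "\<forall>f g. integrable lborel f \<longrightarrow> integrable lborel g \<longrightarrow>
       nLq (?p + ?q1 + ?q2) (\<lambda>x. pdo f g x) \<le>
      ennreal C * nLq ?q1 f * nLq ?q2 g"
      using Lq_pdo_le[OF s(1-6) _ s(7) _ s(8) m] by auto
    then show ?thesis
      using P(3) Q1(3) Q2(3) r0
      by (intro exI[of _ C]) (auto simp: Lp_norm_eq_Lq r pdo schwartz_integrable)
  qed
  \<comment> \<open>The reciprocal of the first minimum when q is the larger exponent; reciprocals
    turn minima into maxima.\<close>
  define \<sigma> where "\<sigma> q = max (1/2) (max (enn2real (inverse q)) ?p)" for q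
  \<comment> \<open>The reciprocal of the second minimum, with q the smaller and q' the larger
    exponent; 1/p + 1/q' inverts p q'/(p + q'), including the convention for p =
    \<infinity>.\<close>
  define \<sigma>' where "\<sigma>' q q' = max (1/2) (max (enn2real (inverse q)) (?p + enn2real (inverse q')))" for q q'
  \<comment> \<open>The hypothesis that the larger exponent is at least p' enters here: it keeps
    \<open>\<sigma>'\<close> at most 1, inside the Hausdorff-Young range.\<close>
  have conj: "?p + enn2real (inverse q) \<le> 1" if q: "conj_exp p \<le> q" "1 \<le> q" for q
  proof -
    have "inverse q \<le> inverse (conj_exp p)" using q by (intro ennreal_inverse_antimono)
    also have "\<dots> = 1 - inverse p" by (simp add: conj_exp_def ennreal_inverse_inverse)
    finally have "inverse p + inverse q \<le> inverse p + (1 - inverse p)" by (rule add_left_mono)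
    also have "\<dots> = 1" using P(4) by (rule add_diff_inverse_ennreal)
    finally have "enn2real (inverse p + inverse q) \<le> 1" using enn2real_mono[of _ 1] by simp
    moreover have "inverse q < \<top>" using enn2real_inverse_le_1(2)[OF q(2)] by (simp only: less_top)
    ultimately show ?thesis using lt by (simp add: enn2real_plus)
  qed
  have rw: "enn2real (inverse (min 2 (min q p)) + inverse (min 2 (min q' (inverse (inverse p + inverse q))))) = \<sigma> q + \<sigma>' q' q"
    if q: "1 \<le> q" "1 \<le> q'" for q q'
  proof -
    note q' = enn2real_inverse_le_1[OF q(1)] enn2real_inverse_le_1[OF q(2)]
    have lq: "inverse q < \<top>" using q'(2) by (simp only: less_top)
    have pq: "inverse p + inverse q \<noteq> \<top>" using P(2) q' by simp
    have 1: "enn2real (inverse (min 2 (min q p))) = \<sigma> q"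
    proof -
      have "min q p \<noteq> 0" using P(3) q' by (simp add: min_def)
      then show ?thesis using P(3) q' by (simp add: enn2real_inverse_min half \<sigma>_def)
    qed
    have i0: "inverse (inverse p + inverse q) \<noteq> 0" using pq by simp
    have 2: "enn2real (inverse (min 2 (min q' (inverse (inverse p + inverse q))))) = \<sigma>' q' q"
    proof -
      have "enn2real (inverse (min q' (inverse (inverse p + inverse q)))) = max (enn2real (inverse q')) (?p + enn2real (inverse q))"
        using q' i0 lt(1) lq by (subst enn2real_inverse_min) (auto simp: enn2real_plus ennreal_inverse_inverse)
      moreover have "min q' (inverse (inverse p + inverse q)) \<noteq> 0" using q' i0 by (simp add: min_def)
      ultimately show ?thesis by (simp add: enn2real_inverse_min half \<sigma>'_def)
    qed
    have "inverse (min 2 (min q p)) \<noteq> \<top>" "inverse (min 2 (min q' (inverse (inverse p + inverse q)))) \<noteq> \<top>"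
      using P(3) q' i0 by (auto simp: min_def)
    then show ?thesis unfolding less_top by (simp add: enn2real_plus 1 2)
  qed
  \<comment> \<open>The function with the larger exponent receives \<open>\<sigma>\<close> and the
    other \<open>\<sigma>'\<close>; the two orderings differ only in which function is
    which.\<close>
  show ?thesis
  proof (cases "q2 \<le> q1")
    case True
    then have c: "?p + ?q1 \<le> 1" using conj[of q1] assms(2,5) by (simp add: max_def split: if_splits)
    have "m < real DIM('a) * (\<rho> - 1) * (\<sigma> q1 + \<sigma>' q2 q1)"
      using assms(9) True rw[OF assms(2,3)] by (simp add: max_absorb1 min_absorb2)
    then show ?thesis
      using c P(1) Q1(1) Q2(1) by (intro *[of "\<sigma> q1" "\<sigma>' q2 q1"]) (auto simp: \<sigma>_def \<sigma>'_def le_max_iff_disj)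
  next
    case False
    then have c: "?p + ?q2 \<le> 1" using conj[of q2] assms(3,5) by (simp add: max_def split: if_splits)
    have "m < real DIM('a) * (\<rho> - 1) * (\<sigma>' q1 q2 + \<sigma> q2)"
      using assms(9) False rw[OF assms(3,2)] by (simp add: max_absorb2 min_absorb1 add.commute)
    then show ?thesis
      using c P(1) Q1(1) Q2(1) by (intro *[of "\<sigma>' q1 q2" "\<sigma> q2"]) (auto simp: \<sigma>_def \<sigma>'_def le_max_iff_disj)
  qed
qed

end
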